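(* Bar-Natan's scanning algorithm and Bar-Natan's divide-and-conquer algorithm for computing the Khovanov homology of a link from a link diagram run in exponential time with respect to the number of crossings of the diagram, i.e. their worst-case number of steps grows at least exponentially in the number of crossings. This remains true when the input diagrams are restricted to closures of positive braid words on $3$ strands, and also when the input diagrams are restricted to alternating closed $3$-braid diagrams.
   Context: Braids: a braid word on $3$ strands is a word in $\sigma_1,\sigma_2,\sigma_1^{-1},\sigma_2^{-1}$, whose closure is a link diagram with one crossing per letter. It is positive if only $\sigma_1,\sigma_2$ occur; its closure is an alternating diagram for instance if it is a word in $\sigma_1^{-1}$ and $\sigma_2$ only (involving both letters). Bar-Natan's category: for a disc $B$ with $2n$ marked boundary points, objects are formal finite direct sums of $q$-shifted crossingless tangle diagrams in $B$ with these endpoints, and morphisms are matrices of $R$-linear combinations ($R=\mathbb Z$ or a field) of isotopy classes of dotted cobordisms in $B\times[0,1]$, modulo: an undotted sphere is $0$, a sphere with one dot is $1$, two dots on the same component give $0$, and the neck-cutting relation (a tube equals the sum of the two ways of cutting it into two discs with a dot on exactly one of the discs). A crossing is assigned the two-term complex (one smoothing) $\to$ (other smoothing) with differential a saddle cobordism; gluing tangles corresponds to tensoring complexes, and this assigns to each tangle diagram $T$ a complex, which for a link diagram recovers the Khovanov complex. Delooping: a diagram containing a closed circle is isomorphic to the direct sum of two $q$-shifted (by $+1$ and $-1$) copies of the diagram with the circle deleted. Gaussian elimination: if a matrix entry $\varphi\colon b\to b'$ of the differential between two summands is an isomorphism, then $b,b'$ may be removed, up to chain homotopy equivalence, the differential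 $\varepsilon$ between the remaining summands being replaced by $\varepsilon-\gamma\varphi^{-1}\delta$, where $\delta$ and $\gamma$ are the matrix blocks of the differential from the remaining summands into $b'$ and from $b$ into the remaining summands. Scanning algorithm: given a link diagram, order its crossings; start with the complex of the first crossing; repeatedly tensor the current complex with the complex of the next crossing (gluing according to the diagram), deloop all closed circles, and perform Gaussian eliminations until no isomorphism entries remain; after the last crossing, one has a finite complex of free modules with an explicitly stored basis, chain homotopy equivalent to the Khovanov complex, whose homology is computed by standard linear algebra. Divide-and-conquer algorithm: the same, except that the diagram is recursively cut into two smaller tangles, the complex of each is recursively computed and simplified by delooping and Gaussian elimination, and the two simplified complexes are then tensored together and simplified again. *)

theory Defs
  imports Complex_Main "HOL-Library.Multiset" "HOL-Library.Poly_Mapping"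
begin

section \<open>Crossingless tangle diagrams\<close>

text \<open>
  Edges of link diagrams are labelled by natural numbers.  A crossingless tangle diagram is
  recorded, up to isotopy, as the set of its curves: an arc is given by the labels of its two
  endpoints, a closed circle by a nonempty set of labels, which only serves as its name.
\<close>

datatype curve = Arc "nat set" | Circle "nat set"

type_synonym shape = "curve set"

primrec ends :: "curve \<Rightarrow> nat set" where
  "ends (Arc s) = s"
| "ends (Circle s) = {}"

primrec labels :: "curve \<Rightarrow> nat set" where
  "labels (Arc s) = s"
| "labels (Circle s) = s"

primrec curve_chi :: "curve \<Rightarrow> int" where
  "curve_chi (Arc s) = 1"
| "curve_chi (Circle s) = 0"

definition adj_classes :: "('a \<Rightarrow> 'a \<Rightarrow> bool) \<Rightarrow> 'a set \<Rightarrow> 'a set set" where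
  "adj_classes adj A =
     A // {(x, y). x \<in> A \<and> y \<in> A \<and>
            (x, y) \<in> {(u, v). u \<in> A \<and> v \<in> A \<and> (adj u v \<or> adj v u)}\<^sup>*}"

fun share_end :: "curve + curve \<Rightarrow> curve + curve \<Rightarrow> bool" where
  "share_end (Inl c) (Inr d) \<longleftrightarrow> ends c \<inter> ends d \<noteq> {}"
| "share_end _ _ \<longleftrightarrow> False"

definition glue_classes :: "shape \<Rightarrow> shape \<Rightarrow> (curve + curve) set set" where
  "glue_classes a b = adj_classes share_end (Inl ` a \<union> Inr ` b)"

abbreviation untag :: "'a + 'a \<Rightarrow> 'a" where
  "untag \<equiv> case_sum id id"

definition free_ends :: "(curve + curve) set \<Rightarrow> nat set" where
  "free_ends W = {l. card {u \<in> W. l \<in> ends (untag u)} = 1}"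

definition join :: "(curve + curve) set \<Rightarrow> curve" where
  "join W = (if free_ends W = {} then Circle (\<Union>u\<in>W. labels (untag u)) else Arc (free_ends W))"

text \<open>Planar gluing of two diagrams along the endpoints that carry the same label.\<close>

definition glue :: "shape \<Rightarrow> shape \<Rightarrow> shape" where
  "glue a b = join ` glue_classes a b"

definition strand :: "nat \<Rightarrow> nat \<Rightarrow> shape" where
  "strand i j = (if i = j then {Circle {i}} else {Arc {i, j}})"


section \<open>Dotted cobordisms\<close>

text \<open>
  A dotted cobordism is recorded as the multiset of its connected components.  A component is
  given by the curves of the lower and of the upper diagram it contains, its Euler
  characteristic and its number of dots.  Embedded cobordisms with the same data differ at most
  by knotting and nesting, and become equal modulo the neck-cutting relation.
\<close>

datatype sheet = Sheet (lower: shape) (upper: shape) (chi: int) (dots: nat)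

type_synonym cob = "sheet multiset"

definition closed_sheet :: "sheet \<Rightarrow> bool" where
  "closed_sheet x \<longleftrightarrow> lower x = {} \<and> upper x = {}"

text \<open>The boundary circles of a sheet are the circles obtained by gluing its lower curves to its
  upper curves; the vertical boundary intervals over common endpoints are contracted.\<close>

definition valid_sheet :: "sheet \<Rightarrow> bool" where
  "valid_sheet x \<longleftrightarrow>
     (\<exists>genus::nat. chi x = 2 - 2 * int genus - int (card (glue_classes (lower x) (upper x))))"

definition cobs :: "shape \<Rightarrow> shape \<Rightarrow> cob set" where
  "cobs a b = {K.
     (\<forall>x \<in># K. valid_sheet x \<and> lower x \<subseteq> a \<and> upper x \<subseteq> b) \<and>
     (\<forall>c \<in> a. size {#x \<in># K. c \<in> lower x#} = 1) \<and>
     (\<forall>c \<in> b. size {#x \<in># K. c \<in> upper x#} = 1) \<and>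
     (\<forall>x \<in># K. \<forall>c \<in> lower x. \<forall>d \<in> b. ends c \<inter> ends d \<noteq> {} \<longrightarrow> d \<in> upper x)}"

definition id_cob :: "shape \<Rightarrow> cob" where
  "id_cob a = image_mset (\<lambda>c. Sheet {c} {c} (curve_chi c) 0) (mset_set a)"

text \<open>Vertical composition, first \<open>K\<close> and then \<open>L\<close>: the sheets of \<open>K\<close> and \<open>L\<close> that
  contain a common curve of the middle diagram are glued along it.\<close>

fun share_curve :: "sheet + sheet \<Rightarrow> sheet + sheet \<Rightarrow> bool" where
  "share_curve (Inl x) (Inr y) \<longleftrightarrow> upper x \<inter> lower y \<noteq> {}"
| "share_curve _ _ \<longleftrightarrow> False"

definition vmerge :: "(sheet + sheet) set \<Rightarrow> sheet" where
  "vmerge U =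
     (let X = {x. Inl x \<in> U}; Y = {y. Inr y \<in> U} in
      Sheet (\<Union>x\<in>X. lower x) (\<Union>y\<in>Y. upper y)
        ((\<Sum>x\<in>X. chi x) + (\<Sum>y\<in>Y. chi y) - (\<Sum>c\<in>(\<Union>x\<in>X. upper x). curve_chi c))
        ((\<Sum>x\<in>X. dots x) + (\<Sum>y\<in>Y. dots y)))"

definition open_sheets :: "cob \<Rightarrow> cob \<Rightarrow> (sheet + sheet) set" where
  "open_sheets K L =
     Inl ` {x \<in> set_mset K. \<not> closed_sheet x} \<union> Inr ` {y \<in> set_mset L. \<not> closed_sheet y}"

definition vcomp :: "cob \<Rightarrow> cob \<Rightarrow> cob" where
  "vcomp K L = filter_mset closed_sheet K + filter_mset closed_sheet L +
     image_mset vmerge (mset_set (adj_classes share_curve (open_sheets K L)))"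

text \<open>Horizontal gluing: sheets are glued along the vertical intervals over common endpoints.\<close>

definition sheet_ends :: "sheet \<Rightarrow> nat set" where
  "sheet_ends x = (\<Union>c \<in> lower x \<union> upper x. ends c)"

fun share_side :: "sheet + sheet \<Rightarrow> sheet + sheet \<Rightarrow> bool" where
  "share_side (Inl x) (Inr y) \<longleftrightarrow> sheet_ends x \<inter> sheet_ends y \<noteq> {}"
| "share_side _ _ \<longleftrightarrow> False"

definition hmerge :: "(sheet + sheet) set \<Rightarrow> sheet" where
  "hmerge U =
     (let X = {x. Inl x \<in> U}; Y = {y. Inr y \<in> U} in
      Sheet (glue (\<Union>x\<in>X. lower x) (\<Union>y\<in>Y. lower y)) (glue (\<Union>x\<in>X. upper x) (\<Union>y\<in>Y. upper y))
        ((\<Sum>x\<in>X. chi x) + (\<Sum>y\<in>Y. chi y)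
           - int (card ((\<Union>x\<in>X. sheet_ends x) \<inter> (\<Union>y\<in>Y. sheet_ends y))))
        ((\<Sum>x\<in>X. dots x) + (\<Sum>y\<in>Y. dots y)))"

definition hcomp :: "cob \<Rightarrow> cob \<Rightarrow> cob" where
  "hcomp K L = filter_mset closed_sheet K + filter_mset closed_sheet L +
     image_mset hmerge (mset_set (adj_classes share_side (open_sheets K L)))"

text \<open>The degree of a cobordism with lower diagram \<open>a\<close>; the number of arcs of \<open>a\<close> is half the
  number of marked boundary points.\<close>

definition cob_degree :: "shape \<Rightarrow> cob \<Rightarrow> int" where
  "cob_degree a K = (\<Sum>x\<in>#K. chi x - 2 * int (dots x)) - (\<Sum>c\<in>a. curve_chi c)"


section \<open>Bar-Natan's category\<close>

text \<open>
  Morphisms are represented by formal linear combinations of cobordisms; equality of morphisms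
  is equality of the representatives modulo the submodule \<open>null_mors\<close> spanned by the relations.
\<close>

type_synonym 'r mor = "cob \<Rightarrow>\<^sub>0 'r"

definition scale :: "'r::comm_ring_1 \<Rightarrow> 'r mor \<Rightarrow> 'r mor" where
  "scale r f = (\<Sum>K\<in>Poly_Mapping.keys f. Poly_Mapping.single K (r * Poly_Mapping.lookup f K))"

definition bilinear :: "(cob \<Rightarrow> cob \<Rightarrow> cob) \<Rightarrow> 'r::comm_ring_1 mor \<Rightarrow> 'r mor \<Rightarrow> 'r mor" where
  "bilinear mul f g = (\<Sum>K\<in>Poly_Mapping.keys f. \<Sum>L\<in>Poly_Mapping.keys g.
     Poly_Mapping.single (mul K L) (Poly_Mapping.lookup f K * Poly_Mapping.lookup g L))"

abbreviation of_cob :: "cob \<Rightarrow> 'r::comm_ring_1 mor" where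
  "of_cob K \<equiv> Poly_Mapping.single K 1"

inductive_set null_mors :: "shape \<Rightarrow> shape \<Rightarrow> 'r::comm_ring_1 mor set"
  for a b :: shape where
  zero: "0 \<in> null_mors a b"
| add: "f \<in> null_mors a b \<Longrightarrow> g \<in> null_mors a b \<Longrightarrow> f + g \<in> null_mors a b"
| scale: "f \<in> null_mors a b \<Longrightarrow> scale r f \<in> null_mors a b"
| sphere: "K \<in> cobs a b \<Longrightarrow> of_cob (K + {#Sheet {} {} 2 0#}) \<in> null_mors a b"
| dotted_sphere: "K \<in> cobs a b \<Longrightarrow> of_cob (K + {#Sheet {} {} 2 1#}) - of_cob K \<in> null_mors a b"
| two_dots: "K + {#Sheet S T e (d + 2)#} \<in> cobs a b \<Longrightarrow>
     of_cob (K + {#Sheet S T e (d + 2)#}) \<in> null_mors a b"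
| neck_separating: "K + {#Sheet S T e d, Sheet S' T' e' d'#} \<in> cobs a b \<Longrightarrow>
     of_cob (K + {#Sheet (S \<union> S') (T \<union> T') (e + e' - 2) (d + d')#})
       - of_cob (K + {#Sheet S T e (d + 1), Sheet S' T' e' d'#})
       - of_cob (K + {#Sheet S T e d, Sheet S' T' e' (d' + 1)#}) \<in> null_mors a b"
| neck_nonseparating: "K + {#Sheet S T e d#} \<in> cobs a b \<Longrightarrow>
     of_cob (K + {#Sheet S T (e - 2) d#})
       - of_cob (K + {#Sheet S T e (d + 1)#})
       - of_cob (K + {#Sheet S T e (d + 1)#}) \<in> null_mors a b"

text \<open>Degree-preserving morphisms from \<open>a{m}\<close> to \<open>b{n}\<close>, where \<open>{_}\<close> is the \<open>q\<close>-shift.\<close>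

definition homs :: "shape \<times> int \<Rightarrow> shape \<times> int \<Rightarrow> 'r::comm_ring_1 mor set" where
  "homs x y = {f. \<forall>K\<in>Poly_Mapping.keys f.
     K \<in> cobs (fst x) (fst y) \<and> cob_degree (fst x) K + snd y - snd x = 0}"

definition inverse_mors ::
    "shape \<times> int \<Rightarrow> shape \<times> int \<Rightarrow> 'r::comm_ring_1 mor \<Rightarrow> 'r mor \<Rightarrow> bool" where
  "inverse_mors x y f g \<longleftrightarrow> f \<in> homs x y \<and> g \<in> homs y x \<and>
     bilinear vcomp f g - of_cob (id_cob (fst x)) \<in> null_mors (fst x) (fst x) \<and>
     bilinear vcomp g f - of_cob (id_cob (fst y)) \<in> null_mors (fst y) (fst y)"


section \<open>Complexes\<close>

text \<open>The stored basis of a complex is a finite set of named summands \<open>shape g {qdeg g}\<close>; the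
  entry \<open>diff C g h\<close> of the differential is a morphism from \<open>g\<close> to \<open>h\<close>.\<close>

datatype name = Smooth0 | Smooth1 | Only | Tens name name | DelPlus name | DelMinus name

record (overloaded) 'r cpx =
  gens :: "name set"
  hdeg :: "name \<Rightarrow> int"
  qdeg :: "name \<Rightarrow> int"
  shape :: "name \<Rightarrow> shape"
  diff :: "name \<Rightarrow> name \<Rightarrow> 'r mor"

definition obj :: "'r cpx \<Rightarrow> name \<Rightarrow> shape \<times> int" where
  "obj C g = (shape C g, qdeg C g)"

definition nonzero_entries :: "'r::comm_ring_1 cpx \<Rightarrow> (name \<times> name) set" where
  "nonzero_entries C =
     {(g, h). g \<in> gens C \<and> h \<in> gens C \<and> diff C g h \<notin> null_mors (shape C g) (shape C h)}"

definition storage :: "'r::comm_ring_1 cpx \<Rightarrow> nat" where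
  "storage C = card (gens C) + card (nonzero_entries C)"

text \<open>
  Crossings are given as in a planar diagram code: the four edges in counterclockwise order,
  starting with the incoming lower edge.  The over strand runs from the fourth to the second
  edge at a positive crossing and from the second to the fourth edge at a negative one.
  \<open>Loop e\<close> is a closed component without crossings.
\<close>

datatype piece = Pos nat nat nat nat | Neg nat nat nat nat | Loop nat

definition crossing_cpx :: "int \<Rightarrow> int \<Rightarrow> nat \<Rightarrow> nat \<Rightarrow> nat \<Rightarrow> nat \<Rightarrow> 'r::comm_ring_1 cpx" where
  "crossing_cpx h q i j k l =
     (let s0 = glue (strand i j) (strand k l); s1 = glue (strand i l) (strand j k) in
      \<lparr>gens = {Smooth0, Smooth1},
       hdeg = (\<lambda>g. if g = Smooth0 then h else h + 1),
       qdeg = (\<lambda>g. if g = Smooth0 then q else q + 1),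
       shape = (\<lambda>g. if g = Smooth0 then s0 else s1),
       diff = (\<lambda>g g'. if g = Smooth0 \<and> g' = Smooth1
                then of_cob {#Sheet s0 s1 (int (card {i, j, k, l}) - 3) 0#} else 0)\<rparr>)"
  \<comment> \<open>The saddle is a disc, glued to itself along the interval over each repeated label.\<close>

primrec piece_cpx :: "piece \<Rightarrow> 'r::comm_ring_1 cpx" where
  "piece_cpx (Pos i j k l) = crossing_cpx 0 1 i j k l"
| "piece_cpx (Neg i j k l) = crossing_cpx (-1) (-2) i j k l"
| "piece_cpx (Loop e) =
     \<lparr>gens = {Only}, hdeg = (\<lambda>_. 0), qdeg = (\<lambda>_. 0), shape = (\<lambda>_. {Circle {e}}),
      diff = (\<lambda>_ _. 0)\<rparr>"

fun tensor_name :: "(name \<Rightarrow> name \<Rightarrow> 'b) \<Rightarrow> 'b \<Rightarrow> name \<Rightarrow> 'b" where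
  "tensor_name f z (Tens g h) = f g h"
| "tensor_name f z _ = z"

definition tensor_diff :: "'r::comm_ring_1 cpx \<Rightarrow> 'r cpx \<Rightarrow> name \<Rightarrow> name \<Rightarrow> name \<Rightarrow> name \<Rightarrow> 'r mor" where
  "tensor_diff C D g h g' h' =
     (if h = h' then bilinear hcomp (diff C g g') (of_cob (id_cob (shape D h))) else 0) +
     (if g = g' then scale (if even (hdeg C g) then 1 else -1)
        (bilinear hcomp (of_cob (id_cob (shape C g))) (diff D h h')) else 0)"

definition tensor :: "'r::comm_ring_1 cpx \<Rightarrow> 'r cpx \<Rightarrow> 'r cpx" where
  "tensor C D =
     \<lparr>gens = {Tens g h | g h. g \<in> gens C \<and> h \<in> gens D},
      hdeg = tensor_name (\<lambda>g h. hdeg C g + hdeg D h) 0,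
      qdeg = tensor_name (\<lambda>g h. qdeg C g + qdeg D h) 0,
      shape = tensor_name (\<lambda>g h. glue (shape C g) (shape D h)) {},
      diff = (\<lambda>x y. tensor_name (\<lambda>g h. tensor_name (\<lambda>g' h'. tensor_diff C D g h g' h') 0 y) 0 x)\<rparr>"

text \<open>Delooping the circle \<open>c\<close> of the summand \<open>g\<close>: a cup is composed with the outgoing, a cap with
  the incoming entries.  The isomorphism uses the dotted cap and the plain cup for the copy with
  shift \<open>+1\<close>, the plain cap and the dotted cup for the copy with shift \<open>-1\<close>.\<close>

definition cup_cob :: "shape \<Rightarrow> curve \<Rightarrow> nat \<Rightarrow> cob" where
  "cup_cob a c d = id_cob (a - {c}) + {#Sheet {} {c} 1 d#}"

definition cap_cob :: "shape \<Rightarrow> curve \<Rightarrow> nat \<Rightarrow> cob" where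
  "cap_cob a c d = id_cob (a - {c}) + {#Sheet {c} {} 1 d#}"

definition deloop :: "'r::comm_ring_1 cpx \<Rightarrow> name \<Rightarrow> curve \<Rightarrow> 'r cpx" where
  "deloop C g c =
     (let a = shape C g;
          old = (\<lambda>x. if x = DelPlus g \<or> x = DelMinus g then g else x);
          pre = (\<lambda>x f. if x = DelPlus g then bilinear vcomp (of_cob (cup_cob a c 0)) f
                    else if x = DelMinus g then bilinear vcomp (of_cob (cup_cob a c 1)) f else f);
          post = (\<lambda>y f. if y = DelPlus g then bilinear vcomp f (of_cob (cap_cob a c 1))
                    else if y = DelMinus g then bilinear vcomp f (of_cob (cap_cob a c 0)) else f)
      in \<lparr>gens = gens C - {g} \<union> {DelPlus g, DelMinus g},
          hdeg = (hdeg C)(DelPlus g := hdeg C g, DelMinus g := hdeg C g),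
          qdeg = (qdeg C)(DelPlus g := qdeg C g + 1, DelMinus g := qdeg C g - 1),
          shape = (shape C)(DelPlus g := a - {c}, DelMinus g := a - {c}),
          diff = (\<lambda>x y. post y (pre x (diff C (old x) (old y))))\<rparr>)"

definition pivot :: "'r::comm_ring_1 cpx \<Rightarrow> name \<Rightarrow> name \<Rightarrow> 'r mor \<Rightarrow> bool" where
  "pivot C b b' \<psi> \<longleftrightarrow> b \<in> gens C \<and> b' \<in> gens C \<and> hdeg C b' = hdeg C b + 1 \<and>
     inverse_mors (obj C b) (obj C b') (diff C b b') \<psi>"

definition eliminate :: "'r::comm_ring_1 cpx \<Rightarrow> name \<Rightarrow> name \<Rightarrow> 'r mor \<Rightarrow> 'r cpx" where
  "eliminate C b b' \<psi> = C\<lparr>gens := gens C - {b, b'},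
     diff := (\<lambda>x y. diff C x y -
        bilinear vcomp (bilinear vcomp (diff C x b') \<psi>) (diff C b y))\<rparr>"


section \<open>The algorithms\<close>

text \<open>
  One step is counted for every basis element and for every nonzero matrix entry that is
  written, for every update of a matrix entry in a Gaussian elimination, and for the elimination
  itself.  Arithmetic in \<open>R\<close> and with cobordisms is free.
\<close>

definition deloop_cost :: "'r::comm_ring_1 cpx \<Rightarrow> name \<Rightarrow> curve \<Rightarrow> nat" where
  "deloop_cost C g c = 2 + card {(x, y) \<in> nonzero_entries (deloop C g c).
     x \<in> {DelPlus g, DelMinus g} \<or> y \<in> {DelPlus g, DelMinus g}}"

definition eliminate_cost :: "'r::comm_ring_1 cpx \<Rightarrow> name \<Rightarrow> name \<Rightarrow> nat" where
  "eliminate_cost C b b' = 1 +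
     card {x. x \<noteq> b \<and> (x, b') \<in> nonzero_entries C} * card {y. y \<noteq> b' \<and> (b, y) \<in> nonzero_entries C}"

inductive deloop_all :: "'r::comm_ring_1 cpx \<Rightarrow> 'r cpx \<Rightarrow> nat \<Rightarrow> bool" where
  finished: "(\<And>g s. g \<in> gens C \<Longrightarrow> Circle s \<notin> shape C g) \<Longrightarrow> deloop_all C C 0"
| step: "g \<in> gens C \<Longrightarrow> Circle s \<in> shape C g \<Longrightarrow> deloop_all (deloop C g (Circle s)) C' t \<Longrightarrow>
     deloop_all C C' (deloop_cost C g (Circle s) + t)"

inductive eliminate_all :: "'r::comm_ring_1 cpx \<Rightarrow> 'r cpx \<Rightarrow> nat \<Rightarrow> bool" where
  finished: "(\<And>b b' \<psi>. \<not> pivot C b b' \<psi>) \<Longrightarrow> eliminate_all C C 0"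
| step: "pivot C b b' \<psi> \<Longrightarrow> eliminate_all (eliminate C b b' \<psi>) C' t \<Longrightarrow>
     eliminate_all C C' (eliminate_cost C b b' + t)"

definition simplify :: "'r::comm_ring_1 cpx \<Rightarrow> 'r cpx \<Rightarrow> nat \<Rightarrow> bool" where
  "simplify C C' t \<longleftrightarrow>
     (\<exists>D t1 t2. deloop_all C D t1 \<and> eliminate_all D C' t2 \<and> t = t1 + t2)"

inductive scan :: "piece list \<Rightarrow> 'r::comm_ring_1 cpx \<Rightarrow> nat \<Rightarrow> bool" where
  first: "simplify (piece_cpx x) C t \<Longrightarrow> scan [x] C (storage (piece_cpx x :: 'r cpx) + t)"
| extend: "scan xs C t \<Longrightarrow> simplify (tensor C (piece_cpx x)) C' t' \<Longrightarrow>
     scan (xs @ [x]) C' (t + storage (tensor C (piece_cpx x)) + t')"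

inductive divide_conquer :: "piece multiset \<Rightarrow> 'r::comm_ring_1 cpx \<Rightarrow> nat \<Rightarrow> bool" where
  leaf: "simplify (piece_cpx x) C t \<Longrightarrow>
     divide_conquer {#x#} C (storage (piece_cpx x :: 'r cpx) + t)"
| cut: "S \<noteq> {#} \<Longrightarrow> T \<noteq> {#} \<Longrightarrow> divide_conquer S C s \<Longrightarrow> divide_conquer T D t \<Longrightarrow>
     simplify (tensor C D) E u \<Longrightarrow>
     divide_conquer (S + T) E (s + t + storage (tensor C D) + u)"

text \<open>
  \<open>scanning_run la D t\<close>: the algorithm can process the diagram \<open>D\<close> in \<open>t\<close> steps, for some order
  of the crossings and some choice of the circles and pivots.  The number of steps of the final
  linear algebra routine on the final complex is an arbitrary function \<open>la\<close>, whose type also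
  determines the coefficient ring.
\<close>

definition scanning_run :: "('r::comm_ring_1 cpx \<Rightarrow> nat) \<Rightarrow> piece list \<Rightarrow> nat \<Rightarrow> bool" where
  "scanning_run la D t \<longleftrightarrow>
     (\<exists>xs C s. mset xs = mset D \<and> scan xs C s \<and> t = s + la C)"

definition divide_conquer_run :: "('r::comm_ring_1 cpx \<Rightarrow> nat) \<Rightarrow> piece list \<Rightarrow> nat \<Rightarrow> bool" where
  "divide_conquer_run la D t \<longleftrightarrow>
     (\<exists>C s. divide_conquer (mset D) C s \<and> t = s + la C)"


section \<open>Link diagrams and closed braids\<close>

primrec crossing_edges :: "piece \<Rightarrow> nat list" where
  "crossing_edges (Pos i j k l) = [i, j, k, l]"
| "crossing_edges (Neg i j k l) = [i, j, k, l]"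
| "crossing_edges (Loop e) = []"

primrec in_edges :: "piece \<Rightarrow> nat list" where
  "in_edges (Pos i j k l) = [i, l]"
| "in_edges (Neg i j k l) = [i, j]"
| "in_edges (Loop e) = [e]"

primrec out_edges :: "piece \<Rightarrow> nat list" where
  "out_edges (Pos i j k l) = [k, j]"
| "out_edges (Neg i j k l) = [k, l]"
| "out_edges (Loop e) = [e]"

definition crossings :: "piece list \<Rightarrow> piece list" where
  "crossings D = filter (\<lambda>x. crossing_edges x \<noteq> []) D"

text \<open>The corners of the underlying 4-valent graph: \<open>(k, j)\<close> is the \<open>j\<close>-th edge end at the \<open>k\<close>-th
  crossing.  A face is traversed by passing to the other end of an edge and turning to the
  next edge there.\<close>

definition darts :: "piece list \<Rightarrow> (nat \<times> nat) set" where
  "darts D = {..<length (crossings D)} \<times> {..<4}"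

definition dart_edge :: "piece list \<Rightarrow> nat \<times> nat \<Rightarrow> nat" where
  "dart_edge D d = crossing_edges (crossings D ! fst d) ! snd d"

definition faces :: "piece list \<Rightarrow> (nat \<times> nat) set set" where
  "faces D = adj_classes
     (\<lambda>d d'. \<exists>e \<in> darts D. e \<noteq> d \<and> dart_edge D e = dart_edge D d \<and>
        d' = (fst e, (snd e + 1) mod 4)) (darts D)"

definition connected_parts :: "piece list \<Rightarrow> (nat \<times> nat) set set" where
  "connected_parts D =
     adj_classes (\<lambda>d d'. fst d = fst d' \<or> dart_edge D d = dart_edge D d') (darts D)"

text \<open>Oriented link diagrams: every edge starts at one and ends at one edge end, and the rotation
  system has genus zero by Euler's formula (there are twice as many edges as crossings).\<close>

definition link_diagram :: "piece list \<Rightarrow> bool" where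
  "link_diagram D \<longleftrightarrow> D \<noteq> [] \<and>
     distinct (concat (map in_edges D)) \<and> distinct (concat (map out_edges D)) \<and>
     set (concat (map in_edges D)) = set (concat (map out_edges D)) \<and>
     int (length (crossings D)) - 2 * int (length (crossings D)) + int (card (faces D))
       = 2 * int (card (connected_parts D))"

primrec under_edges :: "piece \<Rightarrow> nat list" where
  "under_edges (Pos i j k l) = [i, k]"
| "under_edges (Neg i j k l) = [i, k]"
| "under_edges (Loop e) = []"

primrec over_edges :: "piece \<Rightarrow> nat list" where
  "over_edges (Pos i j k l) = [j, l]"
| "over_edges (Neg i j k l) = [j, l]"
| "over_edges (Loop e) = []"

definition alternating :: "piece list \<Rightarrow> bool" where
  "alternating D \<longleftrightarrow>
     distinct (concat (map under_edges D)) \<and> distinct (concat (map over_edges D)) \<and>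
     set (concat (map under_edges D)) = set (concat (map over_edges D))"

datatype letter = Sigma1 | Sigma2 | Sigma1_inv | Sigma2_inv

definition positive_word :: "letter list \<Rightarrow> bool" where
  "positive_word w \<longleftrightarrow> set w \<subseteq> {Sigma1, Sigma2}"

text \<open>The letter acts on the strands at positions \<open>left_pos x\<close> and \<open>left_pos x + 1\<close> among \<open>0, 1, 2\<close>.\<close>

primrec left_pos :: "letter \<Rightarrow> nat" where
  "left_pos Sigma1 = 0"
| "left_pos Sigma2 = 1"
| "left_pos Sigma1_inv = 0"
| "left_pos Sigma2_inv = 1"

definition touching :: "letter list \<Rightarrow> nat \<Rightarrow> nat set" where
  "touching w p = {s. s < length w \<and> (p = left_pos (w ! s) \<or> p = left_pos (w ! s) + 1)}"

text \<open>The edge that leaves the \<open>s\<close>-th crossing at position \<open>p\<close> is labelled \<open>3 * s + p\<close>.  The edge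
  that enters the \<open>t\<close>-th crossing at position \<open>p\<close> comes from the cyclically preceding crossing
  at this position.\<close>

definition out_label :: "nat \<Rightarrow> nat \<Rightarrow> nat" where
  "out_label s p = 3 * s + p"

definition in_label :: "letter list \<Rightarrow> nat \<Rightarrow> nat \<Rightarrow> nat" where
  "in_label w t p =
     (let S = touching w p; S' = {s \<in> S. s < t}
      in out_label (if S' \<noteq> {} then Max S' else Max S) p)"

definition braid_crossing :: "letter list \<Rightarrow> nat \<Rightarrow> piece" where
  "braid_crossing w t =
     (let p = left_pos (w ! t);
          in_l = in_label w t p; in_r = in_label w t (p + 1);
          out_l = out_label t p; out_r = out_label t (p + 1)
      in if w ! t \<in> {Sigma1, Sigma2} then Pos in_r out_r out_l in_l
         else Neg in_l in_r out_r out_l)"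

definition braid_closure :: "letter list \<Rightarrow> piece list" where
  "braid_closure w = map (braid_crossing w) [0..<length w] @
     map (\<lambda>p. Loop (out_label (length w) p)) (filter (\<lambda>p. touching w p = {}) [0..<3])"


section \<open>Exponential running time\<close>

text \<open>
  An implementation resolves the choices that the algorithm leaves open, so it is described by
  a function \<open>time\<close> that gives the number of steps of one possible run on each diagram.  Every
  implementation, even one making the luckiest choices, has worst-case running time at least
  \<open>c * b ^ n\<close> on the diagrams with \<open>n\<close> crossings.
\<close>

definition exponential_time :: "(piece list \<Rightarrow> nat \<Rightarrow> bool) \<Rightarrow> piece list set \<Rightarrow> bool" where
  "exponential_time run \<D> \<longleftrightarrow>
     (\<forall>D\<in>\<D>. \<exists>t. run D t) \<and>
     (\<forall>time. (\<forall>D\<in>\<D>. run D (time D)) \<longrightarrow>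
        (\<exists>c>0. \<exists>b>1. \<forall>\<^sub>F n in sequentially.
           \<exists>D\<in>\<D>. length (crossings D) = n \<and> c * b ^ n \<le> real (time D)))"

definition positive_3_braid_closures :: "piece list set" where
  "positive_3_braid_closures = {braid_closure w | w. positive_word w}"

definition alternating_3_braid_closures :: "piece list set" where
  "alternating_3_braid_closures = {braid_closure w | w. alternating (braid_closure w)}"

end

theory Submission
  imports Defs
begin

text \<open>
  The final complex cannot be small: its graded Euler characteristic, evaluated at a number \<open>q\<close> of
  absolute value one, is bounded by the number of its generators, and every generator has been
  written down at some step.  Tensoring, delooping and Gaussian elimination all respect the Euler
  characteristic, whatever choices are made; for the elimination this holds since diagrams without
  circles are isomorphic in Bar-Natan's category only if they and their shifts agree.  Hence the
  Euler characteristic is the Kauffman state sum of the diagram, and it suffices to find diagrams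
  for which this is exponentially large at a suitable \<open>q\<close>.  Closed \<open>3\<close>-braids are evaluated by a
  two-dimensional representation of the Temperley-Lieb algebra, in which
  \<open>\<sigma>\<^sub>1 \<sigma>\<^sub>2\<^sup>-\<^sup>1\<close> has the eigenvalues \<open>2\<close> and \<open>1/2\<close> if \<open>(q + q\<^sup>-\<^sup>1)\<^sup>2 = 1/2\<close>; a full twist makes
  its powers positive and acts by a scalar.
\<close>

section \<open>Classes of an adjacency relation\<close>

text \<open>The Euler characteristic of a tangle complex is a combination of diagrams, not a number.
  It is therefore tested against all contexts: every summand is closed up by an arbitrary hypergraph
  \<open>Z\<close> and components are counted. Tensoring then means substituting one context into
  another, and the order of the crossings drops out. The value 1/2 comes from a trace. With d = q +
  1/q, the matrix of the alternating block has determinant 1 and trace 3 - d^2. On the unit circle d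
  is real, so the eigenvalues leave the unit circle exactly if d^2 < 1; d = 0 would kill the factor
  d in front of the trace, and d^2 = 1/2 gives 5/2 = 2 + 1/2. The full twist has six letters of
  determinant - q^4, and its scalar is q^12, whose square is the product q^24. Blocks reach only
  multiples of their length. All other crossing numbers are reached by padding with letters
  \<open>Sigma1\<close>, and the coefficient of the growing eigenvalue must be shown not to vanish
  for each amount of padding. For unrestricted link diagrams the witnesses are disjoint kinks at q =
  1, where planarity amounts to counting three faces per component.\<close>

definition adj_edges :: "('a \<Rightarrow> 'a \<Rightarrow> bool) \<Rightarrow> 'a set \<Rightarrow> ('a \<times> 'a) set" where
  "adj_edges adj A = {(u, v). u \<in> A \<and> v \<in> A \<and> (adj u v \<or> adj v u)}"

definition adj_rel :: "('a \<Rightarrow> 'a \<Rightarrow> bool) \<Rightarrow> 'a set \<Rightarrow> ('a \<times> 'a) set" where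
  "adj_rel adj A = {(x, y). x \<in> A \<and> y \<in> A \<and> (x, y) \<in> (adj_edges adj A)\<^sup>*}"

lemma adj_classes_alt: "adj_classes adj A = A // adj_rel adj A"
  unfolding adj_classes_def adj_rel_def adj_edges_def ..

lemma equiv_adj_rel: "equiv A (adj_rel adj A)"
proof (rule equivI)
  show "adj_rel adj A \<subseteq> A \<times> A"
    by (auto simp: adj_rel_def)
  show "refl_on A (adj_rel adj A)"
    by (auto simp: refl_on_def adj_rel_def)
  have "sym (adj_edges adj A)"
    by (auto simp: sym_def adj_edges_def)
  then have "sym ((adj_edges adj A)\<^sup>*)"
    by (rule sym_rtrancl)
  then show "sym (adj_rel adj A)"
    by (auto simp: sym_def adj_rel_def)
  show "trans (adj_rel adj A)"
    by (auto simp: trans_def adj_rel_def)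
qed

lemma adj_class_exists: "x \<in> A \<Longrightarrow> \<exists>W \<in> adj_classes adj A. x \<in> W"
  unfolding adj_classes_alt using equiv_adj_rel
  by (metis equiv_class_self quotientI)

lemma adj_class_subset: "W \<in> adj_classes adj A \<Longrightarrow> W \<subseteq> A"
  unfolding adj_classes_alt using equiv_adj_rel
  by (metis Union_quotient Union_upper)

lemma adj_class_nonempty: "W \<in> adj_classes adj A \<Longrightarrow> W \<noteq> {}"
  unfolding adj_classes_alt using equiv_adj_rel
  by (metis in_quotient_imp_non_empty)

lemma adj_class_disjoint:
  "W \<in> adj_classes adj A \<Longrightarrow> W' \<in> adj_classes adj A \<Longrightarrow> x \<in> W \<Longrightarrow> x \<in> W' \<Longrightarrow> W = W'"
  unfolding adj_classes_alt using quotient_disj[OF equiv_adj_rel] by blast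

lemma adj_class_closed:
  assumes "W \<in> adj_classes adj A" "x \<in> W" "y \<in> A" "adj x y \<or> adj y x"
  shows "y \<in> W"
proof -
  have "x \<in> A" using assms adj_class_subset by blast
  then have "(x, y) \<in> adj_rel adj A"
    using assms by (auto simp: adj_rel_def adj_edges_def)
  then show ?thesis
    using assms equiv_adj_rel in_quotient_imp_closed unfolding adj_classes_alt by metis
qed

lemma adj_class_path:
  assumes "W \<in> adj_classes adj A" "x \<in> W" "y \<in> W"
  shows "(x, y) \<in> (adj_edges adj A)\<^sup>*"
proof -
  have "(x, y) \<in> adj_rel adj A"
    using assms equiv_adj_rel in_quotient_imp_in_rel[of A _ W x y] unfolding adj_classes_alt by auto
  then show ?thesis by (simp add: adj_rel_def)
qed

lemma finite_adj_classes: "finite A \<Longrightarrow> finite (adj_classes adj A)"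
  unfolding adj_classes_alt
  using equiv_adj_rel finite_quotient[of A "adj_rel adj A"] by (auto simp: adj_rel_def)

text \<open>Adjacency preserves \<open>f\<close> and each fibre of \<open>f\<close> is connected in
  a single step, so the classes are the fibres. Faces and connected parts of the kinks are counted
  this way.\<close>

lemma card_adj_classes:
  assumes const: "\<And>x y. x \<in> A \<Longrightarrow> y \<in> A \<Longrightarrow> adj x y \<Longrightarrow> f x = f y"
    and conn: "\<And>x y. x \<in> A \<Longrightarrow> y \<in> A \<Longrightarrow> f x = f y \<Longrightarrow> x = y \<or> adj x y \<or> adj y x"
  shows "card (adj_classes adj A) = card (f ` A)"
proof -
  let ?F = "\<lambda>W. f (SOME x. x \<in> W)"
  have same: "f x = f y" if "W \<in> adj_classes adj A" "x \<in> W" "y \<in> W" for W x y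
    using adj_class_path[OF that]
  proof (induction rule: rtrancl_induct)
    case (step u v)
    then show ?case using const by (auto simp: adj_edges_def)
  qed simp
  have F: "?F W = f x" if "W \<in> adj_classes adj A" "x \<in> W" for W x
    using same[OF that(1) _ that(2)] someI[of "\<lambda>x. x \<in> W", OF that(2)] by blast
  have "inj_on ?F (adj_classes adj A)"
  proof (rule inj_onI)
    fix W W' assume W: "W \<in> adj_classes adj A" "W' \<in> adj_classes adj A" "?F W = ?F W'"
    obtain x y where xy: "x \<in> W" "y \<in> W'"
      using W adj_class_nonempty by blast
    then have "f x = f y" using W F by metis
    then have "y \<in> W"
      using conn W xy adj_class_closed adj_class_subset by (metis subsetD)
    then show "W = W'" using W xy adj_class_disjoint by metis
  qed
  moreover have "?F ` adj_classes adj A = f ` A"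
  proof (intro equalityI subsetI)
    fix z assume "z \<in> ?F ` adj_classes adj A"
    then show "z \<in> f ` A"
      using F adj_class_nonempty adj_class_subset by (smt (verit) ex_in_conv image_iff subsetD)
  next
    fix z assume "z \<in> f ` A"
    then obtain x where "x \<in> A" "z = f x" by blast
    moreover from this obtain W where "W \<in> adj_classes adj A" "x \<in> W"
      using adj_class_exists by metis
    ultimately show "z \<in> ?F ` adj_classes adj A"
      using F by (intro image_eqI[of _ _ W]) simp_all
  qed
  ultimately show ?thesis by (metis card_image)
qed

section \<open>Components of hypergraphs\<close>

text \<open>Curves become hyperedges, namely their sets of labels. The circles of a closed-up
  diagram are then the components of a hypergraph, a count that does not depend on the order in
  which pieces were glued.\<close>

definition conn :: "'a set set \<Rightarrow> 'a \<Rightarrow> 'a \<Rightarrow> bool" where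
  "conn H = (\<lambda>x y. \<exists>h\<in>H. x \<in> h \<and> y \<in> h)\<^sup>*\<^sup>*"

definition components :: "'a set set \<Rightarrow> 'a set set" where
  "components H = (\<lambda>x. Collect (conn H x)) ` \<Union>H"

definition num_components :: "'a set set \<Rightarrow> nat" where
  "num_components H = card (components H)"

lemma conn_refl [simp]: "conn H x x"
  by (simp add: conn_def)

lemma conn_edge: "h \<in> H \<Longrightarrow> x \<in> h \<Longrightarrow> y \<in> h \<Longrightarrow> conn H x y"
  unfolding conn_def by blast

lemma conn_trans: "conn H x y \<Longrightarrow> conn H y z \<Longrightarrow> conn H x z"
  unfolding conn_def by simp

lemma conn_sym: "conn H x y \<Longrightarrow> conn H y x"
proof -
  have "symp (\<lambda>x y. \<exists>h\<in>H. x \<in> h \<and> y \<in> h)"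
    by (auto simp: symp_def)
  then show "conn H x y \<Longrightarrow> conn H y x"
    unfolding conn_def by (rule sympD[OF symp_rtranclp])
qed

lemma conn_induct [consumes 1, case_names refl step]:
  assumes "conn H x y" "P x" "\<And>u v h. conn H x u \<Longrightarrow> P u \<Longrightarrow> h \<in> H \<Longrightarrow> u \<in> h \<Longrightarrow> v \<in> h \<Longrightarrow> P v"
  shows "P y"
proof -
  have "(\<lambda>x y. \<exists>h\<in>H. x \<in> h \<and> y \<in> h)\<^sup>*\<^sup>* x y"
    using assms(1) by (simp add: conn_def)
  then show ?thesis
  proof (induction rule: rtranclp_induct)
    case (step u v)
    then show ?case using assms(3)[of u] unfolding conn_def by blast
  qed (rule assms(2))
qed

lemma conn_transfer:
  assumes "conn H x y" "\<And>h u v. h \<in> H \<Longrightarrow> u \<in> h \<Longrightarrow> v \<in> h \<Longrightarrow> conn H' (f u) (f v)"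
  shows "conn H' (f x) (f y)"
  using assms(1)
proof (induction rule: conn_induct)
  case (step u v h)
  then show ?case using assms(2)[of h u v] conn_trans by metis
qed simp

lemma conn_mono:
  assumes "conn H x y" "H \<subseteq> H'"
  shows "conn H' x y"
proof (rule conn_transfer[OF assms(1), where f = "\<lambda>x. x"])
  fix h u v assume "h \<in> H" "u \<in> h" "v \<in> h"
  then show "conn H' u v"
    using assms(2) by (intro conn_edge[of h]) auto
qed

lemma num_components_eqI:
  assumes "\<Union>H = \<Union>H'"
    and "\<And>h u v. h \<in> H \<Longrightarrow> u \<in> h \<Longrightarrow> v \<in> h \<Longrightarrow> conn H' u v"
    and "\<And>h u v. h \<in> H' \<Longrightarrow> u \<in> h \<Longrightarrow> v \<in> h \<Longrightarrow> conn H u v"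
  shows "num_components H = num_components H'"
proof -
  have "conn H x y \<Longrightarrow> conn H' x y" for x y
    by (erule conn_transfer[where f = "\<lambda>x. x"]) (rule assms(2,3); assumption)
  moreover have "conn H' x y \<Longrightarrow> conn H x y" for x y
    by (erule conn_transfer[where f = "\<lambda>x. x"]) (rule assms(2,3); assumption)
  ultimately have "conn H = conn H'"
    by (intro ext iffI)
  then show ?thesis
    by (simp add: num_components_def components_def assms(1))
qed

lemma conn_stays: "conn H x y \<Longrightarrow> x \<in> \<Union>H \<Longrightarrow> y \<in> \<Union>H"
  by (induction rule: conn_induct) auto

text \<open>A fibre of \<open>f\<close> lies within one component, so taking images is a bijection
  on components. Both the removal of interior labels and the passage from the ladder to the closed
  braid rest on this.\<close>

lemma num_components_contract:
  assumes fibres: "\<And>x y. x \<in> \<Union>H \<Longrightarrow> y \<in> \<Union>H \<Longrightarrow> f x = f y \<Longrightarrow> conn H x y"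
  shows "num_components ((`) f ` H) = num_components H"
proof -
  let ?H' = "(`) f ` H"
  have fwd: "conn ?H' (f x) (f y)" if "conn H x y" for x y
    using that by (rule conn_transfer) (auto intro: conn_edge)
  have bwd: "\<exists>y \<in> \<Union>H. f y = v \<and> conn H x y" if "conn ?H' (f x) v" "x \<in> \<Union>H" for x v
    using that(1)
  proof (induction rule: conn_induct)
    case refl
    show ?case by (rule bexI[OF _ that(2)]) simp
  next
    case (step u v h')
    then obtain h x1 x2 y where h: "h \<in> H" "x1 \<in> h" "f x1 = u" "y \<in> h" "f y = v"
        "x2 \<in> \<Union>H" "f x2 = u" "conn H x x2"
      by fast
    then have "conn H x2 x1" using fibres by blast
    then show ?case using h conn_trans conn_edge by (metis UnionI)
  qed
  have comp: "f ` Collect (conn H x) = Collect (conn ?H' (f x))" if "x \<in> \<Union>H" for x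
    using fwd bwd that by blast
  have "components ?H' = (`) f ` components H"
  proof -
    have "\<Union>?H' = f ` \<Union>H"
      by blast
    then have "components ?H' = (\<lambda>x. Collect (conn ?H' (f x))) ` \<Union>H"
      by (simp only: components_def image_image)
    also have "\<dots> = (\<lambda>x. f ` Collect (conn H x)) ` \<Union>H"
      by (intro image_cong refl) (simp only: comp)
    finally show ?thesis
      by (simp only: components_def image_image)
  qed
  moreover have "inj_on ((`) f) (components H)"
  proof (rule inj_onI)
    fix C D assume "C \<in> components H" "D \<in> components H" and eq: "f ` C = f ` D"
    then obtain x y where xy: "x \<in> \<Union>H" "y \<in> \<Union>H" "C = Collect (conn H x)" "D = Collect (conn H y)"
      unfolding components_def by blast
    have "f x \<in> f ` D" using eq xy by auto
    then obtain z where z: "conn H y z" "f x = f z" using xy by auto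
    then have "conn H x z" using fibres xy conn_stays by metis
    then have "conn H x y" using z conn_sym conn_trans by metis
    then have "conn H x w \<longleftrightarrow> conn H y w" for w
      by (blast intro: conn_sym conn_trans)
    then show "C = D" unfolding xy by blast
  qed
  ultimately show ?thesis by (simp add: num_components_def card_image)
qed

lemma finite_components: "finite (\<Union>H) \<Longrightarrow> finite (components H)"
  by (simp add: components_def)

lemma num_components_insert_disjoint:
  assumes "finite (\<Union>H)" "A \<noteq> {}" "A \<inter> \<Union>H = {}"
  shows "num_components (insert A H) = Suc (num_components H)"
proof -
  have A: "conn (insert A H) x y \<longleftrightarrow> y \<in> A" if "x \<in> A" for x y
  proof
    assume "conn (insert A H) x y"
    then show "y \<in> A" by (induction rule: conn_induct) (use that assms in auto)
  qed (use that in \<open>auto intro: conn_edge\<close>)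
  have H: "conn (insert A H) x y \<longleftrightarrow> conn H x y" if "x \<in> \<Union>H" for x y
  proof
    assume "conn (insert A H) x y"
    then have "conn H x y \<and> y \<in> \<Union>H"
    proof (induction rule: conn_induct)
      case (step u v h)
      then show ?case using assms by (metis IntI UnionI conn_edge conn_trans emptyE insertE)
    qed (use that in simp)
    then show "conn H x y" ..
  qed (auto intro: conn_mono)
  have "components (insert A H) = insert A (components H)"
  proof -
    have "Collect (conn (insert A H) x) = A" if "x \<in> A" for x
      using A[OF that] by blast
    then have "(\<lambda>x. Collect (conn (insert A H) x)) ` A = {A}"
      using \<open>A \<noteq> {}\<close> by force
    moreover have "(\<lambda>x. Collect (conn (insert A H) x)) ` \<Union>H = components H"
      unfolding components_def using H by (intro image_cong Collect_cong refl) blast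
    ultimately show ?thesis
      by (simp add: components_def image_Un)
  qed
  moreover have "A \<notin> components H"
  proof
    assume "A \<in> components H"
    then obtain x where "x \<in> \<Union>H" "x \<in> A" unfolding components_def by force
    then show False using assms by blast
  qed
  ultimately show ?thesis
    using finite_components[OF assms(1)] by (simp add: num_components_def)
qed

lemma num_components_empty [simp]: "num_components {} = 0"
  by (simp add: num_components_def components_def)

lemma num_components_mono_eqI:
  assumes "H \<subseteq> H'" "\<Union>H' \<subseteq> \<Union>H"
    and "\<And>h u v. h \<in> H' - H \<Longrightarrow> u \<in> h \<Longrightarrow> v \<in> h \<Longrightarrow> conn H u v"
  shows "num_components H' = num_components H"
proof (rule num_components_eqI)
  show "\<Union>H' = \<Union>H" using assms by blast
  show "conn H u v" if "h \<in> H'" "u \<in> h" "v \<in> h" for h u v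
    using assms(3)[of h u v] conn_edge[of h H u v] that by blast
  show "conn H' u v" if "h \<in> H" "u \<in> h" "v \<in> h" for h u v
    using conn_edge[of h H' u v] assms(1) that by blast
qed

text \<open>The set \<open>I\<close> consists of the interior labels, which do not occur in a context.\<close>

definition reduces :: "'a set \<Rightarrow> nat \<Rightarrow> 'a set set \<Rightarrow> 'a set set \<Rightarrow> bool" where
  "reduces I c H H' \<longleftrightarrow> (\<forall>Z. finite (\<Union>Z) \<longrightarrow> \<Union>Z \<inter> I = {} \<longrightarrow>
     num_components (H \<union> Z) = c + num_components (H' \<union> Z))"

lemma reduces_trans:
  assumes "reduces I c H H'" "reduces J d H' H''"
  shows "reduces (I \<union> J) (c + d) H H''"
  unfolding reduces_def
proof (intro allI impI)
  fix Z :: "'a set set" assume Z: "finite (\<Union>Z)" "\<Union>Z \<inter> (I \<union> J) = {}"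
  then have "\<Union>Z \<inter> I = {}" "\<Union>Z \<inter> J = {}" by blast+
  then show "num_components (H \<union> Z) = c + d + num_components (H'' \<union> Z)"
    using assms Z unfolding reduces_def by presburger
qed

lemma num_components_insert_Un:
  assumes "A \<inter> B \<noteq> {}"
  shows "num_components (insert A (insert B H)) = num_components (insert (A \<union> B) H)"
proof (rule num_components_eqI)
  let ?H = "insert A (insert B H)"
  obtain z where z: "z \<in> A" "z \<in> B" using assms by blast
  have "conn ?H x z" if "x \<in> A \<union> B" for x
    using that z conn_edge[of A ?H] conn_edge[of B ?H] by auto
  then have *: "conn ?H u v" if "u \<in> A \<union> B" "v \<in> A \<union> B" for u v
    using that conn_sym conn_trans by metis
  show "conn ?H u v" if "h \<in> insert (A \<union> B) H" "u \<in> h" "v \<in> h" for h u v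
    using that * conn_edge[of h ?H] by blast
  show "conn (insert (A \<union> B) H) u v" if "h \<in> ?H" "u \<in> h" "v \<in> h" for h u v
  proof -
    from that consider "u \<in> A \<union> B" "v \<in> A \<union> B" | "h \<in> H"
      by blast
    then show ?thesis
    proof cases
      case 1
      then show ?thesis by (intro conn_edge[of "A \<union> B"]) simp_all
    next
      case 2
      then show ?thesis using that by (intro conn_edge[of h]) simp_all
    qed
  qed
qed auto

text \<open>Every dropped label of \<open>X\<close> is contracted to a label kept in
  \<open>s X\<close>. Disjointness makes the choice consistent, and dropped labels do not occur in
  \<open>Z\<close>, so the contraction leaves \<open>Z\<close> alone.\<close>

lemma num_components_shrink:
  assumes disj: "\<And>X Y. X \<in> P \<Longrightarrow> Y \<in> P \<Longrightarrow> X \<noteq> Y \<Longrightarrow> X \<inter> Y = {}"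
    and sub: "\<And>X. X \<in> P \<Longrightarrow> s X \<subseteq> X \<and> s X \<noteq> {}"
    and out: "\<And>X. X \<in> P \<Longrightarrow> (X - s X) \<inter> \<Union>Z = {}"
  shows "num_components (P \<union> Z) = num_components (s ` P \<union> Z)"
proof -
  define f where "f x = (if \<exists>X\<in>P. x \<in> X - s X
    then SOME y. \<exists>X\<in>P. x \<in> X - s X \<and> y \<in> s X else x)" for x
  have f_in: "f x \<in> s X" if "X \<in> P" "x \<in> X" "x \<notin> s X" for x X
  proof -
    from sub that obtain y where "y \<in> s X" by blast
    then have ex: "\<exists>y. \<exists>X\<in>P. x \<in> X - s X \<and> y \<in> s X" using that by blast
    then have "f x = (SOME y. \<exists>X\<in>P. x \<in> X - s X \<and> y \<in> s X)"
      using that by (auto simp: f_def)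
    then have "\<exists>X'\<in>P. x \<in> X' - s X' \<and> f x \<in> s X'"
      using someI_ex[OF ex] by simp
    then show ?thesis using disj that by (metis DiffD1 disjoint_iff)
  qed
  have f_id: "f x = x" if "\<And>X. X \<in> P \<Longrightarrow> x \<in> X \<Longrightarrow> x \<in> s X" for x
    using that by (auto simp: f_def)
  have fs: "f x = x" if "X \<in> P" "x \<in> s X" for x X
  proof (rule f_id)
    fix Y assume "Y \<in> P" "x \<in> Y"
    then show "x \<in> s Y" using that disj sub by (metis disjoint_iff subsetD)
  qed
  have "f ` X = s X" if "X \<in> P" for X
  proof (intro equalityI subsetI)
    fix y assume "y \<in> f ` X"
    then show "y \<in> s X" using f_in[OF that] fs[OF that] by (metis imageE)
  next
    fix y assume "y \<in> s X"
    then show "y \<in> f ` X" using fs[OF that] sub[OF that] by (metis imageI subsetD)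
  qed
  moreover have "f ` z = z" if "z \<in> Z" for z
  proof -
    have "f x = x" if "x \<in> z" for x
      using out \<open>z \<in> Z\<close> that by (intro f_id) blast
    then show ?thesis by simp
  qed
  ultimately have img: "(`) f ` (P \<union> Z) = s ` P \<union> Z"
    by (auto simp: image_Un)
  have near: "conn (P \<union> Z) x (f x)" for x
  proof (cases "\<exists>X\<in>P. x \<in> X - s X")
    case True
    then obtain X where X: "X \<in> P" "x \<in> X" "x \<notin> s X" by blast
    then have "f x \<in> X" using f_in sub by blast
    then show ?thesis using X by (auto intro: conn_edge)
  next
    case False
    then have "f x = x" by (simp only: f_def if_False)
    then show ?thesis by simp
  qed
  have "num_components ((`) f ` (P \<union> Z)) = num_components (P \<union> Z)"
    by (rule num_components_contract) (metis near conn_sym conn_trans)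
  then show ?thesis by (simp add: img)
qed

lemma num_components_drop:
  assumes "v \<in> A" "A \<noteq> {v}" "v \<notin> \<Union>H"
  shows "num_components (insert A H) = num_components (insert (A - {v}) H)"
  using num_components_shrink[of "{A}" "\<lambda>X. X - {v}" H] assms by auto

section \<open>Gluing\<close>

lemma ends_subset_labels: "ends c \<subseteq> labels c"
  by (cases c) auto

definition interior :: "nat multiset \<Rightarrow> nat set" where
  "interior M = {l. count M l = 2}"

text \<open>\<open>M\<close> counts the edge ends of a tangle at its crossings: its boundary points are the labels
  that occur once in \<open>M\<close>.\<close>

definition shape_ok :: "nat multiset \<Rightarrow> shape \<Rightarrow> bool" where
  "shape_ok M s \<longleftrightarrow> finite s \<and> (\<forall>l. count M l \<le> 2) \<and>
     (\<forall>c\<in>s. finite (labels c) \<and> labels c \<noteq> {}) \<and>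
     (\<forall>c\<in>s. \<forall>l\<in>ends c. count M l = 1) \<and>
     (\<forall>c\<in>s. \<forall>l\<in>labels c - ends c. count M l = 2) \<and>
     (\<forall>l. count M l = 1 \<longrightarrow> (\<exists>c\<in>s. l \<in> ends c)) \<and>
     (\<forall>c\<in>s. \<forall>d\<in>s. labels c \<inter> labels d \<noteq> {} \<longrightarrow> c = d)"

abbreviation hyper :: "shape \<Rightarrow> nat set set" where
  "hyper s \<equiv> labels ` s"

abbreviation block :: "(curve + curve) set \<Rightarrow> nat set" where
  "block W \<equiv> \<Union>u\<in>W. labels (untag u)"

lemma shape_okD:
  assumes "shape_ok M s"
  shows "finite s" "count M l \<le> 2" "c \<in> s \<Longrightarrow> finite (labels c)" "c \<in> s \<Longrightarrow> labels c \<noteq> {}"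
    "c \<in> s \<Longrightarrow> l \<in> ends c \<Longrightarrow> count M l = 1"
    "c \<in> s \<Longrightarrow> l \<in> labels c \<Longrightarrow> l \<notin> ends c \<Longrightarrow> count M l = 2"
    "count M l = 1 \<Longrightarrow> \<exists>c\<in>s. l \<in> ends c"
    "c \<in> s \<Longrightarrow> d \<in> s \<Longrightarrow> l \<in> labels c \<Longrightarrow> l \<in> labels d \<Longrightarrow> c = d"
  using assms unfolding shape_ok_def by blast+

lemma shape_ok_pos:
  assumes "shape_ok M s" "c \<in> s" "l \<in> labels c"
  shows "count M l \<ge> 1"
  using shape_okD(5)[OF assms(1,2), of l] shape_okD(6)[OF assms(1,2), of l] assms(3) by fastforce

lemma shape_ok_end:
  assumes "shape_ok M s" "c \<in> s" "l \<in> labels c" "count M l = 1"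
  shows "l \<in> ends c"
  using shape_okD(6)[OF assms(1-3)] assms(4) by fastforce

locale gluing =
  fixes M N :: "nat multiset" and a b :: shape
  assumes a: "shape_ok M a" and b: "shape_ok N b"
    and le: "\<And>l. count (M + N) l \<le> 2"
begin

abbreviation "curves \<equiv> Inl ` a \<union> Inr ` b"

lemma le': "count M l + count N l \<le> 2"
  using le[of l] by simp

text \<open>A label has at most two edge ends in all. If it occurs in both tangles, it occurs once
  in each, hence is an end of both curves; within one tangle it determines the curve.\<close>

lemma same_label:
  assumes "u \<in> curves" "v \<in> curves" "l \<in> labels (untag u)" "l \<in> labels (untag v)"
  shows "u = v \<or> share_end u v \<or> share_end v u"
proof -
  have *: "share_end (Inl c) (Inr d)" if "c \<in> a" "d \<in> b" "l \<in> labels c" "l \<in> labels d" for c d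
  proof -
    have "count M l \<ge> 1" "count N l \<ge> 1"
      using shape_ok_pos a b that by blast+
    then have "count M l = 1" "count N l = 1"
      using le'[of l] by linarith+
    then have "l \<in> ends c" "l \<in> ends d"
      using shape_ok_end a b that by blast+
    then show ?thesis by auto
  qed
  show ?thesis
    using assms * shape_okD(8)[OF a] shape_okD(8)[OF b] by (auto simp del: share_end.simps)
qed

lemma block_disjoint:
  assumes "W \<in> glue_classes a b" "W' \<in> glue_classes a b" "l \<in> block W" "l \<in> block W'"
  shows "W = W'"
proof -
  obtain u v where uv: "u \<in> W" "v \<in> W'" "l \<in> labels (untag u)" "l \<in> labels (untag v)"
    using assms by blast
  then have "u \<in> curves" "v \<in> curves"
    using assms adj_class_subset unfolding glue_classes_def by blast+
  then have "v \<in> W"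
    using same_label[OF _ _ uv(3,4)] adj_class_closed assms(1) uv(1) unfolding glue_classes_def
    by metis
  then show ?thesis
    using assms uv adj_class_disjoint unfolding glue_classes_def by metis
qed

text \<open>\<open>free_ends\<close> looks at the curves of a class, \<open>count\<close> at the
  crossings. They agree because a boundary point of one tangle either stays free or meets an end in
  the other tangle, which then belongs to the same class.\<close>

lemma free_ends_iff:
  assumes W: "W \<in> glue_classes a b"
  shows "l \<in> free_ends W \<longleftrightarrow> l \<in> block W \<and> count (M + N) l = 1"
proof
  have sub: "W \<subseteq> curves"
    using W adj_class_subset unfolding glue_classes_def by blast
  have closed: "v \<in> W" if "u \<in> W" "v \<in> curves" "share_end u v \<or> share_end v u" for u v
    using W that adj_class_closed[of W share_end curves u v] unfolding glue_classes_def by blast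
  let ?U = "{u \<in> W. l \<in> ends (untag u)}"
  show "l \<in> block W \<and> count (M + N) l = 1" if "l \<in> free_ends W"
  proof -
    from that have "card ?U = 1" by (simp add: free_ends_def)
    then obtain u where u: "?U = {u}" by (auto simp: card_1_singleton_iff)
    then have uW: "u \<in> W" "l \<in> ends (untag u)" by blast+
    have "count (M + N) l = 1"
    proof (cases u)
      case (Inl c)
      then have c: "c \<in> a" "l \<in> ends c" using uW sub by auto
      then have M: "count M l = 1" using shape_okD(5)[OF a] by blast
      moreover have "count N l \<noteq> 1"
      proof
        assume "count N l = 1"
        then obtain d where "d \<in> b" "l \<in> ends d" using shape_okD(7)[OF b] by blast
        then have "Inr d \<in> ?U" using closed[OF uW(1), of "Inr d"] c Inl by auto
        then show False using u Inl by blast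
      qed
      ultimately show ?thesis using le'[of l] by simp
    next
      case (Inr c)
      then have c: "c \<in> b" "l \<in> ends c" using uW sub by auto
      then have M: "count N l = 1" using shape_okD(5)[OF b] by blast
      moreover have "count M l \<noteq> 1"
      proof
        assume "count M l = 1"
        then obtain d where "d \<in> a" "l \<in> ends d" using shape_okD(7)[OF a] by blast
        then have "Inl d \<in> ?U" using closed[OF uW(1), of "Inl d"] c Inr by auto
        then show False using u Inr by blast
      qed
      ultimately show ?thesis using le'[of l] by simp
    qed
    moreover have "l \<in> block W" using uW ends_subset_labels by blast
    ultimately show ?thesis by blast
  qed
  show "l \<in> free_ends W" if "l \<in> block W \<and> count (M + N) l = 1"
  proof -
    from that have MN: "count M l + count N l = 1" by simp
    from that obtain u where u: "u \<in> W" "l \<in> labels (untag u)" by blast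
    have "l \<in> ends (untag u)"
    proof (cases u)
      case (Inl c)
      then have "c \<in> a" "l \<in> labels c" using u sub by auto
      then show ?thesis using shape_ok_pos[OF a] shape_ok_end[OF a] MN Inl by fastforce
    next
      case (Inr c)
      then have "c \<in> b" "l \<in> labels c" using u sub by auto
      then show ?thesis using shape_ok_pos[OF b] shape_ok_end[OF b] MN Inr by fastforce
    qed
    moreover have "v = u" if "v \<in> W" "l \<in> ends (untag v)" for v
    proof -
      have lv: "l \<in> labels (untag v)" using that ends_subset_labels by blast
      have "\<not> share_end x y" if "x \<in> W" "y \<in> W" "l \<in> labels (untag x)" "l \<in> labels (untag y)" for x y
      proof
        assume "share_end x y"
        then obtain c d where cd: "x = Inl c" "y = Inr d"
          by (cases x; cases y) auto
        then have "c \<in> a" "d \<in> b" using that sub by auto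
        then have "count M l \<ge> 1" "count N l \<ge> 1"
          using shape_ok_pos[OF a] shape_ok_pos[OF b] that cd by simp_all
        then show False using MN by linarith
      qed
      then show ?thesis
        using same_label[of u v l] u lv that sub by blast
    qed
    ultimately have "?U = {u}" using u by blast
    then show ?thesis by (simp add: free_ends_def)
  qed
qed

lemma finite_block: "W \<in> glue_classes a b \<Longrightarrow> finite (block W)"
proof -
  assume W: "W \<in> glue_classes a b"
  then have "W \<subseteq> curves"
    using adj_class_subset unfolding glue_classes_def by blast
  moreover have "finite curves"
    using shape_okD(1)[OF a] shape_okD(1)[OF b] by blast
  moreover have "finite (labels (untag u))" if "u \<in> curves" for u
    using that shape_okD(3)[OF a] shape_okD(3)[OF b] by auto
  ultimately show ?thesis
    by (meson finite_UN_I finite_subset subsetD)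
qed

lemma block_nonempty: "W \<in> glue_classes a b \<Longrightarrow> block W \<noteq> {}"
proof -
  assume W: "W \<in> glue_classes a b"
  then obtain u where u: "u \<in> W"
    using adj_class_nonempty unfolding glue_classes_def by blast
  moreover have "u \<in> curves"
    using W u adj_class_subset unfolding glue_classes_def by blast
  then have "labels (untag u) \<noteq> {}"
    using shape_okD(4)[OF a] shape_okD(4)[OF b] by auto
  ultimately show ?thesis by blast
qed

lemma labels_join:
  assumes "W \<in> glue_classes a b"
  shows "labels (join W) = (if free_ends W = {} then block W else free_ends W)"
  by (simp add: join_def)

lemma labels_join_subset: "W \<in> glue_classes a b \<Longrightarrow> labels (join W) \<subseteq> block W"
  using free_ends_iff by (auto simp: join_def)

lemma block_count:
  assumes "W \<in> glue_classes a b" "l \<in> block W"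
  shows "count (M + N) l = 1 \<or> count (M + N) l = 2"
proof -
  obtain u where u: "u \<in> W" "l \<in> labels (untag u)" using assms by blast
  have "u \<in> curves"
    using assms u adj_class_subset unfolding glue_classes_def by blast
  then have "count M l \<ge> 1 \<or> count N l \<ge> 1"
    using u shape_ok_pos[OF a] shape_ok_pos[OF b] by auto
  then show ?thesis unfolding count_union using le'[of l] by linarith
qed

lemma shape_ok_glue: "shape_ok (M + N) (glue a b)"
  unfolding shape_ok_def
proof (intro conjI ballI allI impI)
  have "finite curves"
    using shape_okD(1)[OF a] shape_okD(1)[OF b] by blast
  then show "finite (glue a b)"
    unfolding glue_def glue_classes_def using finite_adj_classes by blast
  show "count (M + N) l \<le> 2" for l by (rule le)
  show "finite (labels c)" if "c \<in> glue a b" for c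
    using that finite_block labels_join_subset unfolding glue_def
    by (metis finite_subset imageE)
  show "labels c \<noteq> {}" if "c \<in> glue a b" for c
  proof -
    from that obtain W where W: "W \<in> glue_classes a b" "c = join W"
      unfolding glue_def by blast
    then show ?thesis using block_nonempty[OF W(1)] labels_join[OF W(1)] by metis
  qed
  show "count (M + N) l = 1" if "c \<in> glue a b" "l \<in> ends c" for c l
  proof -
    from that obtain W where W: "W \<in> glue_classes a b" "c = join W"
      unfolding glue_def by blast
    then have "l \<in> free_ends W" using that(2) by (auto simp: join_def split: if_splits)
    then show ?thesis using free_ends_iff W by blast
  qed
  show "count (M + N) l = 2" if "c \<in> glue a b" "l \<in> labels c - ends c" for c l
  proof -
    from that obtain W where W: "W \<in> glue_classes a b" "c = join W"
      unfolding glue_def by blast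
    then have "free_ends W = {}" "l \<in> block W"
      using that(2) by (auto simp: join_def split: if_splits)
    then show ?thesis using free_ends_iff[OF W(1), of l] block_count[OF W(1)] by blast
  qed
  show "\<exists>c\<in>glue a b. l \<in> ends c" if "count (M + N) l = 1" for l
  proof -
    have "\<exists>u \<in> curves. l \<in> ends (untag u)"
    proof (cases "count M l = 1")
      case True
      then obtain c where "c \<in> a" "l \<in> ends c" using shape_okD(7)[OF a] by blast
      then show ?thesis by (intro bexI[of _ "Inl c"]) auto
    next
      case False
      then have "count N l = 1" using that by auto
      then obtain c where "c \<in> b" "l \<in> ends c" using shape_okD(7)[OF b] by blast
      then show ?thesis by (intro bexI[of _ "Inr c"]) auto
    qed
    then obtain u where u: "u \<in> curves" "l \<in> ends (untag u)" by blast
    then obtain W where W: "W \<in> glue_classes a b" "u \<in> W"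
      using adj_class_exists unfolding glue_classes_def by metis
    then have "l \<in> free_ends W"
      using free_ends_iff[OF W(1)] u that ends_subset_labels by blast
    then have "l \<in> ends (join W)" by (auto simp: join_def)
    then show ?thesis using W unfolding glue_def by blast
  qed
  show "c = d" if "c \<in> glue a b" "d \<in> glue a b" "labels c \<inter> labels d \<noteq> {}" for c d
  proof -
    from that(1,2) obtain W W' where W: "W \<in> glue_classes a b" "c = join W"
        "W' \<in> glue_classes a b" "d = join W'"
      unfolding glue_def by blast
    from that(3) obtain l where "l \<in> labels c" "l \<in> labels d" by blast
    then have "l \<in> block W" "l \<in> block W'"
      using W labels_join_subset by blast+
    then have "W = W'" using block_disjoint W by blast
    then show ?thesis using W by simp
  qed
qed

lemma conn_block:
  assumes W: "W \<in> glue_classes a b" and "x \<in> block W" "y \<in> block W"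
  shows "conn (hyper a \<union> hyper b) x y"
proof -
  let ?H = "hyper a \<union> hyper b"
  obtain u v where uv: "u \<in> W" "x \<in> labels (untag u)" "v \<in> W" "y \<in> labels (untag v)"
    using assms by blast
  have lab: "labels (untag w) \<in> ?H" if "w \<in> curves" for w
    using that by auto
  have uc: "u \<in> curves"
    using W uv adj_class_subset unfolding glue_classes_def by blast
  have "(u, v) \<in> (adj_edges share_end curves)\<^sup>*"
    using adj_class_path[OF W[unfolded glue_classes_def] uv(1,3)] .
  then have "\<forall>y \<in> labels (untag v). conn ?H x y"
  proof (induction rule: rtrancl_induct)
    case base
    show ?case using lab[OF uc] uv(2) by (auto intro: conn_edge)
  next
    case (step v w)
    then have vw: "v \<in> curves" "w \<in> curves" "share_end v w \<or> share_end w v"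
      by (auto simp: adj_edges_def)
    then have "ends (untag v) \<inter> ends (untag w) \<noteq> {}"
      by (cases v; cases w) auto
    then obtain l where l: "l \<in> labels (untag v)" "l \<in> labels (untag w)"
      using ends_subset_labels by blast
    show ?case
    proof
      fix z assume "z \<in> labels (untag w)"
      then have "conn ?H l z"
        using l lab[OF vw(2)] by (intro conn_edge[of "labels (untag w)"])
      moreover have "conn ?H x l" using step.IH l by blast
      ultimately show "conn ?H x z" by (rule conn_trans[rotated])
    qed
  qed
  then show ?thesis using uv by blast
qed

text \<open>Uniting the curves of a class does not change connectivity, and the labels that
  \<open>join\<close> then forgets are interior, hence invisible to every admissible
  context.\<close>

lemma reduces_glue: "reduces (interior (M + N)) 0 (hyper a \<union> hyper b) (hyper (glue a b))"
  unfolding reduces_def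
proof (intro allI impI)
  fix Z :: "nat set set"
  assume fin: "finite (\<Union>Z)" and Z: "\<Union>Z \<inter> interior (M + N) = {}"
  let ?H = "hyper a \<union> hyper b" and ?P = "block ` glue_classes a b"
  define F where "F = {l. count (M + N) l = 1}"
  \<comment> \<open>This mirrors \<open>join\<close>: a class without free ends is a circle and
    keeps all its labels as its name, any other class is an arc and keeps only the free
    ends.\<close>
  define s where "s X = (if X \<inter> F = {} then X else X \<inter> F)" for X
  have sub: "\<exists>X\<in>?P. h \<subseteq> X" if "h \<in> ?H" for h
  proof -
    from that obtain u where "u \<in> curves" "h = labels (untag u)" by force
    moreover from this obtain W where "W \<in> glue_classes a b" "u \<in> W"
      using adj_class_exists unfolding glue_classes_def by metis
    ultimately show ?thesis by blast
  qed
  have sup: "block W \<subseteq> \<Union>?H" if "W \<in> glue_classes a b" for W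
  proof (rule UN_least)
    fix u assume "u \<in> W"
    then have "u \<in> curves"
      using adj_class_subset[OF that[unfolded glue_classes_def]] by (rule subsetD[rotated])
    then have "labels (untag u) \<in> ?H" by auto
    then show "labels (untag u) \<subseteq> \<Union>?H" by (rule Union_upper)
  qed
  have "num_components (?H \<union> Z) = num_components (?P \<union> Z)"
  proof (rule num_components_eqI)
    show "\<Union>(?H \<union> Z) = \<Union>(?P \<union> Z)"
    proof -
      have "\<Union>?H \<subseteq> \<Union>?P"
      proof (rule Union_least)
        fix h assume "h \<in> ?H"
        from sub[OF this] obtain X where "X \<in> ?P" "h \<subseteq> X" by (elim bexE)
        then show "h \<subseteq> \<Union>?P" by blast
      qed
      moreover have "\<Union>?P \<subseteq> \<Union>?H"
        using sup by (intro Union_least) (elim imageE, simp only:)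
      ultimately have "\<Union>?H = \<Union>?P" by (rule equalityI)
      then show ?thesis by (simp only: Union_Un_distrib)
    qed
    show "conn (?P \<union> Z) u v" if "h \<in> ?H \<union> Z" "u \<in> h" "v \<in> h" for h u v
    proof -
      have "\<exists>X \<in> ?P \<union> Z. h \<subseteq> X"
        using that(1)
      proof
        assume "h \<in> ?H"
        from sub[OF this] show ?thesis by (meson UnI1)
      qed (meson UnI2 subset_refl)
      then obtain X where "X \<in> ?P \<union> Z" "h \<subseteq> X" by blast
      then show ?thesis using that(2,3) by (meson conn_edge subsetD)
    qed
    show "conn (?H \<union> Z) u v" if "h \<in> ?P \<union> Z" "u \<in> h" "v \<in> h" for h u v
      using that(1)
    proof
      assume "h \<in> ?P"
      then obtain W where "W \<in> glue_classes a b" "h = block W" by blast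
      then have "conn ?H u v" using conn_block that by blast
      then show ?thesis by (rule conn_mono) simp
    next
      assume "h \<in> Z"
      then show ?thesis using that(2,3) by (intro conn_edge[of h]) simp_all
    qed
  qed
  also have "\<dots> = num_components (s ` ?P \<union> Z)"
  proof (rule num_components_shrink)
    show "X \<inter> Y = {}" if "X \<in> ?P" "Y \<in> ?P" "X \<noteq> Y" for X Y
    proof -
      from that obtain W W' where "W \<in> glue_classes a b" "X = block W"
        "W' \<in> glue_classes a b" "Y = block W'" by blast
      then show ?thesis using block_disjoint[of W W'] that(3) by blast
    qed
    show "s X \<subseteq> X \<and> s X \<noteq> {}" if "X \<in> ?P" for X
      using that block_nonempty by (auto simp: s_def)
    show "(X - s X) \<inter> \<Union>Z = {}" if "X \<in> ?P" for X
    proof -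
      from that obtain W where W: "W \<in> glue_classes a b" "X = block W" by blast
      have "X - s X \<subseteq> interior (M + N)"
        using block_count[OF W(1)] W(2) by (auto simp: s_def F_def interior_def split: if_splits)
      then show ?thesis using Z by blast
    qed
  qed
  also have "s ` ?P = hyper (glue a b)"
  proof -
    have "s (block W) = labels (join W)" if "W \<in> glue_classes a b" for W
    proof -
      have "free_ends W = block W \<inter> F"
        using free_ends_iff[OF that] by (auto simp: F_def)
      then show ?thesis by (simp add: labels_join[OF that] s_def)
    qed
    then show ?thesis
      unfolding glue_def image_image by (intro image_cong refl)
  qed
  finally show "num_components (?H \<union> Z) = 0 + num_components (hyper (glue a b) \<union> Z)"
    by simp
qed

end

lemma shape_ok_strand: "shape_ok {#i, j#} (strand i j)"
  by (auto simp: shape_ok_def strand_def)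

lemma hyper_strand: "hyper (strand i j) = {{i, j}}"
  by (auto simp: strand_def)

lemma glue_strands:
  assumes "\<And>m. count {#i, j, k, l#} m \<le> 2"
  shows "shape_ok {#i, j, k, l#} (glue (strand i j) (strand k l))"
    and "reduces (interior {#i, j, k, l#}) 0 {{i, j}, {k, l}} (hyper (glue (strand i j) (strand k l)))"
proof -
  have M: "{#i, j#} + {#k, l#} = {#i, j, k, l#}" by simp
  interpret gluing "{#i, j#}" "{#k, l#}" "strand i j" "strand k l"
    by (unfold_locales, unfold M) (rule shape_ok_strand assms)+
  show "shape_ok {#i, j, k, l#} (glue (strand i j) (strand k l))"
    using shape_ok_glue unfolding M .
  show "reduces (interior {#i, j, k, l#}) 0 {{i, j}, {k, l}} (hyper (glue (strand i j) (strand k l)))"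
    using reduces_glue unfolding M hyper_strand by (simp only: Un_insert_left Un_empty_left)
qed

lemma shape_ok_no_boundary:
  assumes "shape_ok M s" "\<And>l. count M l \<noteq> 1" "\<And>n. Circle n \<notin> s"
  shows "s = {}"
proof -
  have "c \<notin> s" for c
    using shape_okD(4,5)[OF assms(1), of c] assms(2,3) by (cases c) auto
  then show ?thesis by blast
qed

text \<open>The labels of a circle are interior and meet neither another curve nor the context, so
  the circle is a component of its own. This is the source of the factor that delooping distributes
  over two copies.\<close>

lemma reduces_circle:
  assumes s: "shape_ok M s" and c: "Circle n \<in> s"
  shows "reduces (interior M) 1 (hyper s) (hyper (s - {Circle n}))"
  unfolding reduces_def
proof (intro allI impI)
  fix Z :: "nat set set"
  assume fin: "finite (\<Union>Z)" and Z: "\<Union>Z \<inter> interior M = {}"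
  let ?s = "s - {Circle n}"
  have "n \<subseteq> interior M"
    using shape_okD(6)[OF s c] by (auto simp: interior_def)
  then have "n \<inter> \<Union>Z = {}" using Z by blast
  moreover have "n \<inter> labels d = {}" if "d \<in> ?s" for d
    using shape_okD(8)[OF s c, of d] that by auto
  ultimately have "n \<inter> \<Union>(hyper ?s \<union> Z) = {}" by blast
  moreover have "finite (\<Union>(hyper ?s \<union> Z))"
    using fin shape_okD(1,3)[OF s] by auto
  moreover have "n \<noteq> {}" using shape_okD(4)[OF s c] by simp
  ultimately have "num_components (insert n (hyper ?s \<union> Z)) = Suc (num_components (hyper ?s \<union> Z))"
    by (intro num_components_insert_disjoint)
  moreover have "s = insert (Circle n) ?s" using c by blast
  then have "hyper s = insert n (hyper ?s)" by (metis image_insert labels.simps(2))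
  then have "hyper s \<union> Z = insert n (hyper ?s \<union> Z)" by simp
  ultimately show "num_components (hyper s \<union> Z) = 1 + num_components (hyper ?s \<union> Z)"
    by simp
qed

lemma shape_ok_delete_circle:
  assumes "shape_ok M s"
  shows "shape_ok M (s - {Circle n})"
proof -
  have "\<exists>c\<in>s - {Circle n}. l \<in> ends c" if l: "count M l = 1" for l
    using shape_okD(7)[OF assms l] by force
  then show ?thesis
    using assms unfolding shape_ok_def by (simp only: Diff_iff finite_Diff) blast
qed

section \<open>Isomorphisms in Bar-Natan's category\<close>

text \<open>A sheet is evaluated by the relations after setting every dot on a sheet with boundary to
  zero: closed sheets are evaluated, and of the others only undotted discs survive.\<close>

definition sheet_val :: "sheet \<Rightarrow> int" where
  "sheet_val x =
     (if closed_sheet x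
      then if chi x = 2 \<and> dots x = 1 then 1 else if chi x = 0 \<and> dots x = 0 then 2 else 0
      else if chi x = 1 \<and> dots x = 0 then 1 else 0)"

definition cob_val :: "cob \<Rightarrow> int" where
  "cob_val K = prod_mset (image_mset sheet_val K)"

definition mor_val :: "'r::comm_ring_1 mor \<Rightarrow> 'r" where
  "mor_val f = (\<Sum>K\<in>Poly_Mapping.keys f. Poly_Mapping.lookup f K * of_int (cob_val K))"

lemma mor_val_superset:
  assumes "finite A" "Poly_Mapping.keys f \<subseteq> A"
  shows "mor_val f = (\<Sum>K\<in>A. Poly_Mapping.lookup f K * of_int (cob_val K))"
  unfolding mor_val_def using assms
  by (intro sum.mono_neutral_left) (auto simp: in_keys_iff)

lemma mor_val_zero [simp]: "mor_val 0 = 0"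
  by (simp add: mor_val_def)

lemma mor_val_add: "mor_val (f + g) = mor_val f + mor_val g"
proof -
  let ?A = "Poly_Mapping.keys f \<union> Poly_Mapping.keys g"
  have "Poly_Mapping.keys (f + g) \<subseteq> ?A" by (rule Poly_Mapping.keys_add)
  then show ?thesis
    by (simp add: mor_val_superset[of ?A] lookup_add distrib_right sum.distrib)
qed

lemma mor_val_diff: "mor_val (f - g) = mor_val f - mor_val g"
proof -
  have "mor_val f = mor_val ((f - g) + g)" by simp
  then show ?thesis unfolding mor_val_add by simp
qed

lemma mor_val_single [simp]: "mor_val (Poly_Mapping.single K r) = r * of_int (cob_val K)"
  by (cases "r = 0") (simp_all add: mor_val_def)

lemma mor_val_sum: "mor_val (sum f A) = (\<Sum>x\<in>A. mor_val (f x))"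
  by (induction A rule: infinite_finite_induct) (simp_all add: mor_val_add)

lemma mor_val_scale: "mor_val (scale r f) = r * mor_val f"
  by (simp add: scale_def mor_val_sum mor_val_def[of f] sum_distrib_left mult.assoc)

lemma mor_val_bilinear:
  "mor_val (bilinear m f g) = (\<Sum>K\<in>Poly_Mapping.keys f. \<Sum>L\<in>Poly_Mapping.keys g.
     Poly_Mapping.lookup f K * Poly_Mapping.lookup g L * of_int (cob_val (m K L)))"
  by (simp add: bilinear_def mor_val_sum)

lemma cob_val_union [simp]: "cob_val (K + L) = cob_val K * cob_val L"
  by (simp add: cob_val_def)

lemma cob_val_add_mset [simp]: "cob_val (add_mset x K) = sheet_val x * cob_val K"
  by (simp add: cob_val_def)

lemma cob_val_empty [simp]: "cob_val {#} = 1"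
  by (simp add: cob_val_def)

lemma closed_sheet_Sheet [simp]: "closed_sheet (Sheet S T e d) \<longleftrightarrow> S = {} \<and> T = {}"
  by (simp add: closed_sheet_def)

lemma valid_closed_sheet:
  assumes "valid_sheet x" "closed_sheet x"
  shows "\<exists>g::nat. chi x = 2 - 2 * int g"
proof -
  have "glue_classes {} {} = {}"
    using adj_class_subset adj_class_nonempty unfolding glue_classes_def by blast
  then show ?thesis
    using assms by (auto simp: valid_sheet_def closed_sheet_def)
qed

text \<open>At least one boundary circle is present, so the Euler characteristic is at most that of
  a disc.\<close>

lemma valid_open_sheet:
  assumes "valid_sheet x" "\<not> closed_sheet x" "finite (lower x)" "finite (upper x)"
  shows "chi x \<le> 1"
proof -
  let ?A = "Inl ` lower x \<union> Inr ` upper x"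
  obtain u where "u \<in> ?A"
    using assms(2) by (auto simp: closed_sheet_def)
  then have "glue_classes (lower x) (upper x) \<noteq> {}"
    using adj_class_exists[of u ?A share_end] unfolding glue_classes_def by blast
  moreover have "finite (glue_classes (lower x) (upper x))"
    using assms(3,4) unfolding glue_classes_def by (intro finite_adj_classes) simp
  ultimately have "card (glue_classes (lower x) (upper x)) > 0"
    by (simp add: card_gt_0_iff)
  then show ?thesis
    using assms(1) by (auto simp: valid_sheet_def)
qed

lemma cobsD:
  assumes "K \<in> cobs a b"
  shows "x \<in># K \<Longrightarrow> valid_sheet x" "x \<in># K \<Longrightarrow> lower x \<subseteq> a" "x \<in># K \<Longrightarrow> upper x \<subseteq> b"
    "c \<in> a \<Longrightarrow> size {#x \<in># K. c \<in> lower x#} = 1"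
    "c \<in> b \<Longrightarrow> size {#x \<in># K. c \<in> upper x#} = 1"
    "x \<in># K \<Longrightarrow> c \<in> lower x \<Longrightarrow> d \<in> b \<Longrightarrow> l \<in> ends c \<Longrightarrow> l \<in> ends d \<Longrightarrow> d \<in> upper x"
  using assms unfolding cobs_def by blast+

lemma cobs_sheet_cases:
  assumes "K \<in> cobs a b" "Sheet S T e d \<in># K" "finite a" "finite b"
  obtains "S = {}" "T = {}" "\<exists>g::nat. e = 2 - 2 * int g" | "\<not> (S = {} \<and> T = {})" "e \<le> 1"
proof (cases "S = {} \<and> T = {}")
  case True
  then show ?thesis using that(1) valid_closed_sheet[of "Sheet S T e d"] cobsD(1)[OF assms(1,2)] by simp
next
  case False
  moreover have "finite S" "finite T"
    using cobsD(2,3)[OF assms(1,2)] assms(3,4) finite_subset by auto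
  ultimately show ?thesis
    using that(2) valid_open_sheet[of "Sheet S T e d"] cobsD(1)[OF assms(1,2)] by simp
qed

text \<open>For two closed sheets the genera add, and only total genus at most one survives. If just
  one is closed, the union is a disc only if that one is a sphere. If both have boundary, the union
  has nonpositive Euler characteristic, and each product contains a dotted sheet with boundary, so
  everything vanishes.\<close>

lemma sheet_val_neck_separating:
  assumes K: "K + {#Sheet S T e d, Sheet S' T' e' d'#} \<in> cobs a b" and fin: "finite a" "finite b"
  shows "sheet_val (Sheet (S \<union> S') (T \<union> T') (e + e' - 2) (d + d')) =
    sheet_val (Sheet S T e (d + 1)) * sheet_val (Sheet S' T' e' d') +
    sheet_val (Sheet S T e d) * sheet_val (Sheet S' T' e' (d' + 1))"
proof -
  have x: "Sheet S T e d \<in># K + {#Sheet S T e d, Sheet S' T' e' d'#}"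
    and y: "Sheet S' T' e' d' \<in># K + {#Sheet S T e d, Sheet S' T' e' d'#}" by simp_all
  from K x fin show ?thesis
  proof (cases rule: cobs_sheet_cases)
    case 1
    note X = this
    from K y fin show ?thesis
    proof (cases rule: cobs_sheet_cases)
      case 1
      obtain g g' :: nat where g: "e = 2 - 2 * int g" "e' = 2 - 2 * int g'"
        using X(3) 1(3) by blast
      consider "g = 0" | "g = 1" | "g \<ge> 2" by linarith
      then show ?thesis
        using 1 X g by cases (auto simp: sheet_val_def)
    next
      case 2
      obtain g :: nat where g: "e = 2 - 2 * int g" using X(3) by blast
      then show ?thesis using 2 X by (cases g) (auto simp: sheet_val_def)
    qed
  next
    case 2
    note X = this
    from K y fin show ?thesis
    proof (cases rule: cobs_sheet_cases)
      case 1
      obtain g :: nat where g: "e' = 2 - 2 * int g" using 1(3) by blast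
      then show ?thesis using 1 X by (cases g) (auto simp: sheet_val_def)
    next
      case 2
      then show ?thesis using X by (auto simp: sheet_val_def)
    qed
  qed
qed

lemma sheet_val_neck_nonseparating:
  assumes K: "K + {#Sheet S T e d#} \<in> cobs a b" and fin: "finite a" "finite b"
  shows "sheet_val (Sheet S T (e - 2) d) = 2 * sheet_val (Sheet S T e (d + 1))"
proof -
  have x: "Sheet S T e d \<in># K + {#Sheet S T e d#}" by simp
  from K x fin show ?thesis
  proof (cases rule: cobs_sheet_cases)
    case 1
    then obtain g :: nat where "e = 2 - 2 * int g" by blast
    then show ?thesis using 1 by (cases g) (auto simp: sheet_val_def)
  next
    case 2
    then show ?thesis by (auto simp: sheet_val_def)
  qed
qed

text \<open>Hence the evaluation descends to morphisms of Bar-Natan's category. Finiteness of the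
  diagrams makes the number of boundary circles a true cardinality and so bounds the Euler
  characteristic of sheets with boundary.\<close>

lemma mor_val_null:
  assumes "f \<in> null_mors a b" "finite a" "finite b"
  shows "mor_val f = 0"
  using assms(1)
proof (induction rule: null_mors.induct)
  case (neck_separating K S T e d S' T' e' d')
  have "mor_val (of_cob (K + {#Sheet (S \<union> S') (T \<union> T') (e + e' - 2) (d + d')#})
       - of_cob (K + {#Sheet S T e (d + 1), Sheet S' T' e' d'#})
       - of_cob (K + {#Sheet S T e d, Sheet S' T' e' (d' + 1)#}) :: 'a mor) =
    of_int (cob_val K * (sheet_val (Sheet (S \<union> S') (T \<union> T') (e + e' - 2) (d + d')) -
      sheet_val (Sheet S T e (d + 1)) * sheet_val (Sheet S' T' e' d') -
      sheet_val (Sheet S T e d) * sheet_val (Sheet S' T' e' (d' + 1))))"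
    unfolding mor_val_diff mor_val_single by (simp add: algebra_simps)
  then show ?case
    unfolding sheet_val_neck_separating[OF neck_separating assms(2,3)] by simp
next
  case (neck_nonseparating K S T e d)
  have "mor_val (of_cob (K + {#Sheet S T (e - 2) d#})
       - of_cob (K + {#Sheet S T e (d + 1)#})
       - of_cob (K + {#Sheet S T e (d + 1)#}) :: 'a mor) =
    of_int (cob_val K * (sheet_val (Sheet S T (e - 2) d) - 2 * sheet_val (Sheet S T e (d + 1))))"
    unfolding mor_val_diff mor_val_single by (simp add: algebra_simps)
  then show ?case
    unfolding sheet_val_neck_nonseparating[OF neck_nonseparating assms(2,3)] by simp
qed (simp_all add: mor_val_add mor_val_diff mor_val_scale sheet_val_def)

text \<open>Over arcs the identity consists of undotted discs. A circle would contribute an annulus,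
  of value zero.\<close>

lemma cob_val_id:
  assumes "\<And>n. Circle n \<notin> a"
  shows "cob_val (id_cob a) = 1"
proof -
  have "sheet_val (Sheet {c} {c} (curve_chi c) 0) = 1" if "c \<in> a" for c
    using that assms by (cases c) (auto simp: sheet_val_def)
  moreover have "c \<in> a" if "c \<in># mset_set a" for c
    using that by (cases "finite a") auto
  ultimately show ?thesis
    unfolding cob_val_def id_cob_def multiset.map_comp by (intro prod_mset.neutral) auto
qed

section \<open>Degrees of cobordisms between diagrams without circles\<close>

lemma filter_size_one_unique:
  assumes "size {#x \<in># K. P x#} = 1" "x \<in># K" "y \<in># K" "P x" "P y"
  shows "x = y"
proof -
  obtain z where z: "{#x \<in># K. P x#} = {#z#}"
    using assms(1) size_1_singleton_mset by blast
  have "x \<in># {#x \<in># K. P x#}" "y \<in># {#x \<in># K. P x#}" using assms(2-) by simp_all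
  then show ?thesis unfolding z by simp
qed

lemma filter_size_one_exists:
  assumes "size {#x \<in># K. P x#} = 1"
  shows "\<exists>x. x \<in># K \<and> P x"
proof -
  obtain z where "{#x \<in># K. P x#} = {#z#}"
    using assms size_1_singleton_mset by blast
  then have "z \<in># {#x \<in># K. P x#}" by simp
  then show ?thesis by auto
qed

lemma sum_card_lower:
  assumes "finite a" "\<And>x. x \<in># K \<Longrightarrow> lower x \<subseteq> a"
  shows "(\<Sum>x\<in>#K. card (lower x)) = (\<Sum>c\<in>a. size {#x \<in># K. c \<in> lower x#})"
  using assms(2)
proof (induction K)
  case (add x K)
  then have "lower x \<subseteq> a" by simp
  then have "card (lower x) = (\<Sum>c\<in>a. if c \<in> lower x then 1 else 0)"
    using assms(1) by (simp add: sum.If_cases Int_absorb1)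
  moreover have "(\<Sum>c\<in>a. size {#y \<in># add_mset x K. c \<in> lower y#}) =
      (\<Sum>c\<in>a. (if c \<in> lower x then 1 else 0) + size {#y \<in># K. c \<in> lower y#})"
    by (intro sum.cong) auto
  ultimately show ?case using add by (simp add: sum.distrib)
qed simp

text \<open>The assumption \<open>closed\<close> says that closed sheets have degree zero. It holds
  for cobordisms that contribute to a nonzero evaluation, since the only closed sheets of nonzero
  value are the sphere with one dot and the undotted torus.\<close>

locale arc_cob =
  fixes M :: "nat multiset" and a b :: shape and K :: cob
  assumes a: "shape_ok M a" and b: "shape_ok M b"
    and arcs: "\<And>n. Circle n \<notin> a" "\<And>n. Circle n \<notin> b"
    and K: "K \<in> cobs a b"
    and closed: "\<And>x. x \<in># K \<Longrightarrow> closed_sheet x \<Longrightarrow> chi x = 2 * int (dots x)"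
begin

text \<open>The vertical boundary interval over \<open>l\<close> puts the upper curve and the lower
  curve ending at \<open>l\<close> into the same sheet.\<close>

lemma sheet_below:
  assumes "d \<in> b" "x \<in># K" "d \<in> upper x" "l \<in> ends d"
  shows "\<exists>c\<in>lower x. l \<in> ends c"
proof -
  have "count M l = 1" using shape_okD(5)[OF b] assms by blast
  then obtain c where c: "c \<in> a" "l \<in> ends c" using shape_okD(7)[OF a] by blast
  then obtain y where y: "y \<in># K" "c \<in> lower y"
    using filter_size_one_exists[OF cobsD(4)[OF K]] by blast
  then have "d \<in> upper y" using cobsD(6)[OF K] c assms by blast
  then have "x = y" using filter_size_one_unique[OF cobsD(5)[OF K assms(1)]] assms y by blast
  then show ?thesis using c y by blast
qed

lemma ends_nonempty: "d \<in> b \<Longrightarrow> ends d \<noteq> {}"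
  using shape_okD(4)[OF b, of d] arcs(2) by (cases d) auto

lemma lower_nonempty:
  assumes "x \<in># K" "\<not> closed_sheet x"
  shows "lower x \<noteq> {}"
proof
  assume low: "lower x = {}"
  then obtain d where d: "d \<in> upper x" using assms(2) by (auto simp: closed_sheet_def)
  then have "d \<in> b" using cobsD(3)[OF K assms(1)] by blast
  then show False using ends_nonempty sheet_below assms(1) d low by blast
qed

text \<open>A sheet with boundary lies over at least one arc and is at best a disc, so it lowers the
  degree unless it is an undotted disc over a single arc.\<close>

lemma sheet_bound:
  assumes "x \<in># K"
  shows "chi x - 2 * int (dots x) \<le> int (card (lower x))"
    and "chi x - 2 * int (dots x) = int (card (lower x)) \<Longrightarrow> \<not> closed_sheet x \<Longrightarrow> card (lower x) = 1"
proof -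
  have fin: "finite (lower x)" "finite (upper x)"
    using cobsD(2,3)[OF K assms] shape_okD(1)[OF a] shape_okD(1)[OF b] finite_subset by auto
  have op: "chi x \<le> 1 \<and> card (lower x) \<ge> 1" if "\<not> closed_sheet x"
    using valid_open_sheet[OF cobsD(1)[OF K assms] that fin] lower_nonempty[OF assms that] fin(1)
    by (simp add: Suc_le_eq card_gt_0_iff)
  show "chi x - 2 * int (dots x) \<le> int (card (lower x))"
    using op closed[OF assms] by (cases "closed_sheet x") auto
  show "chi x - 2 * int (dots x) = int (card (lower x)) \<Longrightarrow> \<not> closed_sheet x \<Longrightarrow> card (lower x) = 1"
    using op by auto
qed

lemma cob_degree_alt:
  "cob_degree a K = (\<Sum>x\<in>#K. chi x - 2 * int (dots x) - int (card (lower x)))"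
proof -
  have ca: "(\<Sum>x\<in>#K. card (lower x)) = card a"
    using sum_card_lower[OF shape_okD(1)[OF a] cobsD(2)[OF K]] cobsD(4)[OF K] by simp
  have sub: "(\<Sum>x\<in>#L. f x - g x) = (\<Sum>x\<in>#L. f x) - (\<Sum>x\<in>#L. g x)"
    for L :: cob and f g :: "sheet \<Rightarrow> int"
    by (induction L) simp_all
  have "int (\<Sum>x\<in>#L. card (lower x)) = (\<Sum>x\<in>#L. int (card (lower x)))" for L
    by (induction L) auto
  then have "int (card a) = (\<Sum>x\<in>#K. int (card (lower x)))" using ca by metis
  moreover have "(\<Sum>c\<in>a. curve_chi c) = (\<Sum>c\<in>a. 1)"
  proof (intro sum.cong refl)
    show "curve_chi c = 1" if "c \<in> a" for c
      using that arcs(1) by (cases c) auto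
  qed
  ultimately show ?thesis
    by (simp add: cob_degree_def sub)
qed

lemma cob_degree_nonpos: "cob_degree a K \<le> 0"
proof -
  have "cob_degree a K \<le> (\<Sum>x\<in>#K. 0)"
    unfolding cob_degree_alt by (intro sum_mset_mono) (use sheet_bound in force)
  then show ?thesis by simp
qed

lemma single_lower:
  assumes "cob_degree a K = 0" "x \<in># K" "\<not> closed_sheet x"
  shows "card (lower x) = 1"
proof (rule sheet_bound(2)[OF assms(2) _ assms(3)])
  let ?f = "\<lambda>x. chi x - 2 * int (dots x) - int (card (lower x))"
  obtain L where L: "K = add_mset x L" using assms(2) by (metis insert_DiffM)
  have "(\<Sum>y\<in>#L. ?f y) \<le> (\<Sum>y\<in>#L. 0)"
    by (intro sum_mset_mono) (use sheet_bound L in force)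
  moreover have "(\<Sum>y\<in>#K. ?f y) = ?f x + (\<Sum>y\<in>#L. ?f y)" by (simp add: L)
  ultimately have "?f x \<ge> 0" using assms(1) cob_degree_alt by simp
  then show "chi x - 2 * int (dots x) = int (card (lower x))"
    using sheet_bound(1)[OF assms(2)] by linarith
qed

lemma ends_refine:
  assumes "cob_degree a K = 0" "d \<in> b"
  shows "\<exists>c\<in>a. ends d \<subseteq> ends c"
proof -
  obtain x where x: "x \<in># K" "d \<in> upper x"
    using filter_size_one_exists[OF cobsD(5)[OF K assms(2)]] by blast
  then have "\<not> closed_sheet x" by (auto simp: closed_sheet_def)
  then obtain c where c: "lower x = {c}"
    using single_lower[OF assms(1) x(1)] card_1_singletonE by metis
  then have "ends d \<subseteq> ends c" using sheet_below[OF assms(2) x] by auto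
  moreover have "c \<in> a" using c cobsD(2)[OF K x(1)] by blast
  ultimately show ?thesis by blast
qed

end

text \<open>Each set of arcs refines the other as a partition of the boundary points. Going there
  and back stays within one arc, so all inclusions are equalities.\<close>

lemma arcs_subset:
  assumes a: "shape_ok M a" "\<And>n. Circle n \<notin> a" and b: "\<And>n. Circle n \<notin> b"
    and ab: "\<And>c. c \<in> a \<Longrightarrow> \<exists>d\<in>b. ends c \<subseteq> ends d"
    and ba: "\<And>d. d \<in> b \<Longrightarrow> \<exists>c\<in>a. ends d \<subseteq> ends c"
  shows "a \<subseteq> b"
proof
  fix c assume c: "c \<in> a"
  then obtain s where s: "c = Arc s" using a(2) by (cases c) auto
  obtain d where d: "d \<in> b" "ends c \<subseteq> ends d" using ab c by blast
  obtain c' where c': "c' \<in> a" "ends d \<subseteq> ends c'" using ba d by blast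
  obtain l where "l \<in> ends c" using shape_okD(4)[OF a(1) c] s by auto
  then have "c = c'"
    using shape_okD(8)[OF a(1) c c'(1)] d c' ends_subset_labels by blast
  then have "ends d = ends c" using d c' by blast
  moreover obtain t where "d = Arc t" using d(1) b by (cases d) auto
  ultimately show "c \<in> b" using s d by simp
qed

text \<open>The identity evaluates to one, so some \<open>K\<close> and \<open>L\<close> have a
  composite of nonzero value. Their degrees are at most zero, and the shifts make the degrees
  opposite; so both are zero, the shifts agree, and in degree zero the arcs refine each
  other.\<close>

lemma inverse_mors_arcs:
  fixes f g :: "'r::comm_ring_1 mor"
  assumes inv: "inverse_mors (a, m) (b, n) f g"
    and a: "shape_ok M a" "\<And>n. Circle n \<notin> a" and b: "shape_ok M b" "\<And>n. Circle n \<notin> b"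
  shows "a = b \<and> m = n"
proof -
  have fin: "finite a" using shape_okD(1)[OF a(1)] .
  have "mor_val (bilinear vcomp f g - of_cob (id_cob a)) = 0"
    by (intro mor_val_null[OF _ fin fin]) (use inv in \<open>simp add: inverse_mors_def\<close>)
  then have "mor_val (bilinear vcomp f g) = 1"
    using cob_val_id[of a] a(2) by (simp add: mor_val_diff)
  then have "(\<Sum>K\<in>Poly_Mapping.keys f. \<Sum>L\<in>Poly_Mapping.keys g. Poly_Mapping.lookup f K *
      Poly_Mapping.lookup g L * of_int (cob_val (vcomp K L))) \<noteq> 0"
    by (simp add: mor_val_bilinear)
  then obtain K where K: "K \<in> Poly_Mapping.keys f" "(\<Sum>L\<in>Poly_Mapping.keys g. Poly_Mapping.lookup f K *
      Poly_Mapping.lookup g L * of_int (cob_val (vcomp K L))) \<noteq> 0"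
    by (rule sum.not_neutral_contains_not_neutral)
  from K(2) obtain L where L: "L \<in> Poly_Mapping.keys g" "Poly_Mapping.lookup f K *
      Poly_Mapping.lookup g L * of_int (cob_val (vcomp K L)) \<noteq> 0"
    by (rule sum.not_neutral_contains_not_neutral)
  then have "cob_val (vcomp K L) \<noteq> 0" by auto
  then have val: "sheet_val x \<noteq> 0" if "x \<in># vcomp K L" for x
    using that by (auto simp: cob_val_def prod_mset_zero_iff)
  \<comment> \<open>Composition leaves closed sheets as they are, so each of them is a factor of a
    nonzero product.\<close>
  have closed: "chi x = 2 * int (dots x)" if "x \<in># K + L" "closed_sheet x" for x
  proof -
    have "x \<in># vcomp K L" using that by (auto simp: vcomp_def)
    then show ?thesis using val[of x] that by (auto simp: sheet_val_def split: if_splits)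
  qed
  have Kh: "K \<in> cobs a b" "cob_degree a K + n - m = 0" and Lh: "L \<in> cobs b a" "cob_degree b L + m - n = 0"
    using inv K L by (auto simp: inverse_mors_def homs_def)
  interpret k: arc_cob M a b K
    using a b Kh closed by unfold_locales auto
  interpret l: arc_cob M b a L
    using a b Lh closed by unfold_locales auto
  have deg: "cob_degree a K = 0" "cob_degree b L = 0"
    using Kh Lh k.cob_degree_nonpos l.cob_degree_nonpos by linarith+
  have "a \<subseteq> b" "b \<subseteq> a"
    using arcs_subset[OF a b(2)] arcs_subset[OF b a(2)] k.ends_refine[OF deg(1)] l.ends_refine[OF deg(2)]
    by blast+
  then show ?thesis using deg Kh by simp
qed

lemma pivot_same:
  assumes "pivot C g h \<psi>" "shape_ok M (shape C g)" "shape_ok M (shape C h)"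
    "\<And>n. Circle n \<notin> shape C g" "\<And>n. Circle n \<notin> shape C h"
  shows "shape C g = shape C h \<and> qdeg C g = qdeg C h"
  using inverse_mors_arcs[of "shape C g" "qdeg C g" "shape C h" "qdeg C h"] assms
  unfolding pivot_def obj_def by blast

section \<open>State sums\<close>

text \<open>The Kauffman state sum: an entry holds the weights and the hyperedges of the two
  smoothings of a crossing, and \<open>Z\<close> accumulates the outside together with the
  smoothings already chosen.\<close>

fun state_sum ::
    "complex \<Rightarrow> (complex \<times> 'a set set \<times> complex \<times> 'a set set) list \<Rightarrow> 'a set set \<Rightarrow> complex" where
  "state_sum d [] Z = d ^ num_components Z"
| "state_sum d ((x, A, y, B) # xs) Z = x * state_sum d xs (A \<union> Z) + y * state_sum d xs (B \<union> Z)"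

definition avoids :: "'a set \<Rightarrow> (complex \<times> 'a set set \<times> complex \<times> 'a set set) list \<Rightarrow> bool" where
  "avoids I xs \<longleftrightarrow> (\<forall>(x, A, y, B) \<in> set xs.
     finite (\<Union>A) \<and> finite (\<Union>B) \<and> \<Union>A \<inter> I = {} \<and> \<Union>B \<inter> I = {})"

lemma avoids_Nil [simp]: "avoids I []"
  by (simp add: avoids_def)

lemma avoids_Cons [simp]: "avoids I ((x, A, y, B) # xs) \<longleftrightarrow>
    finite (\<Union>A) \<and> finite (\<Union>B) \<and> \<Union>A \<inter> I = {} \<and> \<Union>B \<inter> I = {} \<and> avoids I xs"
  by (simp add: avoids_def)

lemma state_sum_move: "state_sum d (xs @ x # ys) Z = state_sum d (x # xs @ ys) Z"
proof (induction xs arbitrary: Z)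
  case (Cons z xs)
  obtain x1 A x2 B where x: "x = (x1, A, x2, B)" by (cases x) auto
  obtain z1 A' z2 B' where z: "z = (z1, A', z2, B')" by (cases z) auto
  show ?case
    using Cons by (simp add: x z algebra_simps Un_left_commute)
qed simp

text \<open>This makes the final bound independent of the scanning order and of the way a diagram is
  cut.\<close>

lemma state_sum_perm: "mset xs = mset ys \<Longrightarrow> state_sum d xs Z = state_sum d ys Z"
proof (induction xs arbitrary: ys Z)
  case (Cons x xs)
  then have "x \<in> set ys" by (metis list.set_intros(1) set_mset_mset)
  then obtain as bs where ys: "ys = as @ x # bs" by (meson split_list)
  then have "mset xs = mset (as @ bs)" using Cons.prems by simp
  then have IH: "state_sum d xs Z' = state_sum d (as @ bs) Z'" for Z' by (rule Cons.IH)
  obtain x1 A x2 B where x: "x = (x1, A, x2, B)" by (cases x) auto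
  show ?case unfolding ys state_sum_move by (simp add: x IH)
qed simp

text \<open>The crossings in \<open>xs\<close> avoid the interior labels, so every choice of their
  smoothings, added to \<open>Z\<close>, is again an admissible context for the local move.\<close>

lemma state_sum_reduce:
  assumes "reduces I c H H'" "avoids I xs" "finite (\<Union>Z)" "\<Union>Z \<inter> I = {}"
  shows "state_sum d xs (H \<union> Z) = d ^ c * state_sum d xs (H' \<union> Z)"
  using assms(2-4)
proof (induction xs arbitrary: Z)
  case Nil
  then show ?case using assms(1) by (simp add: reduces_def power_add)
next
  case (Cons z xs)
  obtain x A y B where z: "z = (x, A, y, B)" by (cases z) auto
  have "state_sum d xs (H \<union> (A \<union> Z)) = d ^ c * state_sum d xs (H' \<union> (A \<union> Z))"
    using Cons.prems by (intro Cons.IH) (auto simp: z Int_Un_distrib2)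
  moreover have "state_sum d xs (H \<union> (B \<union> Z)) = d ^ c * state_sum d xs (H' \<union> (B \<union> Z))"
    using Cons.prems by (intro Cons.IH) (auto simp: z Int_Un_distrib2)
  ultimately show ?case
    by (simp add: z Un_left_commute[of _ H] Un_left_commute[of _ H'] algebra_simps)
qed

text \<open>A combination of diagrams that agrees with \<open>ys\<close> in all contexts may replace
  \<open>ys\<close> inside a larger diagram, because every state of \<open>xs\<close> is such a
  context.\<close>

lemma state_sum_linear:
  assumes "\<And>Z. finite (\<Union>Z) \<Longrightarrow> \<Union>Z \<inter> I = {} \<Longrightarrow>
      (\<Sum>h\<in>G. w h * d ^ num_components (s h \<union> Z)) = state_sum d ys Z"
    and "avoids I xs" "finite (\<Union>Z)" "\<Union>Z \<inter> I = {}"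
  shows "(\<Sum>h\<in>G. w h * state_sum d xs (s h \<union> Z)) = state_sum d (xs @ ys) Z"
  using assms(2-4)
proof (induction xs arbitrary: Z)
  case Nil
  then show ?case using assms(1) by simp
next
  case (Cons z xs)
  obtain x A y B where z: "z = (x, A, y, B)" by (cases z) auto
  have A: "(\<Sum>h\<in>G. w h * state_sum d xs (s h \<union> (A \<union> Z))) = state_sum d (xs @ ys) (A \<union> Z)"
    using Cons.prems by (intro Cons.IH) (auto simp: z Int_Un_distrib2)
  have B: "(\<Sum>h\<in>G. w h * state_sum d xs (s h \<union> (B \<union> Z))) = state_sum d (xs @ ys) (B \<union> Z)"
    using Cons.prems by (intro Cons.IH) (auto simp: z Int_Un_distrib2)
  have "(\<Sum>h\<in>G. w h * state_sum d (z # xs) (s h \<union> Z)) =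
      (\<Sum>h\<in>G. x * (w h * state_sum d xs (s h \<union> (A \<union> Z))) + y * (w h * state_sum d xs (s h \<union> (B \<union> Z))))"
    by (intro sum.cong refl) (simp add: z Un_left_commute algebra_simps)
  also have "\<dots> = x * state_sum d (xs @ ys) (A \<union> Z) + y * state_sum d (xs @ ys) (B \<union> Z)"
    by (simp only: sum.distrib sum_distrib_left[symmetric] A B)
  finally show ?case by (simp add: z)
qed

section \<open>The state sum of a link diagram\<close>

primrec piece_labels :: "piece \<Rightarrow> nat multiset" where
  "piece_labels (Pos i j k l) = {#i, j, k, l#}"
| "piece_labels (Neg i j k l) = {#i, j, k, l#}"
| "piece_labels (Loop e) = {#e, e#}"

abbreviation all_labels :: "piece list \<Rightarrow> nat multiset" where
  "all_labels xs \<equiv> sum_list (map piece_labels xs)"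

text \<open>The weights are the signed powers of \<open>q\<close> of the two generators of
  \<open>piece_cpx\<close>. A \<open>Loop\<close> receives a second smoothing of weight zero to fit
  the two-term format.\<close>

primrec piece_states :: "complex \<Rightarrow> piece \<Rightarrow> complex \<times> nat set set \<times> complex \<times> nat set set" where
  "piece_states q (Pos i j k l) = (q, {{i, j}, {k, l}}, - q\<^sup>2, {{i, l}, {j, k}})"
| "piece_states q (Neg i j k l) = (- (inverse q)\<^sup>2, {{i, j}, {k, l}}, inverse q, {{i, l}, {j, k}})"
| "piece_states q (Loop e) = (1, {{e}}, 0, {{e}})"

text \<open>For a closed diagram and empty context this is the unnormalised Jones polynomial at
  \<open>q\<close>, with the unknot valued \<open>q + inverse q\<close>.\<close>

definition bracket :: "complex \<Rightarrow> piece list \<Rightarrow> nat set set \<Rightarrow> complex" where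
  "bracket q xs = state_sum (q + inverse q) (map (piece_states q) xs)"

lemma avoids_pieces:
  assumes "\<And>l. l \<in> I \<Longrightarrow> count (all_labels xs) l = 0"
  shows "avoids I (map (piece_states q) xs)"
  using assms
proof (induction xs)
  case (Cons x xs)
  then have "avoids I (map (piece_states q) xs)" by simp
  moreover have "count (piece_labels x) l = 0" if "l \<in> I" for l
    using Cons.prems[OF that] by simp
  then have "l \<notin> I" if "l \<in># piece_labels x" for l
    using that by (metis not_in_iff)
  ultimately show ?case by (cases x) auto
qed simp


section \<open>The Euler characteristic of a complex\<close>

definition gen_weight :: "complex \<Rightarrow> 'r::comm_ring_1 cpx \<Rightarrow> name \<Rightarrow> complex" where
  "gen_weight q C g = (if even (hdeg C g) then 1 else - 1) * q powi qdeg C g"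

definition euler :: "complex \<Rightarrow> 'r::comm_ring_1 cpx \<Rightarrow> nat set set \<Rightarrow> complex" where
  "euler q C Z = (\<Sum>g\<in>gens C. gen_weight q C g *
     (q + inverse q) ^ num_components (hyper (shape C g) \<union> Z))"

inductive delooped_from :: "name \<Rightarrow> name \<Rightarrow> bool" where
  self: "delooped_from g g"
| del_plus: "delooped_from g h \<Longrightarrow> delooped_from g (DelPlus h)"
| del_minus: "delooped_from g h \<Longrightarrow> delooped_from g (DelMinus h)"

text \<open>The condition on names ensures that delooping never overwrites an existing summand.\<close>

definition represents :: "complex \<Rightarrow> piece list \<Rightarrow> 'r::comm_ring_1 cpx \<Rightarrow> bool" where
  "represents q xs C \<longleftrightarrow> finite (gens C) \<and>
     (\<forall>g\<in>gens C. \<forall>h\<in>gens C. delooped_from g h \<longrightarrow> g = h) \<and>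
     (\<forall>g\<in>gens C. shape_ok (all_labels xs) (shape C g)) \<and>
     (\<forall>Z. finite (\<Union>Z) \<longrightarrow> \<Union>Z \<inter> interior (all_labels xs) = {} \<longrightarrow> euler q C Z = bracket q xs Z)"

lemma delooped_from_simps [simp]:
  "delooped_from g Smooth0 \<longleftrightarrow> g = Smooth0"
  "delooped_from g Smooth1 \<longleftrightarrow> g = Smooth1"
  "delooped_from g Only \<longleftrightarrow> g = Only"
  "delooped_from g (Tens h k) \<longleftrightarrow> g = Tens h k"
  "delooped_from g (DelPlus h) \<longleftrightarrow> g = DelPlus h \<or> delooped_from g h"
  "delooped_from g (DelMinus h) \<longleftrightarrow> g = DelMinus h \<or> delooped_from g h"
  by (auto intro: delooped_from.intros elim: delooped_from.cases)

lemma delooped_from_trans: "delooped_from h k \<Longrightarrow> delooped_from g h \<Longrightarrow> delooped_from g k"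
  by (induction rule: delooped_from.induct) (auto intro: delooped_from.intros)

lemma size_delooped_from: "delooped_from g h \<Longrightarrow> size g \<le> size h"
  by (induction rule: delooped_from.induct) auto

lemma represents_crossing:
  assumes le: "\<And>m. count {#i, j, k, l#} m \<le> 2"
    and lab: "piece_labels x = {#i, j, k, l#}"
    and st: "piece_states q x =
      ((if even h then 1 else - 1) * q powi n, {{i, j}, {k, l}},
       (if even h then - 1 else 1) * q powi (n + 1), {{i, l}, {j, k}})"
  shows "represents q [x] (crossing_cpx h n i j k l :: 'r::comm_ring_1 cpx)"
proof -
  let ?C = "crossing_cpx h n i j k l :: 'r cpx"
  let ?s0 = "glue (strand i j) (strand k l)" and ?s1 = "glue (strand i l) (strand j k)"
  have perm: "{#i, l, j, k#} = {#i, j, k, l#}" by simp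
  have "count {#i, l, j, k#} m \<le> 2" for m using le[of m] unfolding perm .
  note s1 = glue_strands[OF this, unfolded perm]
  note s0 = glue_strands[OF le]
  have C: "gens ?C = {Smooth0, Smooth1}" "shape ?C Smooth0 = ?s0" "shape ?C Smooth1 = ?s1"
    "gen_weight q ?C Smooth0 = (if even h then 1 else - 1) * q powi n"
    "gen_weight q ?C Smooth1 = (if even h then - 1 else 1) * q powi (n + 1)"
    by (simp_all add: crossing_cpx_def Let_def gen_weight_def)
  have L: "all_labels [x] = {#i, j, k, l#}" by (simp add: lab)
  have "euler q ?C Z = bracket q [x] Z"
    if "finite (\<Union>Z)" "\<Union>Z \<inter> interior {#i, j, k, l#} = {}" for Z
  proof -
    have "num_components (hyper ?s0 \<union> Z) = num_components ({{i, j}, {k, l}} \<union> Z)"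
      "num_components (hyper ?s1 \<union> Z) = num_components ({{i, l}, {j, k}} \<union> Z)"
      using s0(2) s1(2) that unfolding reduces_def by simp_all
    then show ?thesis
      by (simp add: euler_def C bracket_def st)
  qed
  then show ?thesis
    unfolding represents_def L using s0(1) s1(1) by (simp add: C)
qed

lemma represents_piece:
  assumes "\<And>l. count (piece_labels x) l \<le> 2"
  shows "represents q [x] (piece_cpx x :: 'r::comm_ring_1 cpx)"
proof (cases x)
  case (Pos i j k l)
  then show ?thesis
    using represents_crossing[of i j k l x q 0 1] assms by simp
next
  case (Neg i j k l)
  then show ?thesis
    using represents_crossing[of i j k l x q "-1" "-2"] assms
    by (simp add: power_int_minus power_inverse)
next
  case (Loop e)
  then show ?thesis
    unfolding represents_def
    by (auto simp: shape_ok_def euler_def gen_weight_def bracket_def)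
qed

lemma interior_subset:
  assumes "\<And>l. count (M + N) l \<le> 2"
  shows "interior M \<subseteq> interior (M + N)" "interior N \<subseteq> interior (M + N)"
proof -
  have "count M l + count N l \<le> 2" for l using assms[of l] by simp
  then show "interior M \<subseteq> interior (M + N)" "interior N \<subseteq> interior (M + N)"
    by (auto simp: interior_def) (metis add_le_same_cancel1 le_zero_eq, metis add_le_same_cancel2 le_zero_eq)
qed

text \<open>Two substitutions of contexts: a summand of \<open>D\<close> together with
  \<open>Z\<close> is a context for \<open>C\<close>, which replaces \<open>C\<close> by the state
  sum of \<open>xs\<close>; afterwards the states of \<open>xs\<close> are contexts for
  \<open>D\<close>.\<close>

lemma represents_tensor:
  assumes C: "represents q xs (C :: 'r::comm_ring_1 cpx)" and D: "represents q ys D"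
    and le: "\<And>l. count (all_labels (xs @ ys)) l \<le> 2" and q: "q \<noteq> 0"
  shows "represents q (xs @ ys) (tensor C D)"
proof -
  let ?M = "all_labels xs" and ?N = "all_labels ys" and ?d = "q + inverse q"
  let ?T = "tensor C D"
  have le': "count (?M + ?N) l \<le> 2" for l using le[of l] by simp
  have glu: "gluing ?M ?N (shape C g) (shape D h)" if "g \<in> gens C" "h \<in> gens D" for g h
    using C D that le' by unfold_locales (auto simp: represents_def)
  have gens: "gens ?T = (\<lambda>(g, h). Tens g h) ` (gens C \<times> gens D)"
    by (auto simp: tensor_def)
  have sh: "shape ?T (Tens g h) = glue (shape C g) (shape D h)" for g h
    by (simp add: tensor_def)
  have wt: "gen_weight q ?T (Tens g h) = gen_weight q C g * gen_weight q D h" for g h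
    using q by (simp add: tensor_def gen_weight_def power_int_add)
  have "euler q ?T Z = bracket q (xs @ ys) Z"
    if Z: "finite (\<Union>Z)" "\<Union>Z \<inter> interior (?M + ?N) = {}" for Z
  proof -
    have ZM: "\<Union>Z \<inter> interior ?M = {}" "\<Union>Z \<inter> interior ?N = {}"
      using Z(2) interior_subset[OF le'] by blast+
    have "euler q ?T Z = (\<Sum>(g, h)\<in>gens C \<times> gens D. gen_weight q ?T (Tens g h) *
        ?d ^ num_components (hyper (shape ?T (Tens g h)) \<union> Z))"
      unfolding euler_def gens by (subst sum.reindex) (auto simp: inj_on_def case_prod_unfold)
    also have "\<dots> = (\<Sum>(g, h)\<in>gens C \<times> gens D. gen_weight q D h * (gen_weight q C g *
        ?d ^ num_components (hyper (shape C g) \<union> (hyper (shape D h) \<union> Z))))"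
    proof (intro sum.cong refl, clarify)
      fix g h assume "g \<in> gens C" "h \<in> gens D"
      from gluing.reduces_glue[OF glu[OF this]]
      have "num_components (hyper (shape C g) \<union> hyper (shape D h) \<union> Z) =
          num_components (hyper (glue (shape C g) (shape D h)) \<union> Z)"
        using Z unfolding reduces_def by simp
      then show "gen_weight q ?T (Tens g h) * ?d ^ num_components (hyper (shape ?T (Tens g h)) \<union> Z) =
          gen_weight q D h * (gen_weight q C g *
            ?d ^ num_components (hyper (shape C g) \<union> (hyper (shape D h) \<union> Z)))"
        by (simp add: sh wt Un_assoc)
    qed
    also have "\<dots> = (\<Sum>h\<in>gens D. gen_weight q D h * euler q C (hyper (shape D h) \<union> Z))"
      unfolding euler_def sum.cartesian_product[symmetric] sum_distrib_left by (rule sum.swap)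
    also have "\<dots> = (\<Sum>h\<in>gens D. gen_weight q D h * bracket q xs (hyper (shape D h) \<union> Z))"
    proof (intro sum.cong refl)
      fix h assume h: "h \<in> gens D"
      then have ok: "shape_ok ?N (shape D h)" using D by (simp add: represents_def)
      have "finite (\<Union>(hyper (shape D h) \<union> Z))"
        using shape_okD(1,3)[OF ok] Z(1) by auto
      \<comment> \<open>A label of \<open>shape D h\<close> has an edge end in \<open>ys\<close>, so
        at most one is left for \<open>xs\<close>.\<close>
      moreover have "l \<notin> interior ?M" if "l \<in> \<Union>(hyper (shape D h))" for l
      proof -
        from that obtain c where "c \<in> shape D h" "l \<in> labels c" by blast
        then have "count ?N l \<ge> 1" by (rule shape_ok_pos[OF ok])
        then show ?thesis using le'[of l] unfolding count_union interior_def mem_Collect_eq by linarith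
      qed
      then have "\<Union>(hyper (shape D h) \<union> Z) \<inter> interior ?M = {}" using ZM(1) by blast
      ultimately show "gen_weight q D h * euler q C (hyper (shape D h) \<union> Z) =
          gen_weight q D h * bracket q xs (hyper (shape D h) \<union> Z)"
        using C by (simp add: represents_def)
    qed
    also have "\<dots> = bracket q (xs @ ys) Z"
      unfolding bracket_def map_append
    proof (rule state_sum_linear[where I = "interior ?N"])
      show "(\<Sum>h\<in>gens D. gen_weight q D h * ?d ^ num_components (hyper (shape D h) \<union> Z')) =
          state_sum ?d (map (piece_states q) ys) Z'"
        if "finite (\<Union>Z')" "\<Union>Z' \<inter> interior ?N = {}" for Z'
        using D that by (simp add: represents_def euler_def bracket_def)
      have "count ?M l = 0" if "l \<in> interior ?N" for l
        using that le'[of l] by (simp add: interior_def)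
      then show "avoids (interior ?N) (map (piece_states q) xs)" by (rule avoids_pieces)
    qed (use Z ZM in simp_all)
    finally show ?thesis .
  qed
  moreover have "shape_ok (?M + ?N) (shape ?T x)" if "x \<in> gens ?T" for x
    using that gluing.shape_ok_glue[OF glu] by (auto simp: gens sh)
  moreover have "finite (gens ?T)"
    using C D by (simp add: gens represents_def)
  moreover have "x = y" if "x \<in> gens ?T" "y \<in> gens ?T" "delooped_from x y" for x y
    using that by (auto simp: gens)
  ultimately show ?thesis
    unfolding represents_def map_append sum_list_append by (intro conjI ballI allI impI)
qed

text \<open>The circle's factor \<open>q + inverse q\<close> is the sum of the factors that the two
  shifts give to the copies.\<close>

lemma represents_deloop:
  assumes C: "represents q xs (C :: 'r::comm_ring_1 cpx)" and g: "g \<in> gens C" "Circle s \<in> shape C g"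
    and q: "q \<noteq> 0"
  shows "represents q xs (deloop C g (Circle s))"
proof -
  let ?D = "deloop C g (Circle s)" and ?d = "q + inverse q"
  let ?P = "DelPlus g" and ?N = "DelMinus g"
  have anti: "\<And>x y. x \<in> gens C \<Longrightarrow> y \<in> gens C \<Longrightarrow> delooped_from x y \<Longrightarrow> x = y"
    and fin: "finite (gens C)" and ok: "\<And>x. x \<in> gens C \<Longrightarrow> shape_ok (all_labels xs) (shape C x)"
    using C by (auto simp: represents_def)
  have new: "?P \<notin> gens C" "?N \<notin> gens C"
    using anti[OF g(1), of ?P] anti[OF g(1), of ?N] size_delooped_from[of g g]
    by (auto simp: delooped_from.self dest: arg_cong[of _ _ size])
  have D: "gens ?D = gens C - {g} \<union> {?P, ?N}"
    "\<And>x. x \<noteq> ?P \<Longrightarrow> x \<noteq> ?N \<Longrightarrow> gen_weight q ?D x = gen_weight q C x \<and> shape ?D x = shape C x"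
    "shape ?D ?P = shape C g - {Circle s}" "shape ?D ?N = shape C g - {Circle s}"
    "gen_weight q ?D ?P = gen_weight q C g * q" "gen_weight q ?D ?N = gen_weight q C g * inverse q"
    using q by (simp_all add: deloop_def Let_def gen_weight_def power_int_add power_int_diff divide_inverse)
  have "euler q ?D Z = bracket q xs Z"
    if Z: "finite (\<Union>Z)" "\<Union>Z \<inter> interior (all_labels xs) = {}" for Z
  proof -
    let ?f = "\<lambda>E x. gen_weight q E x * ?d ^ num_components (hyper (shape E x) \<union> Z)"
    have "num_components (hyper (shape C g) \<union> Z) =
        Suc (num_components (hyper (shape C g - {Circle s}) \<union> Z))"
      using reduces_circle[OF ok[OF g(1)] g(2)] Z unfolding reduces_def by simp
    then have gg: "?f ?D ?P + ?f ?D ?N = ?f C g"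
      by (simp add: D algebra_simps)
    have "euler q ?D Z = (\<Sum>x\<in>gens C - {g}. ?f ?D x) + (?f ?D ?P + ?f ?D ?N)"
      unfolding euler_def D(1) using fin new by (subst sum.union_disjoint) auto
    also have "(\<Sum>x\<in>gens C - {g}. ?f ?D x) = (\<Sum>x\<in>gens C - {g}. ?f C x)"
    proof (intro sum.cong refl)
      fix x assume "x \<in> gens C - {g}"
      then have "x \<noteq> ?P" "x \<noteq> ?N" using new by auto
      then show "?f ?D x = ?f C x" using D(2) by simp
    qed
    also have "(\<Sum>x\<in>gens C - {g}. ?f C x) + (?f ?D ?P + ?f ?D ?N) = euler q C Z"
      unfolding gg euler_def using sum.remove[OF fin g(1), of "?f C"] by (simp add: add.commute)
    also have "\<dots> = bracket q xs Z" using C Z by (simp add: represents_def)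
    finally show ?thesis .
  qed
  moreover have "shape_ok (all_labels xs) (shape ?D x)" if "x \<in> gens ?D" for x
  proof (cases "x = ?P \<or> x = ?N")
    case True
    then show ?thesis using shape_ok_delete_circle[OF ok[OF g(1)]] D(3,4) by auto
  next
    case False
    then show ?thesis using ok that D(1,2) by auto
  qed
  moreover have "x = y" if xy: "x \<in> gens ?D" "y \<in> gens ?D" "delooped_from x y" for x y
  proof -
    have no: "\<not> delooped_from x g" if "x \<in> gens C" "x \<noteq> g" for x
      using anti[OF that(1) g(1)] that(2) by blast
    have small: "\<not> delooped_from ?P g" "\<not> delooped_from ?N g"
      using size_delooped_from[of ?P g] size_delooped_from[of ?N g] by auto
    have no': "\<not> delooped_from z y" if "y \<in> gens C" "z = ?P \<or> z = ?N" for y z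
    proof
      assume z: "delooped_from z y"
      moreover have "delooped_from g z" using that(2) by (auto simp: delooped_from.self)
      ultimately have "delooped_from g y" by (rule delooped_from_trans)
      then have "y = g" using anti[OF g(1) that(1)] by simp
      then show False using z small that(2) by auto
    qed
    show ?thesis
      using xy no no' new small anti[of x y] by (auto simp: D(1))
  qed
  moreover have "finite (gens ?D)" using fin by (simp add: D(1))
  ultimately show ?thesis
    unfolding represents_def by (intro conjI ballI allI impI)
qed

definition circle_free :: "'r::comm_ring_1 cpx \<Rightarrow> bool" where
  "circle_free C \<longleftrightarrow> (\<forall>g\<in>gens C. \<forall>s. Circle s \<notin> shape C g)"

text \<open>By \<open>pivot_same\<close> the cancelled summands carry the same diagram and shift.
  Their homological degrees differ by one, so their contributions are opposite.\<close>

lemma represents_eliminate: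
  assumes C: "represents q xs (C :: 'r::comm_ring_1 cpx)" "circle_free C" and p: "pivot C b b' \<psi>"
  shows "represents q xs (eliminate C b b' \<psi>)" "circle_free (eliminate C b b' \<psi>)"
proof -
  let ?E = "eliminate C b b' \<psi>" and ?d = "q + inverse q"
  have E: "gens ?E = gens C - {b, b'}" "shape ?E = shape C" "gen_weight q ?E = gen_weight q C"
    by (simp_all add: eliminate_def gen_weight_def fun_eq_iff)
  have b: "b \<in> gens C" "b' \<in> gens C" "hdeg C b' = hdeg C b + 1"
    using p by (auto simp: pivot_def)
  then have neq: "b \<noteq> b'" by auto
  have fin: "finite (gens C)" using C by (simp add: represents_def)
  have same: "shape C b = shape C b'" "qdeg C b = qdeg C b'"
    using pivot_same[OF p, of "all_labels xs"] C b by (auto simp: represents_def circle_free_def)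
  then have wt: "gen_weight q C b' = - gen_weight q C b"
    by (simp add: gen_weight_def b(3))
  have "euler q ?E Z = euler q C Z" for Z
  proof -
    let ?f = "\<lambda>x. gen_weight q C x * ?d ^ num_components (hyper (shape C x) \<union> Z)"
    have "euler q C Z = (\<Sum>x\<in>gens C - {b, b'}. ?f x) + (\<Sum>x\<in>{b, b'}. ?f x)"
      unfolding euler_def using fin b by (intro sum.subset_diff) auto
    also have "(\<Sum>x\<in>{b, b'}. ?f x) = 0"
      using neq by (simp add: wt same)
    finally show ?thesis by (simp add: euler_def E)
  qed
  then show "represents q xs ?E" using C(1) by (simp add: represents_def E)
  show "circle_free ?E" using C(2) by (simp add: circle_free_def E)
qed

lemma deloop_all_represents:
  "deloop_all C C' t \<Longrightarrow> represents q xs C \<Longrightarrow> q \<noteq> 0 \<Longrightarrow> represents q xs C' \<and> circle_free C'"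
proof (induction rule: deloop_all.induct)
  case (finished C)
  then show ?case by (auto simp: circle_free_def)
qed (simp add: represents_deloop)

lemma eliminate_all_represents:
  "eliminate_all C C' t \<Longrightarrow> represents q xs C \<Longrightarrow> circle_free C \<Longrightarrow> represents q xs C' \<and> circle_free C'"
  by (induction rule: eliminate_all.induct) (simp_all add: represents_eliminate)

lemma simplify_represents:
  assumes "simplify C C' t" "represents q xs C" "q \<noteq> 0"
  shows "represents q xs C' \<and> circle_free C'"
  using assms deloop_all_represents eliminate_all_represents unfolding simplify_def by metis

lemma scan_represents:
  "scan xs (C :: 'r::comm_ring_1 cpx) t \<Longrightarrow> (\<And>l. count (all_labels xs) l \<le> 2) \<Longrightarrow> q \<noteq> 0 \<Longrightarrow>
    represents q xs C \<and> circle_free C"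
proof (induction rule: scan.induct)
  case (first x C t)
  then show ?case using simplify_represents represents_piece[of x] by fastforce
next
  case (extend xs C t x C' t')
  have *: "count (all_labels xs) l + count (piece_labels x) l \<le> 2" for l
    using extend.prems(1)[of l] by simp
  have "represents q xs C" using extend.IH * extend.prems(2) add_leD1 by blast
  moreover have "represents q [x] (piece_cpx x :: 'r cpx)"
    using represents_piece * add_leD2 by blast
  ultimately have "represents q (xs @ [x]) (tensor C (piece_cpx x))"
    using extend.prems by (intro represents_tensor)
  then show ?case using extend.hyps(2) extend.prems(2) simplify_represents by blast
qed

lemma divide_conquer_represents:
  "divide_conquer S (C :: 'r::comm_ring_1 cpx) t \<Longrightarrow> (\<And>l. count (\<Sum>x\<in>#S. piece_labels x) l \<le> 2) \<Longrightarrow> q \<noteq> 0 \<Longrightarrow>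
    \<exists>xs. mset xs = S \<and> represents q xs C \<and> circle_free C"
proof (induction rule: divide_conquer.induct)
  case (leaf x C t)
  then have "represents q [x] C \<and> circle_free C"
    using simplify_represents represents_piece[of x] by fastforce
  then show ?case by (intro exI[of _ "[x]"]) simp
next
  case (cut S T C s D t E u)
  have *: "count (\<Sum>x\<in>#S. piece_labels x) l + count (\<Sum>x\<in>#T. piece_labels x) l \<le> 2" for l
    using cut.prems(1)[of l] by simp
  obtain xs where xs: "mset xs = S" "represents q xs C"
    using cut.IH(1) * cut.prems(2) add_leD1 by blast
  obtain ys where ys: "mset ys = T" "represents q ys D"
    using cut.IH(2) * cut.prems(2) add_leD2 by blast
  have "all_labels xs = (\<Sum>x\<in>#S. piece_labels x)" "all_labels ys = (\<Sum>x\<in>#T. piece_labels x)"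
    using xs(1) ys(1) by (metis mset_map sum_mset_sum_list)+
  then have "represents q (xs @ ys) (tensor C D)"
    using xs(2) ys(2) * cut.prems(2) by (intro represents_tensor) simp_all
  then have "represents q (xs @ ys) E \<and> circle_free E"
    using cut.hyps cut.prems(2) simplify_represents by blast
  then show ?case using xs ys by (intro exI[of _ "xs @ ys"]) simp
qed


section \<open>Lower bounds for the number of steps\<close>

lemma card_deloop_le: "card (gens (deloop C g c)) \<le> card (gens C) + deloop_cost C g c"
proof (cases "finite (gens C)")
  case True
  have "gens (deloop C g c) = gens C - {g} \<union> {DelPlus g, DelMinus g}"
    by (simp add: deloop_def Let_def)
  then have "card (gens (deloop C g c)) \<le> card (gens C - {g}) + card {DelPlus g, DelMinus g}"
    by (simp only: card_Un_le)
  also have "\<dots> \<le> card (gens C) + 2"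
    using True by (intro add_mono card_mono) (simp_all add: card_insert_if)
  finally show ?thesis by (simp add: deloop_cost_def)
qed (simp add: deloop_def Let_def)

lemma deloop_all_card: "deloop_all C C' t \<Longrightarrow> card (gens C') \<le> card (gens C) + t"
proof (induction rule: deloop_all.induct)
  case (step g C s C' t)
  then show ?case using card_deloop_le[of C g "Circle s"] by linarith
qed simp

lemma eliminate_all_card:
  "eliminate_all C C' t \<Longrightarrow> finite (gens C) \<Longrightarrow> card (gens C') \<le> card (gens C)"
proof (induction rule: eliminate_all.induct)
  case (step C b b' \<psi> C' t)
  then have "card (gens C') \<le> card (gens C - {b, b'})" by (simp add: eliminate_def)
  also have "\<dots> \<le> card (gens C)" using step.prems by (intro card_mono) auto
  finally show ?case .
qed simp

lemma deloop_all_finite: "deloop_all C C' t \<Longrightarrow> finite (gens C) \<Longrightarrow> finite (gens C')"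
  by (induction rule: deloop_all.induct) (simp_all add: deloop_def Let_def)

lemma eliminate_all_finite: "eliminate_all C C' t \<Longrightarrow> finite (gens C) \<Longrightarrow> finite (gens C')"
  by (induction rule: eliminate_all.induct) (simp_all add: eliminate_def)

text \<open>A surviving generator either was written before, which \<open>storage\<close> counts, or
  was created by a delooping, where the summand 2 of \<open>deloop_cost\<close> pays for the two
  copies. Eliminations only remove generators.\<close>

lemma simplify_card:
  assumes "simplify C C' t" "finite (gens C)"
  shows "finite (gens C') \<and> card (gens C') \<le> storage C + t"
proof -
  obtain D t1 t2 where D: "deloop_all C D t1" "eliminate_all D C' t2" "t = t1 + t2"
    using assms(1) unfolding simplify_def by blast
  then show ?thesis
    using deloop_all_finite[OF D(1) assms(2)] eliminate_all_finite[OF D(2)]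
      deloop_all_card[OF D(1)] eliminate_all_card[OF D(2)]
    by (simp add: storage_def)
qed

lemma finite_gens_piece: "finite (gens (piece_cpx x))"
  by (cases x) (simp_all add: crossing_cpx_def Let_def)

lemma finite_gens_tensor:
  assumes "finite (gens C)" "finite (gens D)"
  shows "finite (gens (tensor C D))"
proof -
  have "gens (tensor C D) = (\<lambda>(g, h). Tens g h) ` (gens C \<times> gens D)"
    by (auto simp: tensor_def)
  then show ?thesis using assms by simp
qed

lemma scan_card: "scan xs C t \<Longrightarrow> finite (gens C) \<and> card (gens C) \<le> t"
proof (induction rule: scan.induct)
  case (first x C t)
  then show ?case using simplify_card finite_gens_piece by blast
next
  case (extend xs C t x C' t')
  then have "finite (gens (tensor C (piece_cpx x)))"
    by (simp add: finite_gens_tensor finite_gens_piece)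
  from simplify_card[OF extend.hyps(2) this] show ?case by simp
qed

lemma divide_conquer_card: "divide_conquer S C t \<Longrightarrow> finite (gens C) \<and> card (gens C) \<le> t"
proof (induction rule: divide_conquer.induct)
  case (leaf x C t)
  then show ?case using simplify_card finite_gens_piece by blast
next
  case (cut S T C s D t E u)
  then have "finite (gens (tensor C D))"
    by (simp add: finite_gens_tensor)
  from simplify_card[OF cut.hyps(5) this] show ?case by simp
qed

text \<open>Without boundary points and circles only the empty diagram is left, so each generator
  contributes a signed power of \<open>q\<close>, of modulus one.\<close>

lemma bracket_le_card:
  assumes C: "represents q xs (C :: 'r::comm_ring_1 cpx)" "circle_free C"
    and closed: "\<And>l. count (all_labels xs) l \<noteq> 1" and q: "norm q = 1"
  shows "norm (bracket q xs {}) \<le> real (card (gens C))"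
proof -
  have empty: "shape C g = {}" if "g \<in> gens C" for g
    using C that closed shape_ok_no_boundary unfolding represents_def circle_free_def by metis
  have "bracket q xs {} = euler q C {}" using C(1) by (simp add: represents_def)
  also have "norm \<dots> \<le> (\<Sum>g\<in>gens C. 1)"
    unfolding euler_def
    by (rule sum_norm_le) (simp add: empty gen_weight_def norm_mult norm_power_int q)
  finally show ?thesis by simp
qed

definition closed_diagram :: "piece list \<Rightarrow> bool" where
  "closed_diagram D \<longleftrightarrow> (\<forall>l. count (all_labels D) l \<in> {0, 2})"

lemma all_labels_perm: "mset xs = mset ys \<Longrightarrow> all_labels xs = all_labels ys"
  by (metis mset_map sum_mset_sum_list)

lemma bracket_perm: "mset xs = mset ys \<Longrightarrow> bracket q xs Z = bracket q ys Z"
  unfolding bracket_def by (rule state_sum_perm) (metis mset_map)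

lemma closed_diagramD:
  assumes "closed_diagram D" "mset xs = mset D"
  shows "count (all_labels xs) l \<le> 2" "count (all_labels xs) l \<noteq> 1"
proof -
  have "count (all_labels xs) l \<in> {0, 2}"
    using assms unfolding closed_diagram_def all_labels_perm[OF assms(2)] by blast
  then show "count (all_labels xs) l \<le> 2" "count (all_labels xs) l \<noteq> 1" by auto
qed

lemma scanning_run_ge:
  fixes la :: "'r::comm_ring_1 cpx \<Rightarrow> nat"
  assumes "scanning_run la D t" "closed_diagram D" "norm q = 1"
  shows "norm (bracket q D {}) \<le> real t"
proof -
  obtain xs and C :: "'r cpx" and s where xs: "mset xs = mset D" "scan xs C s" "t = s + la C"
    using assms(1) unfolding scanning_run_def by blast
  have "q \<noteq> 0" using assms(3) by auto
  then have "represents q xs C" "circle_free C"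
    using scan_represents[OF xs(2)] closed_diagramD[OF assms(2) xs(1)] by blast+
  then have "norm (bracket q xs {}) \<le> real (card (gens C))"
    using closed_diagramD[OF assms(2) xs(1)] assms(3) by (intro bracket_le_card)
  also have "\<dots> \<le> real t" using scan_card[OF xs(2)] xs(3) by simp
  finally show ?thesis unfolding bracket_perm[OF xs(1)] .
qed

lemma divide_conquer_run_ge:
  fixes la :: "'r::comm_ring_1 cpx \<Rightarrow> nat"
  assumes "divide_conquer_run la D t" "closed_diagram D" "norm q = 1"
  shows "norm (bracket q D {}) \<le> real t"
proof -
  obtain C :: "'r cpx" and s where C: "divide_conquer (mset D) C s" "t = s + la C"
    using assms(1) unfolding divide_conquer_run_def by blast
  have "q \<noteq> 0" using assms(3) by auto
  moreover have "count (\<Sum>x\<in>#mset D. piece_labels x) l \<le> 2" for l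
    using closed_diagramD(1)[OF assms(2) refl] by (metis mset_map sum_mset_sum_list)
  ultimately obtain xs where xs: "mset xs = mset D" "represents q xs C" "circle_free C"
    using divide_conquer_represents[OF C(1)] by blast
  then have "norm (bracket q xs {}) \<le> real (card (gens C))"
    using closed_diagramD[OF assms(2) xs(1)] assms(3) by (intro bracket_le_card)
  also have "\<dots> \<le> real t" using divide_conquer_card[OF C(1)] C(2) by simp
  finally show ?thesis unfolding bracket_perm[OF xs(1)] .
qed


section \<open>Existence of runs\<close>

definition finite_cpx :: "'r::comm_ring_1 cpx \<Rightarrow> bool" where
  "finite_cpx C \<longleftrightarrow> finite (gens C) \<and> (\<forall>g\<in>gens C. finite (shape C g))"

definition num_circles :: "shape \<Rightarrow> nat" where
  "num_circles s = card {c \<in> s. \<exists>n. c = Circle n}"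

lemma num_circles_delete:
  assumes "finite s" "Circle n \<in> s"
  shows "num_circles s = Suc (num_circles (s - {Circle n}))"
proof -
  have "{c \<in> s. \<exists>n. c = Circle n} = insert (Circle n) {c \<in> s - {Circle n}. \<exists>n. c = Circle n}"
    using assms(2) by blast
  then show ?thesis using assms(1) by (simp add: num_circles_def)
qed

lemma finite_cpx_deloop:
  assumes "finite_cpx C" "g \<in> gens C"
  shows "finite_cpx (deloop C g c)"
  using assms by (auto simp: finite_cpx_def deloop_def Let_def)

text \<open>Delooping replaces a diagram by two copies with one circle less. Weight 3 per circle
  makes the sum decrease, since two copies amount to only two thirds of the old term.\<close>

lemma deloop_all_exists: "finite_cpx C \<Longrightarrow> \<exists>C' t. deloop_all C C' t \<and> finite_cpx C'"
proof (induction "\<Sum>g\<in>gens C. 3 ^ num_circles (shape C g) :: nat" arbitrary: C rule: less_induct)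
  case less
  show ?case
  proof (cases "\<exists>g s. g \<in> gens C \<and> Circle s \<in> shape C g")
    case False
    then show ?thesis using less.prems deloop_all.finished by blast
  next
    case True
    then obtain g s where g: "g \<in> gens C" "Circle s \<in> shape C g" by blast
    let ?D = "deloop C g (Circle s)" and ?new = "{DelPlus g, DelMinus g}"
    let ?f = "\<lambda>E x. 3 ^ num_circles (shape E x) :: nat"
    have fin: "finite (gens C)" "finite (shape C g)"
      using less.prems g by (auto simp: finite_cpx_def)
    let ?k = "num_circles (shape C g - {Circle s})"
    \<comment> \<open>The new names are removed before being added, since \<open>finite_cpx\<close>
      allows them to be in use already; an overlap only makes the sum smaller.\<close>
    have D: "gens ?D = (gens C - {g} - ?new) \<union> ?new"
      "\<And>x. x \<notin> ?new \<Longrightarrow> shape ?D x = shape C x"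
      "\<And>x. x \<in> ?new \<Longrightarrow> shape ?D x = shape C g - {Circle s}"
      by (auto simp: deloop_def Let_def)
    have "(\<Sum>x\<in>gens ?D. ?f ?D x) = (\<Sum>x\<in>gens C - {g} - ?new. ?f ?D x) + (\<Sum>x\<in>?new. ?f ?D x)"
      unfolding D(1) using fin by (intro sum.union_disjoint) auto
    also have "(\<Sum>x\<in>gens C - {g} - ?new. ?f ?D x) = (\<Sum>x\<in>gens C - {g} - ?new. ?f C x)"
      by (intro sum.cong refl) (simp add: D(2))
    also have "\<dots> \<le> (\<Sum>x\<in>gens C - {g}. ?f C x)"
      using fin by (intro sum_mono2) auto
    also have "(\<Sum>x\<in>?new. ?f ?D x) = 2 * 3 ^ ?k" by (simp add: D(3))
    also have "(\<Sum>x\<in>gens C - {g}. ?f C x) + 2 * 3 ^ ?k < (\<Sum>x\<in>gens C - {g}. ?f C x) + ?f C g"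
      by (simp add: num_circles_delete[OF fin(2) g(2)])
    also have "\<dots> = (\<Sum>x\<in>gens C. ?f C x)"
      using sum.remove[OF fin(1) g(1), of "?f C"] by simp
    finally have "(\<Sum>x\<in>gens ?D. ?f ?D x) < (\<Sum>x\<in>gens C. ?f C x)" by simp
    from less.hyps[OF this finite_cpx_deloop[OF less.prems g(1)]]
    show ?thesis using deloop_all.step[OF g] by blast
  qed
qed

lemma eliminate_all_exists: "finite_cpx C \<Longrightarrow> \<exists>C' t. eliminate_all C C' t \<and> finite_cpx C'"
proof (induction "card (gens C)" arbitrary: C rule: less_induct)
  case less
  show ?case
  proof (cases "\<exists>b b' \<psi>. pivot C b b' \<psi>")
    case False
    then show ?thesis using less.prems eliminate_all.finished by blast
  next
    case True
    then obtain b b' \<psi> where p: "pivot C b b' \<psi>" by blast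
    have E: "gens (eliminate C b b' \<psi>) = gens C - {b, b'}" "shape (eliminate C b b' \<psi>) = shape C"
      by (simp_all add: eliminate_def)
    have "card (gens (eliminate C b b' \<psi>)) < card (gens C)"
      unfolding E using less.prems p by (intro psubset_card_mono) (auto simp: finite_cpx_def pivot_def)
    moreover have "finite_cpx (eliminate C b b' \<psi>)"
      using less.prems by (simp add: finite_cpx_def E)
    ultimately show ?thesis using less.hyps eliminate_all.step[OF p] by blast
  qed
qed

lemma simplify_exists:
  assumes "finite_cpx C"
  shows "\<exists>C' t. simplify C C' t \<and> finite_cpx C'"
proof -
  obtain D t1 where "deloop_all C D t1" "finite_cpx D"
    using deloop_all_exists[OF assms] by blast
  moreover from this obtain C' t2 where "eliminate_all D C' t2" "finite_cpx C'"
    using eliminate_all_exists by blast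
  ultimately show ?thesis unfolding simplify_def by blast
qed

lemma finite_glue: "finite a \<Longrightarrow> finite b \<Longrightarrow> finite (glue a b)"
  unfolding glue_def glue_classes_def by (intro finite_imageI finite_adj_classes finite_UnI)

lemma finite_cpx_piece: "finite_cpx (piece_cpx x)"
  by (cases x) (simp_all add: finite_cpx_def crossing_cpx_def Let_def finite_glue strand_def)

lemma finite_cpx_tensor: "finite_cpx C \<Longrightarrow> finite_cpx D \<Longrightarrow> finite_cpx (tensor C D)"
  using finite_gens_tensor[of C D] by (auto simp: finite_cpx_def tensor_def finite_glue)

lemma scan_exists: "xs \<noteq> [] \<Longrightarrow> \<exists>C t. scan xs (C :: 'r::comm_ring_1 cpx) t \<and> finite_cpx C"
proof (induction xs rule: rev_nonempty_induct)
  case (single x)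
  then show ?case
    using simplify_exists[OF finite_cpx_piece[of x]] scan.first by blast
next
  case (snoc x xs)
  then obtain C :: "'r cpx" and t where C: "scan xs C t" "finite_cpx C" by blast
  then show ?case
    using simplify_exists[OF finite_cpx_tensor[OF C(2) finite_cpx_piece[of x]]] scan.extend by blast
qed

text \<open>Cutting off a single piece at every stage is an admissible division.\<close>

lemma divide_conquer_exists:
  "xs \<noteq> [] \<Longrightarrow> \<exists>C t. divide_conquer (mset xs) (C :: 'r::comm_ring_1 cpx) t \<and> finite_cpx C"
proof (induction xs rule: rev_nonempty_induct)
  case (single x)
  then show ?case
    using simplify_exists[OF finite_cpx_piece[of x]] divide_conquer.leaf by fastforce
next
  case (snoc x xs)
  then obtain C :: "'r cpx" and s where C: "divide_conquer (mset xs) C s" "finite_cpx C" by blast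
  obtain D :: "'r cpx" and t where D: "divide_conquer {#x#} D t" "finite_cpx D"
    using simplify_exists[OF finite_cpx_piece[of x]] divide_conquer.leaf by blast
  obtain E u where E: "simplify (tensor C D) E u" "finite_cpx E"
    using simplify_exists[OF finite_cpx_tensor[OF C(2) D(2)]] by blast
  have "divide_conquer (mset xs + {#x#}) E (s + t + storage (tensor C D) + u)"
    using snoc.hyps C D E by (intro divide_conquer.cut) simp_all
  then show ?case using E by auto
qed

lemma scanning_run_exists: "D \<noteq> [] \<Longrightarrow> \<exists>t. scanning_run la D t"
  using scan_exists[of D] unfolding scanning_run_def by blast

lemma divide_conquer_run_exists: "D \<noteq> [] \<Longrightarrow> \<exists>t. divide_conquer_run la D t"
  using divide_conquer_exists[of D] unfolding divide_conquer_run_def by blast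

section \<open>State sums of closed braids\<close>

lemma reduces_trans': "reduces I c H H' \<Longrightarrow> reduces I c' H' H'' \<Longrightarrow> reduces I (c + c') H H''"
  using reduces_trans[of I c H H' I c' H''] by simp

lemma reduces_elim:
  assumes "v \<in> I" "v \<notin> \<Union>H" "v \<noteq> u" "v \<noteq> w"
  shows "reduces I 0 (insert {u, v} (insert {v, w} H)) (insert {u, w} H)"
  unfolding reduces_def
proof (intro allI impI)
  fix Z :: "'a set set" assume Z: "\<Union>Z \<inter> I = {}"
  have "num_components (insert {u, v} (insert {v, w} (H \<union> Z))) =
      num_components (insert ({u, v} \<union> {v, w}) (H \<union> Z))"
    by (rule num_components_insert_Un) simp
  also have "\<dots> = num_components (insert ({u, v} \<union> {v, w} - {v}) (H \<union> Z))"
  proof (rule num_components_drop)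
    show "v \<notin> \<Union>(H \<union> Z)" using Z assms by blast
  qed (use assms in auto)
  also have "{u, v} \<union> {v, w} - {v} = {u, w}" using assms by auto
  finally show "num_components (insert {u, v} (insert {v, w} H) \<union> Z) =
      0 + num_components (insert {u, w} H \<union> Z)" by simp
qed

lemma reduces_closed:
  assumes "u \<in> I" "v \<in> I" "u \<notin> \<Union>H" "v \<notin> \<Union>H" "finite (\<Union>H)"
  shows "reduces I 1 (insert {u, v} H) H"
  unfolding reduces_def
proof (intro allI impI)
  fix Z :: "'a set set" assume Z: "finite (\<Union>Z)" "\<Union>Z \<inter> I = {}"
  have "{u, v} \<inter> \<Union>(H \<union> Z) = {}" using Z(2) assms by auto
  moreover have "finite (\<Union>(H \<union> Z))" using Z(1) assms(5) by simp
  ultimately have "num_components (insert {u, v} (H \<union> Z)) = Suc (num_components (H \<union> Z))"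
    by (intro num_components_insert_disjoint) simp_all
  then show "num_components (insert {u, v} H \<union> Z) = 1 + num_components (H \<union> Z)"
    by simp
qed

lemma reduces_elim_eq:
  assumes "H1 = insert {u, v} (insert {v, w} H)" "H2 = insert {u, w} H"
    "v \<in> I" "v \<notin> \<Union>H" "v \<noteq> u" "v \<noteq> w"
  shows "reduces I 0 H1 H2"
  unfolding assms(1,2) using assms(3-) by (rule reduces_elim)

lemma reduces_closed_eq:
  assumes "H1 = insert {u, v} H" "u \<in> I" "v \<in> I" "u \<notin> \<Union>H" "v \<notin> \<Union>H" "finite (\<Union>H)"
  shows "reduces I 1 H1 H"
  unfolding assms(1) using assms(2-) by (rule reduces_closed)

text \<open>Three columns run from the points \<open>a\<close> through an interior level
  \<open>b\<close> to the points \<open>c\<close>. The columns stay symbolic, so that permuted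
  instances cover both positions of a letter.\<close>

locale strands =
  fixes b0 b1 b2 a0 a1 a2 c0 c1 c2 :: 'a and I :: "'a set"
  assumes inner: "b0 \<in> I" "b1 \<in> I" "b2 \<in> I" "b0 \<noteq> b1" "b0 \<noteq> b2" "b1 \<noteq> b2"
    and outer: "a0 \<notin> I" "a1 \<notin> I" "a2 \<notin> I" "c0 \<notin> I" "c1 \<notin> I" "c2 \<notin> I"
begin

lemma neq:
  "a0 \<noteq> b0" "a0 \<noteq> b1" "a0 \<noteq> b2" "a1 \<noteq> b0" "a1 \<noteq> b1" "a1 \<noteq> b2" "a2 \<noteq> b0" "a2 \<noteq> b1" "a2 \<noteq> b2"
  "c0 \<noteq> b0" "c0 \<noteq> b1" "c0 \<noteq> b2" "c1 \<noteq> b0" "c1 \<noteq> b1" "c1 \<noteq> b2" "c2 \<noteq> b0" "c2 \<noteq> b1" "c2 \<noteq> b2"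
  using inner outer by blast+

lemmas neqs = neq neq[symmetric] inner inner(4-6)[symmetric]

lemma reduces_id_none:
  "reduces I 0 {{a0, b0}, {a1, b1}, {a2, b2}, {b0, c0}, {b1, c1}, {b2, c2}}
    {{a0, c0}, {a1, c1}, {a2, c2}}"
proof -
  have "reduces I 0 {{a0, b0}, {a1, b1}, {a2, b2}, {b0, c0}, {b1, c1}, {b2, c2}}
      {{a0, c0}, {a1, b1}, {a2, b2}, {b1, c1}, {b2, c2}}"
    by (rule reduces_elim_eq[of _ a0 b0 c0 "{{a1, b1}, {a2, b2}, {b1, c1}, {b2, c2}}"])
      (use neqs in auto)
  note reduces_trans'[OF this]
  moreover have "reduces I 0 {{a0, c0}, {a1, b1}, {a2, b2}, {b1, c1}, {b2, c2}}
      {{a0, c0}, {a1, c1}, {a2, b2}, {b2, c2}}"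
    by (rule reduces_elim_eq[of _ a1 b1 c1 "{{a0, c0}, {a2, b2}, {b2, c2}}"]) (use neqs in auto)
  note reduces_trans'[OF this]
  moreover have "reduces I 0 {{a0, c0}, {a1, c1}, {a2, b2}, {b2, c2}} {{a0, c0}, {a1, c1}, {a2, c2}}"
    by (rule reduces_elim_eq[of _ a2 b2 c2 "{{a0, c0}, {a1, c1}}"]) (use neqs in auto)
  ultimately show ?thesis by (metis add_0)
qed

lemma reduces_id_some:
  "reduces I 0 {{a0, a1}, {b0, b1}, {a2, b2}, {b0, c0}, {b1, c1}, {b2, c2}}
    {{a0, a1}, {c0, c1}, {a2, c2}}"
proof -
  have "reduces I 0 {{a0, a1}, {b0, b1}, {a2, b2}, {b0, c0}, {b1, c1}, {b2, c2}}
      {{a0, a1}, {b1, c0}, {a2, b2}, {b1, c1}, {b2, c2}}"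
    by (rule reduces_elim_eq[of _ b1 b0 c0 "{{a0, a1}, {a2, b2}, {b1, c1}, {b2, c2}}"])
      (use neqs in auto)
  note reduces_trans'[OF this]
  moreover have "reduces I 0 {{a0, a1}, {b1, c0}, {a2, b2}, {b1, c1}, {b2, c2}}
      {{a0, a1}, {c0, c1}, {a2, b2}, {b2, c2}}"
    by (rule reduces_elim_eq[of _ c0 b1 c1 "{{a0, a1}, {a2, b2}, {b2, c2}}"]) (use neqs in auto)
  note reduces_trans'[OF this]
  moreover have "reduces I 0 {{a0, a1}, {c0, c1}, {a2, b2}, {b2, c2}} {{a0, a1}, {c0, c1}, {a2, c2}}"
    by (rule reduces_elim_eq[of _ a2 b2 c2 "{{a0, a1}, {c0, c1}}"]) (use neqs in auto)
  ultimately show ?thesis by (metis add_0)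
qed

lemma reduces_turn_none:
  "reduces I 0 {{a0, b0}, {a1, b1}, {a2, b2}, {b0, b1}, {c0, c1}, {b2, c2}}
    {{a0, a1}, {c0, c1}, {a2, c2}}"
proof -
  have "reduces I 0 {{a0, b0}, {a1, b1}, {a2, b2}, {b0, b1}, {c0, c1}, {b2, c2}}
      {{a0, b1}, {a1, b1}, {a2, b2}, {c0, c1}, {b2, c2}}"
    by (rule reduces_elim_eq[of _ a0 b0 b1 "{{a1, b1}, {a2, b2}, {c0, c1}, {b2, c2}}"])
      (use neqs in auto)
  note reduces_trans'[OF this]
  moreover have "reduces I 0 {{a0, b1}, {a1, b1}, {a2, b2}, {c0, c1}, {b2, c2}}
      {{a0, a1}, {a2, b2}, {c0, c1}, {b2, c2}}"
    by (rule reduces_elim_eq[of _ a0 b1 a1 "{{a2, b2}, {c0, c1}, {b2, c2}}"]) (use neqs in auto)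
  note reduces_trans'[OF this]
  moreover have "reduces I 0 {{a0, a1}, {a2, b2}, {c0, c1}, {b2, c2}} {{a0, a1}, {c0, c1}, {a2, c2}}"
    by (rule reduces_elim_eq[of _ a2 b2 c2 "{{a0, a1}, {c0, c1}}"]) (use neqs in auto)
  ultimately show ?thesis by (metis add_0)
qed

text \<open>The Temperley-Lieb relation in which two facing turns close up to a circle.\<close>

lemma reduces_turn_same:
  "reduces I 1 {{a0, a1}, {b0, b1}, {a2, b2}, {c0, c1}, {b2, c2}}
    {{a0, a1}, {c0, c1}, {a2, c2}}"
proof -
  have "reduces I 1 {{a0, a1}, {b0, b1}, {a2, b2}, {c0, c1}, {b2, c2}}
      {{a0, a1}, {a2, b2}, {c0, c1}, {b2, c2}}"
    by (rule reduces_closed_eq[of _ b0 b1]) (use neqs in auto)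
  note reduces_trans'[OF this]
  moreover have "reduces I 0 {{a0, a1}, {a2, b2}, {c0, c1}, {b2, c2}} {{a0, a1}, {c0, c1}, {a2, c2}}"
    by (rule reduces_elim_eq[of _ a2 b2 c2 "{{a0, a1}, {c0, c1}}"]) (use neqs in auto)
  ultimately show ?thesis by (metis add_0_right)
qed

text \<open>The Temperley-Lieb relation in which a zigzag through the three columns is pulled
  straight.\<close>

lemma reduces_turn_other:
  "reduces I 0 {{a0, a1}, {b1, b2}, {a2, b0}, {b0, b1}, {c0, c1}, {b2, c2}}
    {{a0, a1}, {c0, c1}, {a2, c2}}"
proof -
  have "reduces I 0 {{a0, a1}, {b1, b2}, {a2, b0}, {b0, b1}, {c0, c1}, {b2, c2}}
      {{a0, a1}, {b1, b2}, {a2, b1}, {c0, c1}, {b2, c2}}"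
    by (rule reduces_elim_eq[of _ a2 b0 b1 "{{a0, a1}, {b1, b2}, {c0, c1}, {b2, c2}}"])
      (use neqs in auto)
  note reduces_trans'[OF this]
  moreover have "reduces I 0 {{a0, a1}, {b1, b2}, {a2, b1}, {c0, c1}, {b2, c2}}
      {{a0, a1}, {a2, b2}, {c0, c1}, {b2, c2}}"
    by (rule reduces_elim_eq[of _ a2 b1 b2 "{{a0, a1}, {c0, c1}, {b2, c2}}"]) (use neqs in auto)
  note reduces_trans'[OF this]
  moreover have "reduces I 0 {{a0, a1}, {a2, b2}, {c0, c1}, {b2, c2}} {{a0, a1}, {c0, c1}, {a2, c2}}"
    by (rule reduces_elim_eq[of _ a2 b2 c2 "{{a0, a1}, {c0, c1}}"]) (use neqs in auto)
  ultimately show ?thesis by (metis add_0)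
qed

end

text \<open>
  The state sum of a closed braid is computed on a ladder whose vertices are the points
  \<open>(m, p)\<close> at height \<open>m\<close> and column \<open>p < 3\<close>; the letter with index \<open>t\<close> sits between the heights
  \<open>t + 1\<close> and \<open>t + 2\<close>.  A partial state connects the heights \<open>0\<close> and \<open>m\<close> by three
  through-strands (\<open>None\<close>), or by one through-strand, a turn at the columns \<open>i, i + 1\<close> at the
  top and one at the columns \<open>j, j + 1\<close> at the bottom (\<open>Some (i, j)\<close>).
\<close>

fun type_edges :: "(nat \<times> nat) option \<Rightarrow> nat \<Rightarrow> (nat \<times> nat) set set" where
  "type_edges None m = {{(0, 0), (m, 0)}, {(0, 1), (m, 1)}, {(0, 2), (m, 2)}}"
| "type_edges (Some (i, j)) m =
     {{(0, i), (0, i + 1)}, {(m, j), (m, j + 1)}, {(0, 2 - 2 * i), (m, 2 - 2 * j)}}"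

definition id_edges :: "nat \<Rightarrow> nat \<Rightarrow> (nat \<times> nat) set set" where
  "id_edges t p = {{(t + 1, p), (t + 2, p)}, {(t + 1, p + 1), (t + 2, p + 1)}}"

definition turn_edges :: "nat \<Rightarrow> nat \<Rightarrow> (nat \<times> nat) set set" where
  "turn_edges t p = {{(t + 1, p), (t + 1, p + 1)}, {(t + 2, p), (t + 2, p + 1)}}"

text \<open>\<open>2 - 2 * p\<close> is the column that a letter at \<open>p\<close> leaves alone:
  column 2 for \<open>p = 0\<close> and column 0 for \<open>p = 1\<close>.\<close>

definition pass_edge :: "nat \<Rightarrow> nat \<Rightarrow> (nat \<times> nat) set" where
  "pass_edge t p = {(t + 1, 2 - 2 * p), (t + 2, 2 - 2 * p)}"

definition closing :: "nat \<Rightarrow> (nat \<times> nat) set set" where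
  "closing m = {{(0, 0), (m, 0)}, {(0, 1), (m, 1)}, {(0, 2), (m, 2)}}"

definition id_weight :: "complex \<Rightarrow> letter \<Rightarrow> complex" where
  "id_weight q x = (if x \<in> {Sigma1, Sigma2} then q else inverse q)"

definition turn_weight :: "complex \<Rightarrow> letter \<Rightarrow> complex" where
  "turn_weight q x = (if x \<in> {Sigma1, Sigma2} then - q\<^sup>2 else - (inverse q)\<^sup>2)"

text \<open>The smoothing that follows the strands comes first at a positive crossing and second at
  a negative one, in accordance with \<open>piece_states\<close>.\<close>

definition ladder_states ::
    "complex \<Rightarrow> nat \<Rightarrow> letter \<Rightarrow> complex \<times> (nat \<times> nat) set set \<times> complex \<times> (nat \<times> nat) set set" where
  "ladder_states q t x = (if x \<in> {Sigma1, Sigma2}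
     then (id_weight q x, id_edges t (left_pos x), turn_weight q x, turn_edges t (left_pos x))
     else (turn_weight q x, turn_edges t (left_pos x), id_weight q x, id_edges t (left_pos x)))"

fun ladder ::
    "complex \<Rightarrow> nat \<Rightarrow> letter list \<Rightarrow> (complex \<times> (nat \<times> nat) set set \<times> complex \<times> (nat \<times> nat) set set) list" where
  "ladder q t [] = []"
| "ladder q t (x # w) = ladder_states q t x # ladder q (Suc t) w"

fun pass_edges :: "nat \<Rightarrow> letter list \<Rightarrow> (nat \<times> nat) set set" where
  "pass_edges t [] = {}"
| "pass_edges t (x # w) = insert (pass_edge t (left_pos x)) (pass_edges (Suc t) w)"

text \<open>A transfer recursion: the argument of type \<open>option\<close> describes the part of
  the braid already resolved, the list is the rest of the word. The empty word leaves the circles of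
  the closed-up type.\<close>

fun type_value :: "complex \<Rightarrow> letter list \<Rightarrow> (nat \<times> nat) option \<Rightarrow> complex" where
  "type_value q [] None = (q + inverse q) ^ 3"
| "type_value q [] (Some (i, j)) = (q + inverse q) ^ (if i = j then 2 else 1)"
| "type_value q (x # w) None = id_weight q x * type_value q w None +
     turn_weight q x * type_value q w (Some (left_pos x, left_pos x))"
| "type_value q (x # w) (Some (i, j)) = id_weight q x * type_value q w (Some (i, j)) +
     turn_weight q x * ((if j = left_pos x then q + inverse q else 1) * type_value q w (Some (i, left_pos x)))"

definition types :: "(nat \<times> nat) option set" where
  "types = insert None (Some ` ({0, 1} \<times> {0, 1}))"

lemma left_pos_cases: "left_pos x = 0 \<or> left_pos x = 1"
  by (cases x) auto

abbreviation height :: "nat \<Rightarrow> (nat \<times> nat) set" where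
  "height m \<equiv> {m} \<times> {0, 1, 2}"

lemma reduces_id_step:
  assumes "\<tau> \<in> types" "p = 0 \<or> p = 1"
  shows "reduces (height (Suc t)) 0 (id_edges t p \<union> type_edges \<tau> (Suc t) \<union> {pass_edge t p})
    (type_edges \<tau> (Suc (Suc t)))"
proof -
  have all: "id_edges t p \<union> {pass_edge t p} = {{(Suc t, 0), (Suc (Suc t), 0)},
      {(Suc t, 1), (Suc (Suc t), 1)}, {(Suc t, 2), (Suc (Suc t), 2)}}"
    using assms(2)
    by (elim disjE) (simp_all add: id_edges_def pass_edge_def numeral_2_eq_2 insert_commute)
  let ?b = "Pair (Suc t)" and ?c = "Pair (Suc (Suc t))"
  have strands: "strands (?b i) (?b j) (?b k) (0, x) (0, y) (0, z) (?c i) (?c j) (?c k) (height (Suc t))"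
    if "(i, j, k) \<in> {(0, 1, 2), (1, 2, 0)}" for i j k x y z
    using that by unfold_locales auto
  from assms(1) consider "\<tau> = None" | i where "\<tau> = Some (i, 0)" | i where "\<tau> = Some (i, 1)"
    unfolding types_def by blast
  then have "reduces (height (Suc t)) 0 (type_edges \<tau> (Suc t) \<union> (id_edges t p \<union> {pass_edge t p}))
    (type_edges \<tau> (Suc (Suc t)))"
  proof cases
    case 1
    show ?thesis
      using strands.reduces_id_none[OF strands[of 0 1 2 0 1 2]]
      unfolding all by (simp add: 1 insert_commute)
  next
    case (2 i)
    show ?thesis
      using strands.reduces_id_some[OF strands[of 0 1 2 i "i + 1" "2 - 2 * i"]]
      unfolding all by (simp add: 2 insert_commute)
  next
    case (3 i)
    show ?thesis
      using strands.reduces_id_some[OF strands[of 1 2 0 i "i + 1" "2 - 2 * i"]]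
      unfolding all by (simp add: 3 insert_commute numeral_2_eq_2)
  qed
  then show ?thesis by (simp only: Un_ac)
qed

text \<open>Only the bottom turn is replaced, and a circle splits off exactly if the old bottom turn
  sits at the columns of the new letter.\<close>

lemma reduces_turn_step:
  assumes "\<tau> \<in> types" "p = 0 \<or> p = 1"
  shows "reduces (height (Suc t)) (case \<tau> of None \<Rightarrow> 0 | Some (i, j) \<Rightarrow> if j = p then 1 else 0)
    (turn_edges t p \<union> type_edges \<tau> (Suc t) \<union> {pass_edge t p})
    (type_edges (Some (case \<tau> of None \<Rightarrow> (p, p) | Some (i, j) \<Rightarrow> (i, p))) (Suc (Suc t)))"
proof -
  let ?b = "Pair (Suc t)" and ?c = "Pair (Suc (Suc t))"
  have strands: "strands (?b i) (?b j) (?b k) (0, x) (0, y) (0, z) (?c i) (?c j) (?c k) (height (Suc t))"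
    if "(i, j, k) \<in> {(0, 1, 2), (1, 2, 0), (2, 1, 0)}" for i j k x y z
    using that by unfold_locales auto
  note defs = turn_edges_def pass_edge_def numeral_2_eq_2
  note set_eq = insert_commute
  from assms consider "\<tau> = None" "p = 0" | "\<tau> = None" "p = 1"
    | i where "\<tau> = Some (i, 0)" "p = 0" | i where "\<tau> = Some (i, 1)" "p = 1"
    | i where "\<tau> = Some (i, 1)" "p = 0" | i where "\<tau> = Some (i, 0)" "p = 1"
    unfolding types_def by blast
  then show ?thesis
  proof cases
    case 1
    then show ?thesis
      using strands.reduces_turn_none[OF strands[of 0 1 2 0 1 2]] by (simp add: defs set_eq)
  next
    case 2
    then show ?thesis
      using strands.reduces_turn_none[OF strands[of 1 2 0 1 2 0]] by (simp add: defs set_eq)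
  next
    case (3 i)
    then show ?thesis
      using strands.reduces_turn_same[OF strands[of 0 1 2 i "i + 1" "2 - 2 * i"]]
      by (simp add: defs set_eq)
  next
    case (4 i)
    then show ?thesis
      using strands.reduces_turn_same[OF strands[of 1 2 0 i "i + 1" "2 - 2 * i"]]
      by (simp add: defs set_eq)
  next
    case (5 i)
    then show ?thesis
      using strands.reduces_turn_other[OF strands[of 0 1 2 i "i + 1" "2 - 2 * i"]]
      by (simp add: defs set_eq)
  next
    case (6 i)
    then show ?thesis
      using strands.reduces_turn_other[OF strands[of 2 1 0 i "i + 1" "2 - 2 * i"]]
      by (simp add: defs set_eq)
  qed
qed

lemma avoids_ladder: "s \<le> t \<Longrightarrow> avoids (height s) (ladder q t w)"
proof (induction w arbitrary: t)
  case (Cons x w)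
  then have "avoids (height s) (ladder q (Suc t) w)" by simp
  then show ?case
    using Cons.prems by (auto simp: ladder_states_def id_edges_def turn_edges_def)
qed simp

lemma pass_edges_above: "h \<in> pass_edges t w \<Longrightarrow> (m, p) \<in> h \<Longrightarrow> t < m"
proof (induction t w rule: pass_edges.induct)
  case (2 t x w)
  then show ?case by (auto simp: pass_edge_def dest: Suc_lessD)
qed simp

lemma finite_pass_edges: "finite (\<Union>(pass_edges t w))"
  by (induction t w rule: pass_edges.induct) (auto simp: pass_edge_def)

text \<open>Equal turns close to one circle and the through-strand to a second; different turns put
  all six points on one hexagon.\<close>

lemma num_components_close:
  assumes "\<tau> \<in> types" "m > 0"
  shows "num_components (type_edges \<tau> m \<union> closing m) =
    (case \<tau> of None \<Rightarrow> 3 | Some (i, j) \<Rightarrow> if i = j then 2 else 1)"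
proof -
  note [simp] = num_components_insert_disjoint
  have three: "num_components {{(0 :: nat, 0 :: nat), (m, 0)}, {(0, 1), (m, 1)}, {(0, 2), (m, 2)}} = 3"
    using assms(2) by simp
  have two: "num_components ({{(0, i), (0, j)}, {(m, i), (m, j)}, {(0, k), (m, k)}} \<union> closing m) = 2"
    if "(i, j, k) \<in> {(0, 1, 2), (1, 2, 0)}" for i j k :: nat
  proof -
    from that have ijk: "i = 0 \<and> j = 1 \<and> k = 2 \<or> i = 1 \<and> j = 2 \<and> k = 0" by auto
    then have "{{(0, i), (0, j)}, {(m, i), (m, j)}, {(0, k), (m, k)}} \<union> closing m =
        insert {(0, i), (m, i)} (insert {(m, i), (m, j)} (insert {(0, j), (m, j)}
          (insert {(0, i), (0, j)} {{(0, k), (m, k)}})))"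
      by (elim disjE conjE) (simp_all add: closing_def insert_commute)
    also have "num_components \<dots> = num_components (insert {(0, i), (m, i), (m, j)}
        (insert {(0, j), (m, j)} (insert {(0, i), (0, j)} {{(0, k), (m, k)}})))"
      by (subst num_components_insert_Un) (simp_all add: insert_commute)
    also have "\<dots> = num_components (insert {(0, i), (m, i), (m, j), (0, j)}
        (insert {(0, i), (0, j)} {{(0, k), (m, k)}}))"
      by (subst num_components_insert_Un) (simp_all add: insert_commute)
    also have "\<dots> = num_components (insert {(0, i), (m, i), (m, j), (0, j)} {{(0, k), (m, k)}})"
      by (subst num_components_insert_Un) (simp_all add: insert_commute)
    also have "\<dots> = 2" using ijk assms(2) by (elim disjE conjE) simp_all
    finally show ?thesis .
  qed
  have one: "num_components ({{(0, i), (0, j)}, {(m, j), (m, k)}, {(0, k), (m, i)}} \<union> closing m) = 1"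
    if "(i, j, k) \<in> {(0, 1, 2), (2, 1, 0)}" for i j k :: nat
  proof -
    let ?V = "{0, m} \<times> {0, 1, 2 :: nat}"
    let ?H = "{{(0, i), (0, j)}, {(m, j), (m, k)}, {(0, k), (m, i)}} \<union> closing m"
    have c0: "conn ?H (0, i) v" if "v \<in> ?V" for v
    proof -
      have close: "{(0, p), (m, p)} \<in> ?H" if "p = 0 \<or> p = 1 \<or> p = 2" for p
        using that by (intro UnI2) (auto simp: closing_def)
      have jk: "j = 0 \<or> j = 1 \<or> j = 2" "k = 0 \<or> k = 1 \<or> k = 2"
        using \<open>(i, j, k) \<in> _\<close> by auto
      have 1: "conn ?H (0, i) (0, j)"
        by (rule conn_edge[OF UnI1[OF insertI1]]) simp_all
      have 2: "conn ?H (0, j) (m, j)"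
        by (rule conn_edge[OF close[OF jk(1)]]) simp_all
      have 3: "conn ?H (m, j) (m, k)"
        by (rule conn_edge[OF UnI1[OF insertI2[OF insertI1]]]) simp_all
      have 4: "conn ?H (m, k) (0, k)"
        by (rule conn_edge[OF close[OF jk(2)]]) simp_all
      have 5: "conn ?H (0, k) (m, i)"
        by (rule conn_edge[OF UnI1[OF insertI2[OF insertI2[OF insertI1]]]]) simp_all
      note c = conn_refl[of ?H "(0, i)"] 1 conn_trans[OF 1 2] conn_trans[OF conn_trans[OF 1 2] 3]
        conn_trans[OF conn_trans[OF conn_trans[OF 1 2] 3] 4]
        conn_trans[OF conn_trans[OF conn_trans[OF conn_trans[OF 1 2] 3] 4] 5]
      have "v \<in> {(0, i), (0, j), (m, j), (m, k), (0, k), (m, i)}"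
        using that \<open>(i, j, k) \<in> _\<close> by auto
      then show ?thesis by (elim insertE emptyE) (use c in \<open>simp_all only:\<close>)
    qed
    have ijk: "i = 0 \<and> j = 1 \<and> k = 2 \<or> i = 2 \<and> j = 1 \<and> k = 0"
      using that by auto
    have V: "\<Union>?H = ?V"
      using ijk by (elim disjE conjE) (auto simp: closing_def)
    have "num_components (insert ?V {}) = num_components ?H"
    proof (rule num_components_eqI)
      show "\<Union>(insert ?V {}) = \<Union>?H" unfolding V by simp
      show "conn ?H u v" if "h \<in> {?V}" "u \<in> h" "v \<in> h" for h u v
      proof -
        from that have "u \<in> ?V" "v \<in> ?V" by blast+
        then show ?thesis by (rule conn_trans[OF conn_sym[OF c0] c0])
      qed
      show "conn {?V} u v" if "h \<in> ?H" "u \<in> h" "v \<in> h" for h u v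
      proof (rule conn_edge[OF insertI1])
        have "h \<subseteq> ?V" using that(1) unfolding V[symmetric] by (rule Union_upper)
        then show "u \<in> ?V" "v \<in> ?V" using that(2,3) by blast+
      qed
    qed
    then show ?thesis by simp
  qed
  from assms(1) consider "\<tau> = None" | "\<tau> = Some (0, 0)" | "\<tau> = Some (1, 1)"
    | "\<tau> = Some (0, 1)" | "\<tau> = Some (1, 0)"
    unfolding types_def by blast
  then show ?thesis
  proof cases
    case 1
    then show ?thesis using three by (simp add: closing_def)
  next
    case 2
    then show ?thesis using two[of 0 1 2] by simp
  next
    case 3
    then show ?thesis using two[of 1 2 0] by (simp add: numeral_2_eq_2)
  next
    case 4
    then show ?thesis using one[of 0 1 2] by (simp add: numeral_2_eq_2 insert_commute)
  next
    case 5
    then show ?thesis using one[of 2 1 0] by (simp add: numeral_2_eq_2 insert_commute)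
  qed
qed

text \<open>Each letter pushes the resolved part one height further. The remaining letters, passing
  edges and closing edges avoid the height \<open>Suc t\<close>, so they form an admissible context
  for the move.\<close>

lemma ladder_value:
  "\<tau> \<in> types \<Longrightarrow> state_sum (q + inverse q) (ladder q t w)
     (type_edges \<tau> (Suc t) \<union> (pass_edges t w \<union> closing (Suc t + length w))) = type_value q w \<tau>"
proof (induction w arbitrary: t \<tau>)
  case Nil
  then show ?case
    using num_components_close[OF Nil, of "Suc t"] by (cases \<tau>) (auto split: prod.splits)
next
  case (Cons x w)
  let ?p = "left_pos x" and ?d = "q + inverse q"
  let ?Z = "pass_edges (Suc t) w \<union> closing (Suc (Suc t) + length w)"
  have p: "?p = 0 \<or> ?p = 1" by (rule left_pos_cases)
  have fin: "finite (\<Union>?Z)" using finite_pass_edges by (simp add: closing_def)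
  have av: "\<Union>?Z \<inter> height (Suc t) = {}"
    using pass_edges_above[of _ "Suc t" w "Suc t"] by (auto simp: closing_def)
  note red = state_sum_reduce[OF _ avoids_ladder[OF order_refl] fin av, of _ _ _ ?d q w]
  have ctx: "E \<union> (type_edges \<tau> (Suc t) \<union> (pass_edges t (x # w) \<union> closing (Suc t + length (x # w)))) =
      (E \<union> type_edges \<tau> (Suc t) \<union> {pass_edge t ?p}) \<union> ?Z" for E
    by auto
  have id: "state_sum ?d (ladder q (Suc t) w) (id_edges t ?p \<union> (type_edges \<tau> (Suc t) \<union>
      (pass_edges t (x # w) \<union> closing (Suc t + length (x # w))))) = type_value q w \<tau>"
    unfolding ctx red[OF reduces_id_step[OF Cons.prems p]] using Cons.IH[OF Cons.prems, of "Suc t"]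
    by simp
  have turn: "state_sum ?d (ladder q (Suc t) w) (turn_edges t ?p \<union> (type_edges \<tau> (Suc t) \<union>
      (pass_edges t (x # w) \<union> closing (Suc t + length (x # w))))) =
      ?d ^ (case \<tau> of None \<Rightarrow> 0 | Some (i, j) \<Rightarrow> if j = ?p then 1 else 0) *
      type_value q w (Some (case \<tau> of None \<Rightarrow> (?p, ?p) | Some (i, j) \<Rightarrow> (i, ?p)))"
  proof -
    have "Some (case \<tau> of None \<Rightarrow> (?p, ?p) | Some (i, j) \<Rightarrow> (i, ?p)) \<in> types"
      using Cons.prems p by (auto simp: types_def split: option.splits)
    then show ?thesis
      unfolding ctx red[OF reduces_turn_step[OF Cons.prems p]] using Cons.IH[of _ "Suc t"]
      by simp
  qed
  show ?case
    using id turn by (cases \<tau>) (auto simp: ladder_states_def)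
qed

section \<open>The two-dimensional representation\<close>

definition act :: "complex \<Rightarrow> letter \<Rightarrow> complex \<times> complex \<Rightarrow> complex \<times> complex" where
  "act q x = (\<lambda>(a, b). if left_pos x = 0
     then ((id_weight q x + turn_weight q x * (q + inverse q)) * a + turn_weight q x * b, id_weight q x * b)
     else (id_weight q x * a, turn_weight q x * a + (id_weight q x + turn_weight q x * (q + inverse q)) * b))"

text \<open>The generators of the Temperley-Lieb algebra act on \<open>\<complex>\<^sup>2\<close> as the rank one operators \<open>v\<^sub>k f\<^sub>k\<close>
  with \<open>v\<^sub>0 = (1, 0)\<close>, \<open>v\<^sub>1 = (0, 1)\<close>, \<open>f\<^sub>0 (a, b) = d a + b\<close> and \<open>f\<^sub>1 (a, b) = a + d b\<close>; a closed state
  containing a turn contributes \<open>d\<close> times a trace.\<close>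

lemma type_value_Some:
  fixes q :: complex
  defines "d \<equiv> q + inverse q"
  assumes "i \<in> {0, 1}" "j \<in> {0, 1}"
  shows "type_value q w (Some (i, j)) = d *
    (let (a, b) = foldr (act q) w (if i = 0 then (1, 0) else (0, 1))
     in if j = 0 then d * a + b else a + d * b)"
  using assms(3)
proof (induction w arbitrary: j)
  case Nil
  then show ?case using assms(2) by (auto simp: power2_eq_square d_def)
next
  case (Cons x w)
  obtain a b where ab: "foldr (act q) w (if i = 0 then (1, 0) else (0, 1)) = (a, b)" by fastforce
  let ?f = "foldr (act q) (x # w) (if i = 0 then (1, 0) else (0, 1))"
  note IH = Cons.IH[unfolded ab Let_def prod.case]
  have tv: "type_value q (x # w) (Some (i, j)) = id_weight q x * type_value q w (Some (i, j)) +
     turn_weight q x * ((if j = left_pos x then d else 1) * type_value q w (Some (i, left_pos x)))"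
    by (simp add: d_def)
  have f: "?f = (if left_pos x = 0
     then ((id_weight q x + turn_weight q x * d) * a + turn_weight q x * b, id_weight q x * b)
     else (id_weight q x * a, turn_weight q x * a + (id_weight q x + turn_weight q x * d) * b))"
    by (simp only: foldr.simps comp_apply ab act_def prod.case d_def)
  from left_pos_cases[of x] Cons.prems consider "left_pos x = 0" "j = 0" | "left_pos x = 0" "j = 1"
    | "left_pos x = 1" "j = 0" | "left_pos x = 1" "j = 1" by auto
  then show ?case
    unfolding tv f by cases (simp_all add: IH algebra_simps)
qed

text \<open>Closing up is a weighted sum of traces of two representations: the two-dimensional one
  with weight \<open>d\<close>, and the one-dimensional one killing all turns with weight
  \<open>d ^ 3 - 2 * d\<close>. The latter weight is forced by the value \<open>d ^ 3\<close> of the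
  empty word.\<close>

lemma type_value_None:
  fixes q :: complex
  defines "d \<equiv> q + inverse q"
  shows "type_value q w None = d * (fst (foldr (act q) w (1, 0)) + snd (foldr (act q) w (0, 1))) +
     (d ^ 3 - 2 * d) * prod_list (map (id_weight q) w)"
proof (induction w)
  case Nil
  show ?case by (simp add: algebra_simps d_def)
next
  case (Cons x w)
  obtain a b where ab: "foldr (act q) w (1, 0) = (a, b)" by fastforce
  obtain a' b' where ab': "foldr (act q) w (0, 1) = (a', b')" by fastforce
  have act: "act q x (a, b) = (if left_pos x = 0
     then ((id_weight q x + turn_weight q x * d) * a + turn_weight q x * b, id_weight q x * b)
     else (id_weight q x * a, turn_weight q x * a + (id_weight q x + turn_weight q x * d) * b))" for a b
    by (simp only: act_def prod.case d_def)
  note IH = Cons.IH[unfolded ab ab' fst_conv snd_conv]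
  from left_pos_cases[of x] show ?case
  proof
    assume l: "left_pos x = 0"
    show ?case
      using type_value_Some[of 0 0 q w, folded d_def]
      by (simp add: l ab ab' act IH) (simp add: algebra_simps)
  next
    assume l: "left_pos x = 1"
    show ?case
      using type_value_Some[of 1 1 q w, folded d_def]
      by (simp add: l ab ab' act IH) (simp add: algebra_simps)
  qed
qed

section \<open>From the ladder to the labels of the closed braid\<close>

fun states :: "(complex \<times> 'a set set \<times> complex \<times> 'a set set) list \<Rightarrow> 'a set set set" where
  "states [] = {{}}"
| "states ((x, A, y, B) # xs) = (\<union>) A ` states xs \<union> (\<union>) B ` states xs"

definition map_states where
  "map_states f = (\<lambda>(x, A, y, B). (x, (`) f ` A, y, (`) f ` B))"

lemma state_sum_map:
  "(\<And>S. S \<in> states xs \<Longrightarrow> num_components ((`) f ` S \<union> Y) = num_components (S \<union> Z)) \<Longrightarrow>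
    state_sum d (map (map_states f) xs) Y = state_sum d xs Z"
proof (induction xs arbitrary: Y Z)
  case (Cons z xs)
  obtain x A y B where z: "z = (x, A, y, B)" by (cases z) auto
  have "state_sum d (map (map_states f) xs) ((`) f ` E \<union> Y) = state_sum d xs (E \<union> Z)"
    if "E = A \<or> E = B" for E
  proof (rule Cons.IH)
    fix S assume "S \<in> states xs"
    then have "E \<union> S \<in> states (z # xs)" using that by (auto simp: z)
    from Cons.prems[OF this]
    show "num_components ((`) f ` S \<union> ((`) f ` E \<union> Y)) = num_components (S \<union> (E \<union> Z))"
      by (simp add: image_Un Un_ac)
  qed
  then show ?case by (simp add: z map_states_def)
qed simp

lemma states_ladder_out:
  "S \<in> states (ladder q t w) \<Longrightarrow> s < length w \<Longrightarrow> p = left_pos (w ! s) \<or> p = left_pos (w ! s) + 1 \<Longrightarrow>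
    (t + s + 2, p) \<in> \<Union>S"
proof (induction w arbitrary: S t s)
  case (Cons x w)
  from Cons.prems(1) obtain E S' where S: "S' \<in> states (ladder q (Suc t) w)" "S = E \<union> S'"
    "E = id_edges t (left_pos x) \<or> E = turn_edges t (left_pos x)"
    by (auto simp: ladder_states_def split: if_splits)
  show ?case
  proof (cases s)
    case 0
    then show ?thesis using S Cons.prems(3) by (auto simp: id_edges_def turn_edges_def)
  next
    case (Suc s')
    then have "(Suc t + s' + 2, p) \<in> \<Union>S'" using Cons.IH[OF S(1)] Cons.prems by simp
    then show ?thesis using S(2) Suc by auto
  qed
qed simp

lemma states_ladder_subset:
  "S \<in> states (ladder q t w) \<Longrightarrow> h \<in> S \<Longrightarrow> (m, p) \<in> h \<Longrightarrow> m \<le> t + length w + 1 \<and> p < 3"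
proof (induction w arbitrary: S t)
  case (Cons x w)
  from Cons.prems(1) obtain E S' where S: "S' \<in> states (ladder q (Suc t) w)" "S = E \<union> S'"
    "E = id_edges t (left_pos x) \<or> E = turn_edges t (left_pos x)"
    by (auto simp: ladder_states_def split: if_splits)
  have "left_pos x < 2" using left_pos_cases[of x] by auto
  show ?case
  proof (cases "h \<in> S'")
    case True
    then show ?thesis using Cons.IH[OF S(1) _ Cons.prems(3)] by simp
  next
    case False
    then have "h \<in> E" using S(2) Cons.prems(2) by simp
    then show ?thesis
      using S(3) Cons.prems(3) \<open>left_pos x < 2\<close> by (auto simp: id_edges_def turn_edges_def)
  qed
qed simp

lemma length_ladder [simp]: "length (ladder q t w) = length w"
  by (induction q t w rule: ladder.induct) simp_all

lemma nth_ladder: "s < length w \<Longrightarrow> ladder q t w ! s = ladder_states q (t + s) (w ! s)"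
proof (induction w arbitrary: s t)
  case (Cons x w)
  then show ?case by (cases s) simp_all
qed simp

lemma pass_edges_nth:
  "s < length w \<Longrightarrow> p = 2 - 2 * left_pos (w ! s) \<Longrightarrow> {(t + s + 1, p), (t + s + 2, p)} \<in> pass_edges t w"
proof (induction w arbitrary: s t)
  case (Cons x w)
  show ?case
  proof (cases s)
    case 0
    then show ?thesis using Cons.prems by (simp add: pass_edge_def)
  next
    case (Suc s')
    then have "{(Suc t + s' + 1, p), (Suc t + s' + 2, p)} \<in> pass_edges (Suc t) w"
      using Cons.prems by (intro Cons.IH) simp_all
    then show ?thesis using Suc by simp
  qed
qed simp

lemma pass_edgesE:
  "h \<in> pass_edges t w \<Longrightarrow>
    \<exists>s < length w. h = {(t + s + 1, 2 - 2 * left_pos (w ! s)), (t + s + 2, 2 - 2 * left_pos (w ! s))}"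
proof (induction w arbitrary: t)
  case (Cons x w)
  then consider "h = pass_edge t (left_pos x)" | "h \<in> pass_edges (Suc t) w" by auto
  then show ?case
  proof cases
    case 1
    then show ?thesis by (intro exI[of _ 0]) (simp add: pass_edge_def)
  next
    case 2
    from Cons.IH[OF this] obtain s where "s < length w"
      "h = {(Suc t + s + 1, 2 - 2 * left_pos (w ! s)), (Suc t + s + 2, 2 - 2 * left_pos (w ! s))}"
      by blast
    then show ?thesis by (intro exI[of _ "Suc s"]) simp
  qed
qed simp

definition last_touch :: "letter list \<Rightarrow> nat \<Rightarrow> nat \<Rightarrow> nat" where
  "last_touch w t p = (if {s \<in> touching w p. s < t} \<noteq> {} then Max {s \<in> touching w p. s < t}
     else Max (touching w p))"

lemma in_label_alt: "in_label w t p = out_label (last_touch w t p) p"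
  by (simp add: in_label_def last_touch_def Let_def)

lemma finite_touching [simp]: "finite (touching w p)"
  by (simp add: touching_def)

lemma touching_less: "s \<in> touching w p \<Longrightarrow> s < length w"
  by (simp add: touching_def)

lemma last_touch_in:
  assumes "touching w p \<noteq> {}"
  shows "last_touch w t p \<in> touching w p"
proof (cases "{s \<in> touching w p. s < t} = {}")
  case True
  then show ?thesis using Max_in[OF finite_touching assms] by (simp add: last_touch_def)
next
  case False
  then have "Max {s \<in> touching w p. s < t} \<in> {s \<in> touching w p. s < t}" by (intro Max_in) simp_all
  then show ?thesis using False by (simp add: last_touch_def)
qed

lemma last_touch_Suc:
  assumes "t \<in> touching w p"
  shows "last_touch w (Suc t) p = t"
proof -
  have "Max {s \<in> touching w p. s < Suc t} = t"
    using assms by (intro Max_eqI) auto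
  then show ?thesis using assms by (auto simp: last_touch_def)
qed

lemma last_touch_skip:
  assumes "t \<notin> touching w p"
  shows "last_touch w (Suc t) p = last_touch w t p"
proof -
  have "s < Suc t \<longleftrightarrow> s < t" if "s \<in> touching w p" for s
    using that assms by (metis less_Suc_eq)
  then have "{s \<in> touching w p. s < Suc t} = {s \<in> touching w p. s < t}" by blast
  then show ?thesis by (simp only: last_touch_def)
qed

lemma last_touch_ends: "last_touch w 0 p = Max (touching w p)" "last_touch w (length w) p = Max (touching w p)"
proof -
  have "{s \<in> touching w p. s < length w} = touching w p"
    using touching_less by blast
  then show "last_touch w (length w) p = Max (touching w p)" by (simp add: last_touch_def)
qed (simp add: last_touch_def)

lemma touching_left_pos:
  "s \<in> touching w p \<longleftrightarrow> s < length w \<and> (p = left_pos (w ! s) \<or> p = left_pos (w ! s) + 1)"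
  by (simp add: touching_def)

lemma not_touching:
  assumes "s < length w" "p < 3"
  shows "s \<notin> touching w p \<longleftrightarrow> p = 2 - 2 * left_pos (w ! s)"
  using assms left_pos_cases[of "w ! s"] by (auto simp: touching_def)

text \<open>The ladder is mapped to the edges of the closed braid by contracting the edges at the
  columns that a letter does not touch and those that close the braid.\<close>

definition edge_label :: "letter list \<Rightarrow> nat \<times> nat \<Rightarrow> nat" where
  "edge_label w = (\<lambda>(m, p). in_label w (m - 1) p)"

definition trivial_edges :: "letter list \<Rightarrow> (nat \<times> nat) set set" where
  "trivial_edges w = type_edges None 1 \<union> (pass_edges 0 w \<union> closing (Suc 0 + length w))"

text \<open>With all columns touched there are no crossingless components, and the maximum in
  \<open>last_touch\<close> is taken over a nonempty set.\<close>

locale full_braid =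
  fixes w :: "letter list"
  assumes touched: "\<And>p. p < 3 \<Longrightarrow> touching w p \<noteq> {}"
begin

lemma top_edge:
  assumes "p < 3"
  shows "{(0, p), (1, p)} \<in> trivial_edges w"
proof -
  from assms have "p = 0 \<or> p = 1 \<or> p = 2" by linarith
  then have "{(0, p), (1, p)} \<in> type_edges None 1" by (elim disjE) simp_all
  then show ?thesis unfolding trivial_edges_def by (rule UnI1)
qed

lemma closing_edge:
  assumes "p < 3"
  shows "{(0, p), (Suc (length w), p)} \<in> trivial_edges w"
proof -
  from assms have "p = 0 \<or> p = 1 \<or> p = 2" by linarith
  then have "{(0, p), (Suc (length w), p)} \<in> closing (Suc 0 + length w)"
    by (elim disjE) (simp_all add: closing_def)
  then show ?thesis unfolding trivial_edges_def by (intro UnI2)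
qed

lemma skip_edge:
  assumes "s < length w" "p < 3" "s \<notin> touching w p"
  shows "{(Suc s, p), (Suc (Suc s), p)} \<in> trivial_edges w"
  using pass_edges_nth[of s w p 0] assms not_touching by (auto simp: trivial_edges_def)

text \<open>Walk back along the untouched part of the column to the preceding crossing. A crossing
  with index \<open>s\<close> is left at height \<open>s + 2\<close>, which explains the
  offset.\<close>

lemma conn_below:
  assumes p: "p < 3"
  shows "t \<le> length w \<Longrightarrow> {s \<in> touching w p. s < t} \<noteq> {} \<Longrightarrow>
    conn (trivial_edges w) (Suc t, p) (last_touch w t p + 2, p)"
proof (induction t)
  case (Suc t)
  show ?case
  proof (cases "t \<in> touching w p")
    case True
    then show ?thesis by (simp add: last_touch_Suc)
  next
    case False
    then have "conn (trivial_edges w) (Suc (Suc t), p) (Suc t, p)"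
      using Suc.prems(1) p by (intro conn_edge[OF skip_edge[of t p]]) simp_all
    moreover have "{s \<in> touching w p. s < t} \<noteq> {}"
      using Suc.prems(2) False by (auto simp: less_Suc_eq)
    then have "conn (trivial_edges w) (Suc t, p) (last_touch w t p + 2, p)"
      using Suc.prems(1) by (intro Suc.IH) simp_all
    ultimately show ?thesis unfolding last_touch_skip[OF False] by (rule conn_trans)
  qed
qed simp

lemma conn_above:
  assumes p: "p < 3"
  shows "t \<le> length w \<Longrightarrow> {s \<in> touching w p. s < t} = {} \<Longrightarrow>
    conn (trivial_edges w) (Suc t, p) (1, p)"
proof (induction t)
  case (Suc t)
  then have t: "t \<notin> touching w p" by blast
  then have "conn (trivial_edges w) (Suc (Suc t), p) (Suc t, p)"
    using Suc.prems(1) p by (intro conn_edge[OF skip_edge[of t p]]) simp_all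
  moreover have "conn (trivial_edges w) (Suc t, p) (1, p)"
    using Suc.prems by (intro Suc.IH) (auto simp: less_Suc_eq)
  ultimately show ?case by (rule conn_trans)
qed simp

text \<open>A point without an earlier crossing in its column is connected through height 0 and the
  closing edge to the last crossing of the word, as the cyclic convention of \<open>in_label\<close>
  demands.\<close>

lemma conn_last_touch:
  assumes p: "p < 3" and m: "m \<le> Suc (length w)"
  shows "conn (trivial_edges w) (m, p) (last_touch w (m - 1) p + 2, p)"
proof -
  let ?T = "trivial_edges w" and ?M = "(Max (touching w p) + 2, p)"
  have "{s \<in> touching w p. s < length w} \<noteq> {}"
    using touched[OF p] touching_less by blast
  then have end_: "conn ?T (Suc (length w), p) ?M"
    using conn_below[OF p order_refl] by (simp add: last_touch_ends)
  have zero: "conn ?T (0, p) ?M"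
    by (rule conn_trans[OF conn_edge[OF closing_edge[OF p]] end_]) simp_all
  have one: "conn ?T (1, p) ?M"
    by (rule conn_trans[OF conn_edge[OF top_edge[OF p]] zero]) simp_all
  show ?thesis
  proof (cases m)
    case 0
    then show ?thesis using zero by (simp add: last_touch_ends)
  next
    case (Suc t)
    show ?thesis
    proof (cases "{s \<in> touching w p. s < t} = {}")
      case True
      then have "last_touch w t p = Max (touching w p)" by (simp add: last_touch_def)
      moreover have "conn ?T (m, p) (1, p)"
        using conn_above[OF p _ True] m Suc by simp
      then have "conn ?T (m, p) ?M" using one by (rule conn_trans)
      ultimately show ?thesis using Suc by simp
    next
      case False
      then show ?thesis using conn_below[OF p _ False] m Suc by simp
    qed
  qed
qed

lemma edge_label_eq:
  assumes "edge_label w (m, p) = edge_label w (m', p')" "p < 3" "p' < 3"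
  shows "last_touch w (m - 1) p = last_touch w (m' - 1) p' \<and> p = p'"
proof -
  have "3 * last_touch w (m - 1) p + p = 3 * last_touch w (m' - 1) p' + p'"
    using assms(1) by (simp add: edge_label_def in_label_alt out_label_def)
  then show ?thesis using assms(2,3) by presburger
qed

lemma trivial_edges_vertices:
  assumes "h \<in> trivial_edges w" "(m, p) \<in> h"
  shows "m \<le> Suc (length w) \<and> p < 3"
proof -
  from assms(1) consider "h \<in> type_edges None 1" | "h \<in> pass_edges 0 w" | "h \<in> closing (Suc (length w))"
    by (auto simp: trivial_edges_def)
  then show ?thesis
  proof cases
    case 1
    then show ?thesis using assms(2) by auto
  next
    case 2
    from pass_edgesE[OF this] show ?thesis using assms(2) by auto
  next
    case 3
    then show ?thesis using assms(2) by (auto simp: closing_def)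
  qed
qed

lemma trivial_edges_label:
  assumes "h \<in> trivial_edges w" "u \<in> h" "v \<in> h"
  shows "edge_label w u = edge_label w v"
proof -
  from assms(1) consider "h \<in> type_edges None 1" | "h \<in> pass_edges 0 w" | "h \<in> closing (Suc (length w))"
    by (auto simp: trivial_edges_def)
  then show ?thesis
  proof cases
    case 1
    \<comment> \<open>Truncated subtraction gives \<open>0 - 1 = 0\<close>, so the heights 0 and 1
      receive the same label.\<close>
    then show ?thesis using assms(2,3) by (auto simp: edge_label_def)
  next
    case 2
    from pass_edgesE[OF this] obtain s where s: "s < length w"
      "h = {(Suc s, 2 - 2 * left_pos (w ! s)), (Suc (Suc s), 2 - 2 * left_pos (w ! s))}"
      by auto
    let ?p = "2 - 2 * left_pos (w ! s)"
    have "s \<notin> touching w ?p" using s(1) by (subst not_touching) simp_all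
    then have "in_label w (Suc s) ?p = in_label w s ?p"
      by (simp add: in_label_alt last_touch_skip)
    then show ?thesis using s(2) assms(2,3) by (auto simp: edge_label_def)
  next
    case 3
    then obtain p where "h = {(0, p), (Suc (length w), p)}" by (auto simp: closing_def)
    then show ?thesis
      using assms(2,3) by (auto simp: edge_label_def in_label_alt last_touch_ends)
  qed
qed

text \<open>Points with equal labels are already joined by trivial edges, so contraction keeps the
  number of components. The trivial edges collapse to single labels, which occur in \<open>S\<close>
  anyway since either smoothing contains the outgoing points of its crossing.\<close>

lemma num_components_contract_ladder:
  assumes S: "S \<in> states (ladder q 0 w)"
  shows "num_components ((`) (edge_label w) ` S) = num_components (S \<union> trivial_edges w)"
proof -
  let ?f = "edge_label w" and ?T = "trivial_edges w"
  have vert: "snd v < 3 \<and> fst v \<le> Suc (length w)" if "v \<in> \<Union>(S \<union> ?T)" for v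
  proof -
    from that obtain h where "v \<in> h" "h \<in> S \<or> h \<in> ?T" by blast
    then show ?thesis
      using states_ladder_subset[OF S, of h "fst v" "snd v"] trivial_edges_vertices[of h "fst v" "snd v"]
      by auto
  qed
  have e1: "num_components ((`) ?f ` (S \<union> ?T)) = num_components (S \<union> ?T)"
  proof (rule num_components_contract)
    fix x y assume xy: "x \<in> \<Union>(S \<union> ?T)" "y \<in> \<Union>(S \<union> ?T)" "?f x = ?f y"
    obtain m p m' p' where mp: "x = (m, p)" "y = (m', p')" by (cases x, cases y) auto
    have b: "p < 3" "m \<le> Suc (length w)" "p' < 3" "m' \<le> Suc (length w)"
      using vert[OF xy(1)] vert[OF xy(2)] mp by auto
    have "last_touch w (m - 1) p = last_touch w (m' - 1) p' \<and> p = p'"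
      by (rule edge_label_eq) (use xy(3) mp b in simp_all)
    then have eq: "last_touch w (m - 1) p = last_touch w (m' - 1) p'" "p = p'" by blast+
    have "conn ?T x (last_touch w (m - 1) p + 2, p)"
      unfolding mp by (rule conn_last_touch[OF b(1,2)])
    moreover have "conn ?T (last_touch w (m - 1) p + 2, p) y"
      unfolding mp unfolding eq(1) unfolding eq(2) by (rule conn_sym[OF conn_last_touch[OF b(3,4)]])
    ultimately have "conn ?T x y" by (rule conn_trans)
    then show "conn (S \<union> ?T) x y" by (rule conn_mono) simp
  qed
  have e2: "num_components ((`) ?f ` (S \<union> ?T)) = num_components ((`) ?f ` S)"
  proof (rule num_components_mono_eqI)
    show "(`) ?f ` S \<subseteq> (`) ?f ` (S \<union> ?T)" by blast
    show "conn ((`) ?f ` S) u v"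
      if "h \<in> (`) ?f ` (S \<union> ?T) - (`) ?f ` S" "u \<in> h" "v \<in> h" for h u v
    proof -
      from that(1) obtain h' where "h' \<in> ?T" "h = ?f ` h'" by blast
      then have "u = v" using that(2,3) trivial_edges_label by blast
      then show ?thesis by simp
    qed
    show "\<Union>((`) ?f ` (S \<union> ?T)) \<subseteq> \<Union>((`) ?f ` S)"
    proof
      fix u assume "u \<in> \<Union>((`) ?f ` (S \<union> ?T))"
      then obtain v where v: "v \<in> \<Union>(S \<union> ?T)" "u = ?f v" by blast
      obtain m p where mp: "v = (m, p)" by (cases v)
      have b: "p < 3" "m \<le> Suc (length w)" using vert[OF v(1)] mp by auto
      let ?s = "last_touch w (m - 1) p"
      have s: "?s \<in> touching w p" by (rule last_touch_in[OF touched[OF b(1)]])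
      then have "(0 + ?s + 2, p) \<in> \<Union>S"
        using states_ladder_out[OF S, of ?s p] touching_left_pos by blast
      then obtain h where h: "h \<in> S" "(0 + ?s + 2, p) \<in> h" by (elim UnionE)
      moreover have "u = ?f (0 + ?s + 2, p)"
        using last_touch_Suc[OF s] v(2) mp by (simp add: edge_label_def in_label_alt)
      then have "u \<in> ?f ` h" using h(2) by (rule image_eqI)
      ultimately show "u \<in> \<Union>((`) ?f ` S)" by (meson UnionI imageI)
    qed
  qed
  show ?thesis by (rule trans[OF sym[OF e2] e1])
qed

lemma braid_closure_eq: "braid_closure w = map (braid_crossing w) [0..<length w]"
  using touched by (auto simp: braid_closure_def filter_empty_conv)

lemma edge_label_out: "s \<in> touching w p \<Longrightarrow> edge_label w (s + 2, p) = out_label s p"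
  using last_touch_Suc[of s w p] by (simp add: edge_label_def in_label_alt)

lemma piece_states_braid:
  assumes "s < length w"
  shows "piece_states q (braid_crossing w s) = map_states (edge_label w) (ladder_states q s (w ! s))"
proof -
  let ?p = "left_pos (w ! s)"
  have "s \<in> touching w ?p" "s \<in> touching w (?p + 1)"
    using assms by (simp_all add: touching_def)
  note out = this[THEN edge_label_out]
  have inn: "edge_label w (s + 1, p) = in_label w s p" for p
    by (simp add: edge_label_def)
  show ?thesis
    using out inn
    by (simp add: braid_crossing_def Let_def ladder_states_def map_states_def id_edges_def
        turn_edges_def id_weight_def turn_weight_def insert_commute)
qed

lemma bracket_braid_closure: "bracket q (braid_closure w) {} = type_value q w None"
proof -
  have "map (piece_states q) (braid_closure w) = map (map_states (edge_label w)) (ladder q 0 w)"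
    by (rule nth_equalityI) (simp_all add: braid_closure_eq nth_ladder piece_states_braid)
  then have "bracket q (braid_closure w) {} =
      state_sum (q + inverse q) (map (map_states (edge_label w)) (ladder q 0 w)) {}"
    by (simp add: bracket_def)
  also have "\<dots> = state_sum (q + inverse q) (ladder q 0 w) (trivial_edges w)"
    by (rule state_sum_map) (simp add: num_components_contract_ladder)
  also have "\<dots> = type_value q w None"
    unfolding trivial_edges_def using ladder_value[of None q 0 w] by (simp add: types_def)
  finally show ?thesis .
qed

end

section \<open>Edges of closed braids\<close>

definition out_labels :: "letter list \<Rightarrow> nat multiset" where
  "out_labels w = (\<Sum>p<3. \<Sum>t\<in>touching w p. {#out_label t p#})"

lemma count_out_labels_le: "count (out_labels w) l \<le> 1"
proof -
  let ?A = "Sigma {..<3} (touching w)"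
  let ?B = "{x \<in> ?A. out_label (snd x) (fst x) = l}"
  have fin: "finite ?A" by simp
  have "count (out_labels w) l = (\<Sum>(p, t)\<in>?A. count {#out_label t p#} l)"
    unfolding out_labels_def count_sum by (rule sum.Sigma) simp_all
  also have "\<dots> = (\<Sum>x\<in>?A. if out_label (snd x) (fst x) = l then 1 else 0)"
    by (intro sum.cong) auto
  also have "\<dots> = card ?B"
    using fin by (simp add: sum.If_cases Int_def)
  also have "card ?B \<le> 1"
  proof -
    have "x = y" if "x \<in> ?B" "y \<in> ?B" for x y
    proof -
      obtain p t p' t' where xy: "x = (p, t)" "y = (p', t')" by (cases x, cases y) auto
      have "3 * t + p = 3 * t' + p'" "p < 3" "p' < 3"
        using that by (auto simp: xy out_label_def)
      then have "t = t' \<and> p = p'" by presburger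
      then show ?thesis by (simp add: xy)
    qed
    moreover have "finite ?B" using fin by simp
    ultimately show ?thesis by (subst One_nat_def, subst card_le_Suc0_iff_eq) blast+
  qed
  finally show ?thesis .
qed

context full_braid
begin

text \<open>On the crossings of a column this map is the cyclic predecessor. Being injective on a
  finite set that it maps into itself, it is onto.\<close>

lemma bij_last_touch:
  assumes "p < 3"
  shows "bij_betw (\<lambda>t. last_touch w t p) (touching w p) (touching w p)"
proof -
  let ?S = "touching w p"
  have lt: "last_touch w t p \<noteq> last_touch w t' p" if "t \<in> ?S" "t' \<in> ?S" "t < t'" for t t'
  proof -
    have "{s \<in> ?S. s < t'} \<noteq> {}" using that by blast
    then have t': "last_touch w t' p = Max {s \<in> ?S. s < t'}" by (simp add: last_touch_def)
    have "Max {s \<in> ?S. s < t'} \<in> {s \<in> ?S. s < t'}"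
      using that by (intro Max_in) auto
    moreover have "t \<le> Max {s \<in> ?S. s < t'}" using that by (intro Max_ge) auto
    \<comment> \<open>The predecessor of \<open>t'\<close> lies between \<open>t\<close> and
      \<open>t'\<close>, whereas that of \<open>t\<close> lies below \<open>t\<close> or wraps
      around to the maximum, which is at least \<open>t'\<close>.\<close>
    ultimately have t'_bounds: "t \<le> last_touch w t' p" "last_touch w t' p < t'" using t' by auto
    show ?thesis
    proof (cases "{s \<in> ?S. s < t} = {}")
      case True
      then have "last_touch w t p = Max ?S" by (simp add: last_touch_def)
      moreover have "t' \<le> Max ?S" using that by (intro Max_ge) auto
      ultimately show ?thesis using t'_bounds by linarith
    next
      case False
      then have "Max {s \<in> ?S. s < t} \<in> {s \<in> ?S. s < t}" by (intro Max_in) auto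
      then have "last_touch w t p < t" using False by (simp add: last_touch_def)
      then show ?thesis using t'_bounds by linarith
    qed
  qed
  have "inj_on (\<lambda>t. last_touch w t p) ?S"
  proof (rule inj_onI)
    fix t t' assume "t \<in> ?S" "t' \<in> ?S" "last_touch w t p = last_touch w t' p"
    then show "t = t'" using lt[of t t'] lt[of t' t] by (metis linorder_neqE_nat)
  qed
  moreover have "(\<lambda>t. last_touch w t p) ` ?S \<subseteq> ?S"
    using last_touch_in[OF touched[OF assms]] by blast
  ultimately show ?thesis
    using endo_inj_surj[OF finite_touching] by (simp add: bij_betw_def)
qed

lemma sum_in_label:
  assumes "p < 3"
  shows "(\<Sum>t\<in>touching w p. {#in_label w t p#}) = (\<Sum>t\<in>touching w p. {#out_label t p#})"
  unfolding in_label_alt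
  by (rule sum.reindex_bij_betw[OF bij_last_touch[OF assms], of "\<lambda>t. {#out_label t p#}"])

lemma sum_touching:
  fixes f :: "nat \<Rightarrow> nat \<Rightarrow> nat multiset"
  shows "(\<Sum>t<length w. \<Sum>p<3. if t \<in> touching w p then f t p else {#}) =
    (\<Sum>p<3. \<Sum>t\<in>touching w p. f t p)"
proof -
  have "(\<Sum>t<length w. if t \<in> touching w p then f t p else {#}) = (\<Sum>t\<in>touching w p. f t p)" for p
  proof -
    have "(\<Sum>t<length w. if t \<in> touching w p then f t p else {#}) =
        (\<Sum>t\<in>{t \<in> {..<length w}. t \<in> touching w p}. f t p)"
      by (rule sum.inter_filter[symmetric]) simp
    also have "{t \<in> {..<length w}. t \<in> touching w p} = touching w p"
      using touching_less by blast
    finally show ?thesis .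
  qed
  then show ?thesis by (subst sum.swap) simp
qed

lemma all_labels_braid_closure: "all_labels (braid_closure w) = out_labels w + out_labels w"
proof -
  have piece: "piece_labels (braid_crossing w t) =
      (\<Sum>p<3. if t \<in> touching w p then {#in_label w t p#} + {#out_label t p#} else {#})"
    if "t < length w" for t
    using that by (cases "w ! t")
      (simp_all add: braid_crossing_def Let_def touching_def numeral_3_eq_3 lessThan_Suc)
  have "all_labels (braid_closure w) = (\<Sum>t<length w. piece_labels (braid_crossing w t))"
    by (simp add: braid_closure_eq interv_sum_list_conv_sum_set_nat atLeast0LessThan)
  also have "\<dots> = (\<Sum>t<length w. \<Sum>p<3.
      if t \<in> touching w p then {#in_label w t p#} + {#out_label t p#} else {#})"
    by (intro sum.cong refl) (simp only: piece lessThan_iff)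
  also have "\<dots> = (\<Sum>p<3. \<Sum>t\<in>touching w p. {#in_label w t p#} + {#out_label t p#})"
    by (rule sum_touching)
  also have "\<dots> = (\<Sum>p<3. \<Sum>t\<in>touching w p. {#in_label w t p#}) + out_labels w"
    by (simp only: out_labels_def sum.distrib)
  also have "(\<Sum>p<3. \<Sum>t\<in>touching w p. {#in_label w t p#}) = out_labels w"
    unfolding out_labels_def by (rule sum.cong[OF refl]) (simp only: sum_in_label lessThan_iff)
  finally show ?thesis .
qed

lemma closed_braid_closure: "closed_diagram (braid_closure w)"
  unfolding closed_diagram_def
proof
  fix l
  have "count (all_labels (braid_closure w)) l = 2 * count (out_labels w) l"
    by (simp add: all_labels_braid_closure)
  moreover have "count (out_labels w) l = 0 \<or> count (out_labels w) l = 1"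
    using count_out_labels_le[of w l] by linarith
  ultimately show "count (all_labels (braid_closure w)) l \<in> {0, 2}" by auto
qed

text \<open>For both letters the under strand enters in the middle column and leaves in an outer
  one, and the over strand does the reverse. Column by column, incoming and outgoing labels form the
  same multiset, so every edge occurs once as under and once as over.\<close>

lemma alternating_braid_closure:
  assumes "set w \<subseteq> {Sigma1, Sigma2_inv}"
  shows "alternating (braid_closure w)"
proof -
  have lett: "w ! t = Sigma1 \<or> w ! t = Sigma2_inv" if "t < length w" for t
    using assms nth_mem[OF that] by blast
  have concat_mset: "mset (concat (map f (braid_closure w))) =
      (\<Sum>t<length w. mset (f (braid_crossing w t)))" for f :: "piece \<Rightarrow> nat list"
    by (simp add: braid_closure_eq mset_concat interv_sum_list_conv_sum_set_nat atLeast0LessThan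
        comp_def)
  have under: "mset (under_edges (braid_crossing w t)) = (\<Sum>p<3. if t \<in> touching w p
      then if p = 1 then {#in_label w t p#} else {#out_label t p#} else {#})"
    if "t < length w" for t
    using lett[OF that] that
    by (auto simp: braid_crossing_def Let_def touching_def numeral_3_eq_3 lessThan_Suc)
  have over: "mset (over_edges (braid_crossing w t)) = (\<Sum>p<3. if t \<in> touching w p
      then if p = 1 then {#out_label t p#} else {#in_label w t p#} else {#})"
    if "t < length w" for t
    using lett[OF that] that
    by (auto simp: braid_crossing_def Let_def touching_def numeral_3_eq_3 lessThan_Suc)
  have U: "mset (concat (map under_edges (braid_closure w))) = out_labels w"
  proof -
    have "mset (concat (map under_edges (braid_closure w))) = (\<Sum>t<length w. \<Sum>p<3.
        if t \<in> touching w p then if p = 1 then {#in_label w t p#} else {#out_label t p#} else {#})"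
      unfolding concat_mset by (intro sum.cong refl) (simp only: under lessThan_iff)
    also have "\<dots> = (\<Sum>p<3. \<Sum>t\<in>touching w p. if p = 1 then {#in_label w t p#} else {#out_label t p#})"
      by (rule sum_touching)
    also have "\<dots> = out_labels w"
      unfolding out_labels_def
    proof (rule sum.cong[OF refl])
      fix p :: nat assume "p \<in> {..<3}"
      then show "(\<Sum>t\<in>touching w p. if p = 1 then {#in_label w t p#} else {#out_label t p#}) =
          (\<Sum>t\<in>touching w p. {#out_label t p#})"
        using sum_in_label[of p] by (cases "p = 1") simp_all
    qed
    finally show ?thesis .
  qed
  have O: "mset (concat (map over_edges (braid_closure w))) = out_labels w"
  proof -
    have "mset (concat (map over_edges (braid_closure w))) = (\<Sum>t<length w. \<Sum>p<3.
        if t \<in> touching w p then if p = 1 then {#out_label t p#} else {#in_label w t p#} else {#})"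
      unfolding concat_mset by (intro sum.cong refl) (simp only: over lessThan_iff)
    also have "\<dots> = (\<Sum>p<3. \<Sum>t\<in>touching w p. if p = 1 then {#out_label t p#} else {#in_label w t p#})"
      by (rule sum_touching)
    also have "\<dots> = out_labels w"
      unfolding out_labels_def
    proof (rule sum.cong[OF refl])
      fix p :: nat assume "p \<in> {..<3}"
      then show "(\<Sum>t\<in>touching w p. if p = 1 then {#out_label t p#} else {#in_label w t p#}) =
          (\<Sum>t\<in>touching w p. {#out_label t p#})"
        using sum_in_label[of p] by (cases "p = 1") simp_all
    qed
    finally show ?thesis .
  qed
  have "distinct xs" if "mset xs = out_labels w" for xs
  proof -
    have "count (mset xs) l \<le> 1" for l using count_out_labels_le[of w l] that by simp
    then have "count (mset xs) l = (if l \<in> set xs then 1 else 0)" for l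
      by (metis count_eq_zero_iff le_antisym less_one linorder_not_less set_mset_mset)
    then show ?thesis unfolding distinct_count_atmost_1 by blast
  qed
  then show ?thesis
    unfolding alternating_def using U O by (metis set_mset_mset)
qed

end

lemma crossings_braid_closure: "length (crossings (braid_closure w)) = length w"
proof -
  have "filter (\<lambda>x. crossing_edges x \<noteq> []) (map (braid_crossing w) [0..<length w]) =
      map (braid_crossing w) [0..<length w]"
    by (rule filter_True) (auto simp: braid_crossing_def Let_def)
  then show ?thesis
    by (simp add: crossings_def braid_closure_def filter_map comp_def)
qed

lemma braid_closure_nonempty: "braid_closure w \<noteq> []"
  by (cases w) (auto simp: braid_closure_def touching_def filter_empty_conv)

lemma full_braidI:
  assumes "\<exists>x\<in>set w. left_pos x = 0" "\<exists>x\<in>set w. left_pos x = 1"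
  shows "full_braid w"
proof
  fix p :: nat assume "p < 3"
  then have "p = 0 \<or> p = 1 \<or> p = 2" by linarith
  moreover have "\<exists>t<length w. left_pos (w ! t) = k" if "k = 0 \<or> k = 1" for k
    using assms that by (metis in_set_conv_nth)
  ultimately show "touching w p \<noteq> {}"
    by (fastforce simp: touching_def)
qed


section \<open>Disjoint kinks\<close>

definition kink :: "nat \<Rightarrow> piece" where
  "kink t = Pos (2 * t) (2 * t) (2 * t + 1) (2 * t + 1)"

definition kinks :: "nat \<Rightarrow> piece list" where
  "kinks n = map kink [0..<n]"

text \<open>At \<open>q = 1\<close> a circle counts 2 and the smoothings have weights 1 and -1, so a
  kink contributes 2^2 - 2 = 2, the value of an unknot.\<close>

lemma bracket_kinks:
  "distinct ts \<Longrightarrow> finite (\<Union>Z) \<Longrightarrow> (\<And>t. t \<in> set ts \<Longrightarrow> \<Union>Z \<inter> {2 * t, 2 * t + 1} = {}) \<Longrightarrow>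
    bracket 1 (map kink ts) Z = 2 ^ length ts * 2 ^ num_components Z"
proof (induction ts arbitrary: Z)
  case Nil
  then show ?case by (simp add: bracket_def)
next
  case (Cons t ts)
  let ?a = "2 * t" and ?b = "2 * t + 1"
  have Z: "?a \<notin> \<Union>Z" "?b \<notin> \<Union>Z" using Cons.prems(3)[of t] by simp_all
  have fin: "finite (\<Union>(insert A Z))" if "finite A" for A using Cons.prems(2) that by simp
  have disj: "{?a, ?b} \<inter> {2 * s, 2 * s + 1} = {}" if "s \<in> set ts" for s
  proof -
    have "s \<noteq> t" using that Cons.prems(1) by auto
    then show ?thesis by auto
  qed
  have 0: "bracket 1 (map kink ts) (insert {?a} (insert {?b} Z)) = 2 ^ length ts * 2 ^ Suc (Suc (num_components Z))"
  proof -
    have "num_components (insert {?a} (insert {?b} Z)) = Suc (num_components (insert {?b} Z))"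
      using Z fin[of "{?b}"] by (intro num_components_insert_disjoint) auto
    also have "num_components (insert {?b} Z) = Suc (num_components Z)"
      using Z Cons.prems(2) by (intro num_components_insert_disjoint) auto
    finally show ?thesis
      using Cons.prems disj by (subst Cons.IH) (auto simp: Int_Un_distrib2)
  qed
  have 1: "bracket 1 (map kink ts) (insert {?a, ?b} Z) = 2 ^ length ts * 2 ^ Suc (num_components Z)"
  proof -
    have "num_components (insert {?a, ?b} Z) = Suc (num_components Z)"
      using Z Cons.prems(2) by (intro num_components_insert_disjoint) auto
    then show ?thesis
      using Cons.prems disj by (subst Cons.IH) (auto simp: Int_Un_distrib2)
  qed
  have "bracket 1 (map kink (t # ts)) Z = bracket 1 (map kink ts) (insert {?a} (insert {?b} Z)) -
      bracket 1 (map kink ts) (insert {?a, ?b} Z)"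
    by (simp add: bracket_def kink_def)
  then show ?case unfolding 0 1 by simp
qed

lemma length_kinks [simp]: "length (kinks n) = n"
  by (simp add: kinks_def)

lemma crossings_kinks: "crossings (kinks n) = kinks n"
  unfolding crossings_def kinks_def by (rule filter_True) (auto simp: kink_def)

lemma closed_kinks: "closed_diagram (kinks n)"
proof -
  have "count (all_labels (kinks n)) l = (if l < 2 * n then 2 else 0)" for l
    by (induction n) (auto simp: kinks_def kink_def)
  then show ?thesis by (simp add: closed_diagram_def)
qed

text \<open>A kink is a figure eight: the corners 1 and 3 lie in the two monogons, the corners 0 and
  2 on the outer face. With three faces for each of the \<open>n\<close> parts, Euler's formula
  reads n - 2 n + 3 n = 2 n.\<close>

lemma link_diagram_kinks:
  assumes "n > 0"
  shows "link_diagram (kinks n)"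
proof -
  let ?D = "kinks n"
  have in_out: "concat (map in_edges ?D) = [0..<2 * n] \<and>
    mset (concat (map out_edges ?D)) = mset [0..<2 * n]"
    by (induction n) (auto simp: kinks_def kink_def)
  have darts: "darts ?D = {..<n} \<times> {..<4}"
    by (simp add: darts_def crossings_kinks)
  have edge: "dart_edge ?D (t, j) = 2 * t + j div 2" if "t < n" "j < 4" for t j
  proof -
    have "j = 0 \<or> j = 1 \<or> j = 2 \<or> j = 3" using that(2) by linarith
    moreover have "crossings ?D ! t = kink t"
      unfolding crossings_kinks using that(1) by (simp add: kinks_def)
    ultimately show ?thesis by (auto simp: dart_edge_def kink_def)
  qed
  have edge_eq: "t = t' \<and> j div 2 = j' div 2"
    if "t < n" "j < 4" "t' < n" "j' < 4" "dart_edge ?D (t, j) = dart_edge ?D (t', j')" for t j t' j'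
  proof -
    have "2 * t + j div 2 = 2 * t' + j' div 2" using that edge by metis
    moreover have "j div 2 < 2" "j' div 2 < 2" using that by auto
    moreover have "t = t' \<and> a = b" if "2 * t + a = 2 * t' + b" "a < 2" "b < 2" for a b
      using that by presburger
    ultimately show ?thesis by blast
  qed
  let ?A = "{..<n} \<times> {..<4 :: nat}"
  let ?next = "\<lambda>d d'. \<exists>e\<in>?A. e \<noteq> d \<and> dart_edge ?D e = dart_edge ?D d \<and> d' = (fst e, (snd e + 1) mod 4)"
  have cases4: "j = 0 \<or> j = 1 \<or> j = 2 \<or> j = 3" if "j < 4" for j :: nat
    using that by linarith
  have next_D: "t' = t \<and> (j, j') \<in> {(0, 2), (1, 1), (2, 0), (3, 3)}"
    if nxt: "?next (t, j) (t', j')" and tj: "t < n" "j < 4" for t j t' j'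
  proof -
    from nxt obtain e where e: "e \<in> ?A" "e \<noteq> (t, j)" "dart_edge ?D e = dart_edge ?D (t, j)"
      "(t', j') = (fst e, (snd e + 1) mod 4)" by (elim bexE conjE)
    obtain s k where sk: "e = (s, k)" by (cases e)
    have "s < n" "k < 4" using e(1) sk by simp_all
    then have eq: "s = t" "k div 2 = j div 2"
      using edge_eq[of s k t j] tj e(3) sk by simp_all
    then have "k \<noteq> j" using e(2) sk by simp
    then have "(j, (k + 1) mod 4) \<in> {(0, 2), (1, 1), (2, 0), (3, 3)}"
      using cases4[OF \<open>k < 4\<close>] cases4[OF tj(2)] eq(2) by (elim disjE) simp_all
    then show ?thesis using e(4) sk eq(1) by simp
  qed
  have turn: "?next (s, 0) (s, 2)" if "s < n" for s
    using that edge[of s 0] edge[of s 1] by (intro bexI[of _ "(s, 1)"]) simp_all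
  let ?f = "\<lambda>d :: nat \<times> nat. (fst d, if snd d = 2 then 0 else snd d)"
  have "card (faces ?D) = card (?f ` ?A)"
    unfolding faces_def darts
  proof (rule card_adj_classes)
    fix x y assume xy: "x \<in> ?A" "y \<in> ?A"
    obtain t j where x: "x = (t, j)" by (cases x)
    obtain t' j' where y: "y = (t', j')" by (cases y)
    have tj: "t < n" "j < 4" using xy(1) x by simp_all
    show "?f x = ?f y" if "?next x y"
      using next_D[OF that[unfolded x y] tj] unfolding x y by auto
    show "x = y \<or> ?next x y \<or> ?next y x" if "?f x = ?f y"
    proof -
      have "t = t'" "j = j' \<or> j = 0 \<and> j' = 2 \<or> j = 2 \<and> j' = 0"
        using that x y by (auto split: if_splits)
      then consider "x = y" | "x = (t, 0)" "y = (t, 2)" | "x = (t, 2)" "y = (t, 0)"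
        using x y by blast
      then show ?thesis
      proof cases
        case 2
        then show ?thesis using turn[OF tj(1)] by (simp only: simp_thms)
      next
        case 3
        then show ?thesis using turn[OF tj(1)] by (simp only: simp_thms)
      qed (rule disjI1)
    qed
  qed
  also have "?f ` ?A = {..<n} \<times> {0, 1, 3}"
  proof (intro equalityI subsetI)
    fix x assume "x \<in> ?f ` ?A"
    then obtain t j where "t < n" "j < 4" "x = (t, if j = 2 then 0 else j)" by auto
    then show "x \<in> {..<n} \<times> {0, 1, 3}" using cases4[of j] by auto
  next
    fix x :: "nat \<times> nat" assume "x \<in> {..<n} \<times> {0, 1, 3}"
    then show "x \<in> ?f ` ?A" by (intro image_eqI[of _ _ x]) auto
  qed
  finally have faces: "card (faces ?D) = 3 * n" by (simp add: card_cartesian_product)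
  have "card (connected_parts ?D) = card (fst ` ({..<n} \<times> {..<4 :: nat}))"
    unfolding connected_parts_def darts
  proof (rule card_adj_classes)
    fix x y assume xy: "x \<in> ?A" "y \<in> ?A"
    have "fst x < n" "snd x < 4" "fst y < n" "snd y < 4"
      using xy by (simp_all add: mem_Times_iff)
    from edge_eq[OF this] show "fst x = fst y"
      if "fst x = fst y \<or> dart_edge ?D x = dart_edge ?D y"
      using that by (elim disjE) simp_all
    show "x = y \<or> (fst x = fst y \<or> dart_edge ?D x = dart_edge ?D y) \<or>
        (fst y = fst x \<or> dart_edge ?D y = dart_edge ?D x)" if "fst x = fst y"
      using that by blast
  qed
  also have "fst ` ({..<n} \<times> {..<4 :: nat}) = {..<n}" by (simp add: lessThan_empty_iff)
  finally have parts: "card (connected_parts ?D) = n" by simp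
  have d: "distinct (concat (map in_edges ?D))" using in_out by simp
  moreover have "distinct (concat (map out_edges ?D))"
    using in_out mset_eq_imp_distinct_iff distinct_upt by metis
  moreover have "set (concat (map in_edges ?D)) = set (concat (map out_edges ?D))"
    using in_out mset_eq_setD by metis
  moreover have "?D \<noteq> []" using assms by (simp add: kinks_def)
  ultimately show ?thesis
    unfolding link_diagram_def by (simp only: crossings_kinks length_kinks faces parts) simp
qed

section \<open>Exponential growth\<close>

lemma foldr_concat_replicate:
  "foldr f (concat (replicate k u) @ v) y = (foldr f u ^^ k) (foldr f v y)"
  by (induction k) simp_all

text \<open>At this parameter \<open>\<sigma>\<^sub>1 \<sigma>\<^sub>2\<^sup>-\<^sup>1\<close> acts with the eigenvalues \<open>2\<close> and \<open>1/2\<close>.\<close>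

locale hyperbolic_parameter =
  fixes q p d :: complex
  assumes norm_q: "norm q = 1" and p: "p = inverse q" and d: "d = q + p" and d2: "2 * d\<^sup>2 = 1"
begin

lemma q0: "q \<noteq> 0"
  using norm_q by auto

lemma qp: "q * p = 1"
  using q0 by (simp add: p)

lemma squares: "2 * (q\<^sup>2 + p\<^sup>2) = - 3"
  using d2 qp unfolding d by algebra

lemma d0: "d \<noteq> 0"
  using d2 by auto

lemma act_Sigma1: "act q Sigma1 (a, b) = (- (q ^ 3) * a - q\<^sup>2 * b, q * b)"
proof -
  have "q + - q\<^sup>2 * (q + p) = - (q ^ 3)" using qp by algebra
  then show ?thesis by (simp add: act_def id_weight_def turn_weight_def flip: p)
qed

lemma act_Sigma2: "act q Sigma2 (a, b) = (q * a, - q\<^sup>2 * a - q ^ 3 * b)"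
proof -
  have "q + - q\<^sup>2 * (q + p) = - (q ^ 3)" using qp by algebra
  then show ?thesis by (simp add: act_def id_weight_def turn_weight_def flip: p)
qed

lemma act_Sigma2_inv: "act q Sigma2_inv (a, b) = (p * a, - p\<^sup>2 * a - p ^ 3 * b)"
proof -
  have "p + - p\<^sup>2 * (q + p) = - (p ^ 3)" using qp by algebra
  then show ?thesis by (simp add: act_def id_weight_def turn_weight_def flip: p)
qed

text \<open>\<open>A1\<close> and \<open>A2\<close> are the rows of the matrix of the alternating
  block, of determinant 1 and trace 5/2.\<close>

definition A1 :: "complex \<Rightarrow> complex \<Rightarrow> complex" where
  "A1 a b = (1 - q\<^sup>2) * a + p * b"

definition A2 :: "complex \<Rightarrow> complex \<Rightarrow> complex" where
  "A2 a b = - p * a - p\<^sup>2 * b"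

text \<open>The factors \<open>1 *\<close> give the shape of the assumption \<open>block\<close>
  below, with \<open>c = 1\<close>.\<close>

lemma act_alternating_block: "foldr (act q) [Sigma1, Sigma2_inv] (a, b) = (1 * A1 a b, 1 * A2 a b)"
proof -
  have "- (q ^ 3) * (p * a) - q\<^sup>2 * (- p\<^sup>2 * a - p ^ 3 * b) = 1 * A1 a b"
    "q * (- p\<^sup>2 * a - p ^ 3 * b) = 1 * A2 a b"
    unfolding A1_def A2_def using qp by algebra+
  then show ?thesis by (simp add: act_Sigma1 act_Sigma2_inv)
qed

text \<open>The block is \<open>\<sigma>\<^sub>1 \<sigma>\<^sub>2\<^sup>-\<^sup>1\<close> times the full twist, which is central.\<close>

lemma act_positive_block:
  "foldr (act q) [Sigma1, Sigma1, Sigma2, Sigma1, Sigma2, Sigma1] (a, b) = (q ^ 12 * A1 a b, q ^ 12 * A2 a b)"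
proof -
  have pq: "q ^ 12 * p = q ^ 11" "q ^ 12 * p\<^sup>2 = q ^ 10" using qp by algebra+
  have "q ^ 12 * A1 a b = q ^ 12 * (1 - q\<^sup>2) * a + (q ^ 12 * p) * b"
    "q ^ 12 * A2 a b = - (q ^ 12 * p) * a - (q ^ 12 * p\<^sup>2) * b"
    by (simp_all add: A1_def A2_def algebra_simps)
  then show ?thesis
    unfolding pq by (simp add: act_Sigma1 act_Sigma2) (simp add: algebra_simps power_numeral_reduce)
qed

text \<open>Three times the projections to the eigenspaces.\<close>

definition P1 where "P1 a b = 2 * A1 a b - a"
definition P2 where "P2 a b = 2 * A2 a b - b"
definition Q1 where "Q1 a b = 4 * a - 2 * A1 a b"
definition Q2 where "Q2 a b = 4 * b - 2 * A2 a b"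

text \<open>Cayley-Hamilton for the characteristic polynomial (x - 2) (x - 1/2).\<close>

lemma eigen:
  "A1 (P1 a b) (P2 a b) = 2 * P1 a b" "A2 (P1 a b) (P2 a b) = 2 * P2 a b"
  "2 * A1 (Q1 a b) (Q2 a b) = Q1 a b" "2 * A2 (Q1 a b) (Q2 a b) = Q2 a b"
  unfolding P1_def P2_def Q1_def Q2_def A1_def A2_def using qp squares by algebra+

lemma iterate_block:
  assumes F: "\<And>a b. F (a, b) = (c * A1 a b, c * A2 a b)"
  shows "(F ^^ k) (a, b) =
    (c ^ k * (2 ^ k * P1 a b + (1 / 2) ^ k * Q1 a b) / 3, c ^ k * (2 ^ k * P2 a b + (1 / 2) ^ k * Q2 a b) / 3)"
proof (induction k)
  case 0
  show ?case by (simp add: P1_def P2_def Q1_def Q2_def)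
next
  case (Suc k)
  have lin: "A1 (s * (x * u + y * v) / 3) (s * (x * u' + y * v') / 3) = s * (x * A1 u u' + y * A1 v v') / 3"
    "A2 (s * (x * u + y * v) / 3) (s * (x * u' + y * v') / 3) = s * (x * A2 u u' + y * A2 v v') / 3"
    for s x y u u' v v'
    by (simp_all add: A1_def A2_def field_simps)
  have half: "A1 (Q1 a b) (Q2 a b) = Q1 a b / 2" "A2 (Q1 a b) (Q2 a b) = Q2 a b / 2"
    using eigen(3,4)[of a b] by (simp_all add: field_simps)
  show ?case
    unfolding funpow.simps comp_apply Suc F lin eigen(1,2) half by (simp add: field_simps)
qed

section \<open>Padding and the coefficient of the growing eigenvalue\<close>

lemma foldr_Sigma1_first: "foldr (act q) (replicate r Sigma1) (1, 0) = ((- (q ^ 3)) ^ r, 0)"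
  by (induction r) (simp_all add: act_Sigma1)

text \<open>The matrix of \<open>Sigma1\<close> is triangular with eigenvalues
  \<open>- (q ^ 3)\<close> and \<open>q\<close>. The corner entry of its power is
  \<open>- q ^ 2\<close> times a divided difference whose denominator is \<open>- q ^ 2 * d\<close>;
  the equation for \<open>g\<close> is this with the division cleared.\<close>

lemma foldr_Sigma1_second:
  "\<exists>g. foldr (act q) (replicate r Sigma1) (0, 1) = (g, q ^ r) \<and> d * g = (- (q ^ 3)) ^ r - q ^ r"
proof (induction r)
  case (Suc r)
  then obtain g where g: "foldr (act q) (replicate r Sigma1) (0, 1) = (g, q ^ r)"
    "d * g = (- (q ^ 3)) ^ r - q ^ r" by blast
  have "d * (- (q ^ 3) * g - q\<^sup>2 * q ^ r) = - (q ^ 3) * (d * g) - q\<^sup>2 * (q + p) * q ^ r"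
    by (simp add: d algebra_simps)
  also have "\<dots> = - (q ^ 3) * (- (q ^ 3)) ^ r + (q ^ 3 - q\<^sup>2 * (q + p)) * q ^ r"
    unfolding g(2) by (simp add: algebra_simps)
  also have "q ^ 3 - q\<^sup>2 * (q + p) = - q" using qp by algebra
  finally show ?case using g(1) by (simp add: act_Sigma1)
qed simp

text \<open>The left side is three times the trace of the projection to the eigenvalue 2 applied
  after the padding, where \<open>m\<close> and \<open>n\<close> are the diagonal entries of the
  padding and \<open>g\<close> its corner entry.\<close>

lemma leading_coefficient:
  assumes "d * g = m - n"
  shows "P1 m 0 + P2 g n = - 2 * (p\<^sup>2 * m + q\<^sup>2 * n)"
  unfolding P1_def P2_def A1_def A2_def using assms d2 qp squares unfolding d by algebra

text \<open>\<open>q ^ 2\<close> is a root of 2 s^2 + 3 s + 2, whose discriminant is -7.\<close>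

lemma not_real: "Im (q\<^sup>2) \<noteq> 0"
proof
  assume im: "Im (q\<^sup>2) = 0"
  let ?s = "q\<^sup>2"
  have "2 * ?s\<^sup>2 + 3 * ?s + 2 = 0" using squares qp by algebra
  moreover have s: "?s = complex_of_real (Re ?s)" using im by (simp add: complex_eq_iff)
  ultimately have "complex_of_real (2 * (Re ?s)\<^sup>2 + 3 * Re ?s + 2) = 0"
    by (metis (no_types, opaque_lifting) of_real_add of_real_mult of_real_numeral of_real_power)
  then have "2 * (Re ?s)\<^sup>2 + 3 * Re ?s + 2 = 0" by (simp only: of_real_eq_0_iff)
  moreover have "2 * (Re ?s)\<^sup>2 + 3 * Re ?s + 2 = 2 * (Re ?s + 3 / 4)\<^sup>2 + 7 / 8"
    by (simp add: power2_eq_square field_simps)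
  moreover have "(Re ?s + 3 / 4)\<^sup>2 \<ge> 0" by simp
  ultimately show False by linarith
qed

text \<open>Vanishing would mean 2 (- s)^r = 2 + 3 s for s = q^2. Reduced by 2 s^2 + 3 s + 2 = 0
  this becomes a linear equation with integer coefficients, which makes s real. Exponents below six
  suffice for blocks of at most six letters.\<close>

lemma leading_coefficient_nonzero:
  assumes "r < 6"
  shows "p\<^sup>2 * (- (q ^ 3)) ^ r + q\<^sup>2 * q ^ r \<noteq> 0"
proof
  assume 0: "p\<^sup>2 * (- (q ^ 3)) ^ r + q\<^sup>2 * q ^ r = 0"
  define s where "s = q\<^sup>2"
  have h: "2 * s\<^sup>2 + 3 * s + 2 = 0"
    unfolding s_def using squares qp by algebra
  have "(- (q ^ 3)) ^ r = (- s) ^ r * q ^ r"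
    by (simp add: s_def power_mult_distrib[symmetric] power2_eq_square power3_eq_cube)
  then have "q ^ r * (p\<^sup>2 * (- s) ^ r + s) = 0" using 0 by (simp add: s_def algebra_simps)
  then have "p\<^sup>2 * (- s) ^ r + s = 0" using q0 by simp
  moreover have "q\<^sup>2 * p\<^sup>2 * (- s) ^ r + s\<^sup>2 = s * (p\<^sup>2 * (- s) ^ r + s)"
    by (simp add: s_def distrib_left mult.assoc power2_eq_square[of "q\<^sup>2"])
  ultimately have "q\<^sup>2 * p\<^sup>2 * (- s) ^ r + s\<^sup>2 = 0" by simp
  moreover have "q\<^sup>2 * p\<^sup>2 = 1" using qp by algebra
  ultimately have "(- s) ^ r + s\<^sup>2 = 0" by simp
  moreover have "2 * x = 2 + 3 * s" if "x + s\<^sup>2 = 0" for x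
    using that h by algebra
  ultimately have eq: "2 * (- s) ^ r = 2 + 3 * s" by blast
  have im: "Im s \<noteq> 0" using not_real by (simp add: s_def)
  have no: False if "a * s = b" "a = of_real (Re a)" "b = of_real (Re b)" "Re a \<noteq> 0" for a b
  proof -
    have "Im (of_real (Re a) * s) = Im (of_real (Re b))" using that(1-3) by simp
    then show False using im that(4) by simp
  qed
  have "r = 0 \<or> r = 1 \<or> r = 2 \<or> r = 3 \<or> r = 4 \<or> r = 5" using assms by linarith
  then show False
  proof (elim disjE)
    assume "r = 0"
    then have "3 * s = 0" using eq by simp
    then show False by (rule no) simp_all
  next
    assume r: "r = 1"
    have "5 * s = - 2" using eq unfolding r power_one_right by algebra
    then show False by (rule no) simp_all
  next
    assume r: "r = 2"
    have "3 * s = - 2" using eq h unfolding r by algebra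
    then show False by (rule no) simp_all
  next
    assume r: "r = 3"
    have "11 * s = - 10" using eq h unfolding r by algebra
    then show False by (rule no) simp_all
  next
    assume r: "r = 4"
    have "15 * s = - 18" using eq h unfolding r by algebra
    then show False by (rule no) simp_all
  next
    assume r: "r = 5"
    have "13 * s = - 22" using eq h unfolding r by algebra
    then show False by (rule no) simp_all
  qed
qed

text \<open>The term with \<open>2 ^ k\<close> has a nonzero coefficient. The eigenvalue 1/2 and the
  one-dimensional representation contribute only bounded amounts, as \<open>c\<close> and the
  weights \<open>id_weight\<close> have modulus one; these are collected in
  \<open>K\<close>.\<close>

lemma block_growth:
  assumes block: "\<And>a b. foldr (act q) u (a, b) = (c * A1 a b, c * A2 a b)" and c: "norm c = 1"
    and r: "r < 6"
  shows "\<exists>a>0. \<exists>K. \<forall>k. a * 2 ^ k - K \<le> norm (type_value q (concat (replicate k u) @ replicate r Sigma1) None)"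
proof -
  obtain g where g: "foldr (act q) (replicate r Sigma1) (0, 1) = (g, q ^ r)"
    "d * g = (- (q ^ 3)) ^ r - q ^ r" using foldr_Sigma1_second by blast
  let ?m = "(- (q ^ 3)) ^ r"
  define \<alpha> where "\<alpha> = P1 ?m 0 + P2 g (q ^ r)"
  define \<beta> where "\<beta> = Q1 ?m 0 + Q2 g (q ^ r)"
  define K where "K = norm d * norm \<beta> / 3 + norm (d ^ 3 - 2 * d)"
  have "\<alpha> \<noteq> 0"
    unfolding \<alpha>_def leading_coefficient[OF g(2)]
    by (rule no_zero_divisors[OF _ leading_coefficient_nonzero[OF r]]) simp
  then have pos: "norm d * norm \<alpha> / 3 > 0" using d0 by simp
  have "norm d * norm \<alpha> / 3 * 2 ^ k - K \<le> norm (type_value q (concat (replicate k u) @ replicate r Sigma1) None)"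
    (is "_ \<le> norm (type_value q ?w None)") for k
  proof -
    let ?T = "fst (foldr (act q) ?w (1, 0)) + snd (foldr (act q) ?w (0, 1))"
    let ?W = "prod_list (map (id_weight q) ?w)"
    have T: "3 * ?T = c ^ k * (2 ^ k * \<alpha> + (1 / 2) ^ k * \<beta>)"
      unfolding foldr_concat_replicate foldr_Sigma1_first g(1) iterate_block[OF block] \<alpha>_def \<beta>_def
      by (simp add: field_simps)
    have "norm ((2 ^ k * \<alpha> + (1 / 2) ^ k * \<beta>) - (1 / 2) ^ k * \<beta>) \<le>
        norm (2 ^ k * \<alpha> + (1 / 2) ^ k * \<beta>) + norm ((1 / 2) ^ k * \<beta>)"
      by (rule norm_triangle_ineq4)
    moreover have "norm ((1 / 2) ^ k * \<beta>) \<le> norm \<beta>"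
    proof -
      have "(1 / 2 :: real) ^ k \<le> 1" by (simp add: power_le_one)
      then have "(1 / 2) ^ k * norm \<beta> \<le> 1 * norm \<beta>" by (intro mult_right_mono) simp_all
      then show ?thesis by (simp add: norm_mult norm_power norm_divide)
    qed
    ultimately have "2 ^ k * norm \<alpha> - norm \<beta> \<le> norm (2 ^ k * \<alpha> + (1 / 2) ^ k * \<beta>)"
      by (simp add: norm_mult norm_power)
    also have "\<dots> = norm (3 * ?T)" unfolding T by (simp add: norm_mult norm_power c)
    finally have T_ge: "2 ^ k * norm \<alpha> - norm \<beta> \<le> 3 * norm ?T" by (simp only: norm_mult norm_numeral)
    have "norm (id_weight q x) = 1" for x
      by (simp add: id_weight_def norm_q norm_inverse)
    then have "norm (prod_list (map (id_weight q) w)) = 1" for w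
      by (induction w) (simp_all add: norm_mult)
    then have W: "norm ((d ^ 3 - 2 * d) * ?W) = norm (d ^ 3 - 2 * d)"
      by (simp only: norm_mult mult_1_right)
    have tv: "type_value q ?w None = d * ?T + (d ^ 3 - 2 * d) * ?W"
      using type_value_None[of q ?w] unfolding d p .
    have "norm (d * ?T) - norm ((d ^ 3 - 2 * d) * ?W) \<le> norm (type_value q ?w None)"
      unfolding tv by (rule norm_diff_ineq)
    moreover have "norm d * (2 ^ k * norm \<alpha> - norm \<beta>) \<le> norm d * (3 * norm ?T)"
      using T_ge by (rule mult_left_mono) simp
    then have "norm d * norm \<alpha> / 3 * 2 ^ k - norm d * norm \<beta> / 3 \<le> norm (d * ?T)"
      unfolding norm_mult by (simp add: algebra_simps)
    ultimately show ?thesis unfolding W K_def by linarith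
  qed
  then show ?thesis using pos by blast
qed

end

lemma hyperbolic_parameter_exists: "\<exists>q. hyperbolic_parameter q (inverse q) (q + inverse q)"
proof -
  \<comment> \<open>On the unit circle \<open>q + inverse q\<close> is twice the real part, so 2 (2
    x)^2 = 1 gives x^2 = 1/8, and y^2 = 7/8 follows from modulus one.\<close>
  define x where "x = sqrt (1 / 8)"
  define y where "y = sqrt (7 / 8)"
  have xy: "x\<^sup>2 = 1 / 8" "y\<^sup>2 = 7 / 8" by (simp_all add: x_def y_def)
  let ?q = "Complex x y"
  have n: "norm ?q = 1" by (simp add: complex_norm xy)
  have "?q * Complex x (- y) = 1"
    using xy by (simp add: complex_eq_iff power2_eq_square)
  then have inv: "inverse ?q = Complex x (- y)" by (rule inverse_unique)
  have "2 * (?q + inverse ?q)\<^sup>2 = 1"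
    unfolding inv using xy by (simp add: complex_eq_iff power2_eq_square)
  then have "hyperbolic_parameter ?q (inverse ?q) (?q + inverse ?q)"
    using n by unfold_locales simp_all
  then show ?thesis by blast
qed

text \<open>There are finitely many residues modulo \<open>m\<close>, so the worst constants among
  them serve all lengths; the base is the \<open>m\<close>-th root of 2.\<close>

lemma exponential_from_blocks:
  fixes f :: "nat \<Rightarrow> real"
  assumes m: "m > 0" and blocks: "\<And>r. r < m \<Longrightarrow> \<exists>a>0. \<exists>K. \<forall>k. a * 2 ^ k - K \<le> f (k * m + r)"
  shows "\<exists>c>0. \<exists>b>1. \<forall>\<^sub>F n in sequentially. c * b ^ n \<le> f n"
proof -
  have "\<forall>r\<in>{..<m}. \<exists>a K. a > 0 \<and> (\<forall>k. a * 2 ^ k - K \<le> f (k * m + r))"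
    using blocks by fastforce
  then obtain a K where aK: "\<And>r. r < m \<Longrightarrow> a r > 0" "\<And>r k. r < m \<Longrightarrow> a r * 2 ^ k - K r \<le> f (k * m + r)"
    unfolding bchoice_iff by blast
  define a0 where "a0 = Min (a ` {..<m})"
  define K0 where "K0 = Max (K ` {..<m})"
  have ne: "a ` {..<m} \<noteq> {}" using m by blast
  have a0: "a0 > 0" unfolding a0_def using ne aK(1) by (subst Min_gr_iff) auto
  have bounds: "a0 \<le> a r" "K r \<le> K0" if "r < m" for r
    unfolding a0_def K0_def using that by (auto intro: Min_le Max_ge)
  define b where "b = root m (2 :: real)"
  have b: "b > 1" "b ^ m = 2" using m by (simp_all add: b_def)
  obtain N where N: "2 * K0 / a0 < 2 ^ N" using real_arch_pow[of 2 "2 * K0 / a0"] by auto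
  \<comment> \<open>Of the factor 1/4, one half pays for the incomplete block, where
    \<open>b ^ (n mod m)\<close> is at most 2, the other for the subtracted constant
    \<open>K0\<close>.\<close>
  have "a0 / 4 * b ^ n \<le> f n" if n: "n \<ge> N * m" for n
  proof -
    let ?k = "n div m" and ?r = "n mod m"
    have r: "?r < m" using m by simp
    have "N \<le> ?k" using n m by (simp add: less_eq_div_iff_mult_less_eq)
    then have "(2 :: real) ^ N \<le> 2 ^ ?k" by (intro power_increasing) simp_all
    then have "2 * K0 / a0 < 2 ^ ?k" using N by linarith
    then have K: "2 * K0 < a0 * 2 ^ ?k" using a0 by (simp add: field_simps)
    have "b ^ n = b ^ (m * ?k + ?r)" by simp
    also have "\<dots> = 2 ^ ?k * b ^ ?r" by (simp only: power_add power_mult b(2))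
    also have "b ^ ?r \<le> 2" unfolding b(2)[symmetric] using b(1) r by (intro power_increasing) simp_all
    finally have "b ^ n \<le> 2 ^ ?k * 2" by simp
    then have "a0 / 4 * b ^ n \<le> a0 / 4 * (2 ^ ?k * 2)" using a0 by (intro mult_left_mono) simp_all
    also have "\<dots> \<le> a0 * 2 ^ ?k - K0" using K by simp
    also have "\<dots> \<le> a ?r * 2 ^ ?k - K ?r"
      using bounds[OF r] by (intro diff_mono mult_right_mono) simp_all
    also have "\<dots> \<le> f (?k * m + ?r)" by (rule aK(2)[OF r])
    finally show ?thesis by simp
  qed
  then have "\<forall>\<^sub>F n in sequentially. a0 / 4 * b ^ n \<le> f n"
    by (rule eventually_sequentiallyI)
  then show ?thesis using a0 b(1) by (intro exI[of _ "a0 / 4"] conjI exI[of _ b]) simp_all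
qed

text \<open>The part of the argument that concerns only diagrams, shared by both algorithms and all
  coefficient rings.\<close>

definition exponential_bracket :: "piece list set \<Rightarrow> bool" where
  "exponential_bracket \<D> \<longleftrightarrow> (\<exists>q. norm q = 1 \<and> (\<exists>c>0. \<exists>b>1. \<forall>\<^sub>F n in sequentially.
     \<exists>D\<in>\<D>. length (crossings D) = n \<and> closed_diagram D \<and> c * b ^ n \<le> norm (bracket q D {})))"

lemma exponential_bracket_braids:
  assumes q: "hyperbolic_parameter q (inverse q) (q + inverse q)"
    and block: "\<And>a b. foldr (act q) u (a, b) =
      (c * hyperbolic_parameter.A1 q (inverse q) a b, c * hyperbolic_parameter.A2 (inverse q) a b)"
    and c: "norm c = 1" and u: "u \<noteq> []" "length u \<le> 6"
    and full: "\<exists>x\<in>set u. left_pos x = 0" "\<exists>x\<in>set u. left_pos x = 1"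
    and D: "\<And>w. full_braid w \<Longrightarrow> set w \<subseteq> set u \<union> {Sigma1} \<Longrightarrow> braid_closure w \<in> \<D>"
  shows "exponential_bracket \<D>"
proof -
  interpret hyperbolic_parameter q "inverse q" "q + inverse q" by (rule q)
  define word where "word n = concat (replicate (n div length u) u) @ replicate (n mod length u) Sigma1" for n
  have m: "length u > 0" using u(1) by simp
  have "\<exists>c>0. \<exists>b>1. \<forall>\<^sub>F n in sequentially. c * b ^ n \<le> norm (type_value q (word n) None)"
  proof (rule exponential_from_blocks[OF m])
    fix r assume r: "r < length u"
    have "word (k * length u + r) = concat (replicate k u) @ replicate r Sigma1" for k
      using r u(1) by (simp add: word_def)
    then show "\<exists>a>0. \<exists>K. \<forall>k. a * 2 ^ k - K \<le> norm (type_value q (word (k * length u + r)) None)"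
      using block_growth[OF block c, of r] r u(2) by simp
  qed
  then obtain c' b where cb: "c' > 0" "b > 1"
    "\<forall>\<^sub>F n in sequentially. c' * b ^ n \<le> norm (type_value q (word n) None)" by blast
  have "\<forall>\<^sub>F n in sequentially. \<exists>D\<in>\<D>. length (crossings D) = n \<and> closed_diagram D \<and>
      c' * b ^ n \<le> norm (bracket q D {})"
    using cb(3) eventually_ge_at_top[of "length u"]
  proof eventually_elim
    case (elim n)
    let ?w = "word n"
    have len: "length ?w = n" by (simp add: word_def length_concat sum_list_replicate)
    \<comment> \<open>From this length on a whole block occurs in the word, so that all columns are
      touched.\<close>
    have "n div length u > 0" using elim(2) m by (simp add: div_greater_zero_iff)
    then have "set u \<subseteq> set ?w" by (auto simp: word_def)
    then have w: "full_braid ?w" using full by (intro full_braidI) blast+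
    moreover have "set ?w \<subseteq> set u \<union> {Sigma1}" by (auto simp: word_def)
    ultimately have "braid_closure ?w \<in> \<D>" by (rule D)
    moreover have "c' * b ^ n \<le> norm (bracket q (braid_closure ?w) {})"
      using elim(1) full_braid.bracket_braid_closure[OF w] by simp
    moreover have "length (crossings (braid_closure ?w)) = n"
      by (simp only: crossings_braid_closure len)
    ultimately show ?case
      using full_braid.closed_braid_closure[OF w] by blast
  qed
  then show ?thesis unfolding exponential_bracket_def using norm_q cb(1,2) by blast
qed

lemma exponential_bracket_positive: "exponential_bracket positive_3_braid_closures"
proof -
  obtain q where q: "hyperbolic_parameter q (inverse q) (q + inverse q)"
    using hyperbolic_parameter_exists by blast
  show ?thesis
  proof (rule exponential_bracket_braids[OF q hyperbolic_parameter.act_positive_block[OF q]])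
    show "norm (q ^ 12) = 1"
      using hyperbolic_parameter.norm_q[OF q] by (simp add: norm_power)
  qed (auto simp: positive_3_braid_closures_def positive_word_def)
qed

lemma exponential_bracket_alternating: "exponential_bracket alternating_3_braid_closures"
proof -
  obtain q where q: "hyperbolic_parameter q (inverse q) (q + inverse q)"
    using hyperbolic_parameter_exists by blast
  show ?thesis
  proof (rule exponential_bracket_braids[OF q hyperbolic_parameter.act_alternating_block[OF q]])
    show "braid_closure w \<in> alternating_3_braid_closures"
      if "full_braid w" "set w \<subseteq> set [Sigma1, Sigma2_inv] \<union> {Sigma1}" for w
      using full_braid.alternating_braid_closure[OF that(1)] that(2)
      by (auto simp: alternating_3_braid_closures_def)
  qed simp_all
qed

lemma exponential_bracket_link_diagrams: "exponential_bracket {D. link_diagram D}"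
proof -
  have "\<forall>\<^sub>F n in sequentially. \<exists>D\<in>{D. link_diagram D}. length (crossings D) = n \<and>
      closed_diagram D \<and> 1 * 2 ^ n \<le> norm (bracket 1 D {})"
    using eventually_gt_at_top[of 0]
  proof eventually_elim
    case (elim n)
    have "norm (bracket 1 (kinks n) {}) = 2 ^ n"
      unfolding kinks_def by (subst bracket_kinks) (simp_all add: norm_power)
    then show ?case
      using link_diagram_kinks[OF elim] closed_kinks[of n]
      by (intro bexI[of _ "kinks n"]) (simp_all add: crossings_kinks)
  qed
  then show ?thesis
    unfolding exponential_bracket_def
    by (intro exI[of _ 1] conjI exI[of _ 1] exI[of _ 2]) simp_all
qed

lemma exponential_timeI:
  assumes "exponential_bracket \<D>" "\<And>D. D \<in> \<D> \<Longrightarrow> \<exists>t. run D t"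
    and ge: "\<And>D t q. run D t \<Longrightarrow> closed_diagram D \<Longrightarrow> norm q = 1 \<Longrightarrow> norm (bracket q D {}) \<le> real t"
  shows "exponential_time run \<D>"
proof -
  obtain q c b where q: "norm q = 1" and cb: "c > 0" "b > 1"
    and ev: "\<forall>\<^sub>F n in sequentially. \<exists>D\<in>\<D>. length (crossings D) = n \<and> closed_diagram D \<and>
      c * b ^ n \<le> norm (bracket q D {})"
    using assms(1) unfolding exponential_bracket_def by blast
  have "\<forall>\<^sub>F n in sequentially. \<exists>D\<in>\<D>. length (crossings D) = n \<and> c * b ^ n \<le> real (time D)"
    if "\<forall>D\<in>\<D>. run D (time D)" for time
    using ev
  proof eventually_elim
    case (elim n)
    then obtain D where D: "D \<in> \<D>" "length (crossings D) = n" "closed_diagram D"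
      "c * b ^ n \<le> norm (bracket q D {})" by blast
    then have "norm (bracket q D {}) \<le> real (time D)" using that ge q by blast
    then show ?case using D by (intro bexI[of _ D]) simp_all
  qed
  then show ?thesis
    unfolding exponential_time_def using assms(2) cb by blast
qed

theorem theorem1p2:
  fixes la_field :: "'k::field cpx \<Rightarrow> nat" and la_int :: "int cpx \<Rightarrow> nat"
  shows "\<forall>\<D> \<in> {{D. link_diagram D}, positive_3_braid_closures, alternating_3_braid_closures}.
    exponential_time (scanning_run la_field) \<D> \<and>
    exponential_time (scanning_run la_int) \<D> \<and>
    exponential_time (divide_conquer_run la_field) \<D> \<and>
    exponential_time (divide_conquer_run la_int) \<D>"
proof
  fix \<D> assume \<D>: "\<D> \<in> {{D. link_diagram D}, positive_3_braid_closures, alternating_3_braid_closures}"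
  then have exp: "exponential_bracket \<D>"
    using exponential_bracket_link_diagrams exponential_bracket_positive exponential_bracket_alternating
    by blast
  have "D \<noteq> []" if "D \<in> \<D>" for D
    using \<D> that
    by (auto simp: braid_closure_nonempty braid_closure_nonempty[symmetric] link_diagram_def
        positive_3_braid_closures_def alternating_3_braid_closures_def)
  then show "exponential_time (scanning_run la_field) \<D> \<and>
    exponential_time (scanning_run la_int) \<D> \<and>
    exponential_time (divide_conquer_run la_field) \<D> \<and>
    exponential_time (divide_conquer_run la_int) \<D>"
    by (intro conjI exponential_timeI[OF exp] scanning_run_exists divide_conquer_run_exists
        scanning_run_ge divide_conquer_run_ge)
qed

end
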